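(* Let $[\mathbf G_1,\mathbf o_1]$ and $[\mathbf G_2,\mathbf o_2]$ be (not necessarily unimodular) random rooted networks. Consider the following conditions. (B) The distribution of each one is obtained from that of the other by a biasing and then a root-change. (R) The distribution of $[\mathbf G_2,\mathbf o_2]$ is obtained from $[\mathbf G_1,\mathbf o_1]$ by a root-change. (C) There is a coupling of them (a probability measure on $\mathcal G_*\times\mathcal G_*$ whose marginals are the distributions of $[\mathbf G_1,\mathbf o_1]$ and $[\mathbf G_2,\mathbf o_2]$) which is concentrated on the set $\{([G_1,o_1],[G_2,o_2]):[G_1]=[G_2]\}$. (D) There is a random doubly-rooted network $[\mathbf G,\mathbf o,\mathbf o']$ (random element of $\mathcal G_{**}$) such that $[\mathbf G,\mathbf o]$ and $[\mathbf G,\mathbf o']$ have the same distributions as $[\mathbf G_1,\mathbf o_1]$ and $[\mathbf G_2,\mathbf o_2]$ respectively. (F) The random non-rooted networks $[\mathbf G_1]$ and $[\mathbf G_2]$ have the same distribution on $(\mathcal G,J)$; equivalently, the distributions of $[\mathbf G_1,\mathbf o_1]$ and $[\mathbf G_2,\mathbf o_2]$ agree on the invariant sigma-field $I$. Then conditions (R), (C), (D) and (F) are equivalent, and they imply condition (B).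
   Context: Networks. Fix a complete separable metric space $\Xi$ (the mark space). A network is a connected, locally finite (every vertex has finite degree) multigraph $G$ with vertex set $V(G)$, together with a mark in $\Xi$ for each vertex $v$ and for each pair $(v,e)$ with $e$ an edge incident to $v$. A rooted network $(G,o)$ is a network with a distinguished vertex $o$; a doubly-rooted network $(G,o,v)$ has an ordered pair of distinguished vertices. Isomorphisms preserve marks and distinguished vertices. $\mathcal G$, $\mathcal G_*$ and $\mathcal G_{**}$ are the sets of isomorphism classes $[G]$, $[G,o]$ and $[G,o,v]$ of networks, rooted networks and doubly-rooted networks. $\mathcal G_*$ and $\mathcal G_{**}$ carry the Borel sigma-fields of the (Polish) local topologies: $[G_n,o_n]\to[G,o]$ iff for all $r\in\mathbb N$ and $\varepsilon>0$, for all large $n$ there is a graph isomorphism between the balls of radius $r$ about the roots that maps root to root and for which corresponding marks are at distance less than $\varepsilon$; for $\mathcal G_{**}$ one uses balls about the first root, with $r$ at least the distance of the two roots in the limit, and isomorphisms must also map second root to second root. For a function $f$ we write $f[G,o]$ for $f([G,o])$, etc. $\pi:\mathcal G_*\to\mathcal G$ is $\pi[G,o]=[G]$, and $J=\{B\subseteq\mathcal G:\pi^{-1}(B)\text{ is measurable}\}$. A random rooted network $[\mathbf G,\mathbf o]$ is a random element of $\mathcal G_*$; its random non-rooted network $[\mathbf G]$ is its image under $\pi$, a random element of $(\mathcal G,J)$. Invariant sigma-field $I$: the family of measurable $A\subseteq\mathcal G_*$ such that $[G,o]\in A$ and $v\in V(G)$ imply $[G,v]\in A$. Biasing a probability measure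 $\mu$ on $\mathcal G_*$ by a measurable $w:\mathcal G_*\to\mathbb R^{\ge0}$ with $0<\int w\,d\mu<\infty$ gives the probability measure $A\mapsto \frac{1}{\int w\,d\mu}\int w1_A\,d\mu$. Root-change: let $T:\mathcal G_{**}\to\mathbb R^{\ge0}$ be measurable, write $T_G(u,v)=T[G,u,v]$ and $T_G^+(o)=\sum_{v\in V(G)}T_G(o,v)$, and assume $T_{\mathbf G}^+(\mathbf o)=1$ a.s. Any random rooted network with distribution $A\mapsto \mathbb E\big[\sum_{v\in V(\mathbf G)}T_{\mathbf G}(\mathbf o,v)1_A[\mathbf G,v]\big]$ is called the root-change of $[\mathbf G,\mathbf o]$ by kernel $T$. "Obtained by a root-change" means that such a $T$ exists; similarly "by a biasing" means for some such $w$. *)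

theory Defs
  imports "HOL-Probability.Probability"
begin

section \<open>Networks\<close>

text \<open>
  A connected locally finite multigraph has countably many vertices and edges, so every
  isomorphism class has a representative whose vertices and edges are natural numbers.
  Parallel edges and loops are allowed: \<open>ends G e\<close> is a set with two elements, or with one element
  if \<open>e\<close> is a loop. The mark of the pair \<open>(v, e)\<close> is \<open>emark G v e\<close>; marks of pairs that are not
  incident, and all data outside \<open>verts G\<close> and \<open>edges G\<close>, are irrelevant.
\<close>

record 'x net =
  verts :: "nat set"
  edges :: "nat set"
  ends :: "nat \<Rightarrow> nat set"
  vmark :: "nat \<Rightarrow> 'x"
  emark :: "nat \<Rightarrow> nat \<Rightarrow> 'x"

definition adj :: "'x net \<Rightarrow> (nat \<times> nat) set" where
  "adj G = {(u, v). \<exists>e\<in>edges G. ends G e = {u, v}}"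

definition network :: "'x net \<Rightarrow> bool" where
  "network G \<longleftrightarrow>
     verts G \<noteq> {} \<and>
     (\<forall>e\<in>edges G. \<exists>u\<in>verts G. \<exists>v\<in>verts G. ends G e = {u, v}) \<and>
     (\<forall>v\<in>verts G. finite {e \<in> edges G. v \<in> ends G e}) \<and>
     (\<forall>u\<in>verts G. \<forall>v\<in>verts G. (u, v) \<in> (adj G)\<^sup>*)"

text \<open>
  A multigraph isomorphism, given by a vertex bijection and an edge bijection, such that
  corresponding marks are related by \<open>R\<close>. With \<open>R\<close> the equality this is an isomorphism of networks.
\<close>

definition net_iso :: "('x \<Rightarrow> 'x \<Rightarrow> bool) \<Rightarrow> (nat \<Rightarrow> nat) \<Rightarrow> (nat \<Rightarrow> nat) \<Rightarrow> 'x net \<Rightarrow> 'x net \<Rightarrow> bool"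
where
  "net_iso R f g G H \<longleftrightarrow>
     bij_betw f (verts G) (verts H) \<and>
     bij_betw g (edges G) (edges H) \<and>
     (\<forall>e\<in>edges G. ends H (g e) = f ` ends G e) \<and>
     (\<forall>v\<in>verts G. R (vmark G v) (vmark H (f v))) \<and>
     (\<forall>e\<in>edges G. \<forall>v\<in>ends G e. R (emark G v e) (emark H (f v) (g e)))"

definition gdist :: "'x net \<Rightarrow> nat \<Rightarrow> nat \<Rightarrow> nat" where
  "gdist G u v = (LEAST k. (u, v) \<in> adj G ^^ k)"

definition induced :: "'x net \<Rightarrow> nat set \<Rightarrow> 'x net" where
  "induced G S = G\<lparr>verts := S, edges := {e \<in> edges G. ends G e \<subseteq> S}\<rparr>"

definition net_ball :: "'x net \<Rightarrow> nat \<Rightarrow> nat \<Rightarrow> 'x net" where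
  "net_ball G u r = induced G {v \<in> verts G. gdist G u v \<le> r}"

subsection \<open>Basic facts about isomorphisms\<close>

lemma verts_net_ball [simp]: "verts (net_ball G u r) = {v \<in> verts G. gdist G u v \<le> r}"
  and edges_net_ball [simp]:
    "edges (net_ball G u r) = {e \<in> edges G. ends G e \<subseteq> {v \<in> verts G. gdist G u v \<le> r}}"
  and ends_net_ball [simp]: "ends (net_ball G u r) = ends G"
  and vmark_net_ball [simp]: "vmark (net_ball G u r) = vmark G"
  and emark_net_ball [simp]: "emark (net_ball G u r) = emark G"
  by (simp_all add: net_ball_def induced_def)

lemma network_ends:
  assumes "network G" "e \<in> edges G"
  shows "ends G e \<subseteq> verts G"
proof -
  from assms(1) have "\<forall>e\<in>edges G. \<exists>u\<in>verts G. \<exists>v\<in>verts G. ends G e = {u, v}"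
    unfolding network_def by (elim conjE)
  with assms(2) obtain u v where "u \<in> verts G" "v \<in> verts G" "ends G e = {u, v}" by auto
  then show ?thesis by simp
qed

lemma adj_verts: "network G \<Longrightarrow> (u, v) \<in> adj G \<Longrightarrow> u \<in> verts G \<and> v \<in> verts G"
  unfolding adj_def using network_ends[of G] by blast

lemma net_iso_id: "(\<And>x. R x x) \<Longrightarrow> net_iso R id id G G"
  unfolding net_iso_def by simp

lemma net_iso_comp:
  assumes 1: "net_iso R f g G H" and 2: "net_iso S f' g' H K"
    and ends: "\<And>e. e \<in> edges H \<Longrightarrow> ends H e \<subseteq> verts H"
  shows "net_iso (R OO S) (f' \<circ> f) (g' \<circ> g) G K"
proof -
  have fm: "f v \<in> verts H" if "v \<in> verts G" for v
    using 1 that unfolding net_iso_def bij_betw_def by blast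
  have gm: "g e \<in> edges H" if "e \<in> edges G" for e
    using 1 that unfolding net_iso_def bij_betw_def by blast
  have em: "f v \<in> ends H (g e)" if "e \<in> edges G" "v \<in> ends G e" for e v
    using 1 that unfolding net_iso_def by blast
  show ?thesis
    unfolding net_iso_def
  proof (intro conjI ballI)
    show "bij_betw (f' \<circ> f) (verts G) (verts K)"
      using 1 2 unfolding net_iso_def by (blast intro: bij_betw_trans)
    show "bij_betw (g' \<circ> g) (edges G) (edges K)"
      using 1 2 unfolding net_iso_def by (blast intro: bij_betw_trans)
    show "ends K ((g' \<circ> g) e) = (f' \<circ> f) ` ends G e" if "e \<in> edges G" for e
      using 1 2 gm[OF that] that unfolding net_iso_def by (simp add: image_comp)
    show "(R OO S) (vmark G v) (vmark K ((f' \<circ> f) v))" if "v \<in> verts G" for v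
      using 1 2 fm[OF that] that unfolding net_iso_def by auto
    show "(R OO S) (emark G v e) (emark K ((f' \<circ> f) v) ((g' \<circ> g) e))"
      if "e \<in> edges G" "v \<in> ends G e" for e v
    proof -
      have "R (emark G v e) (emark H (f v) (g e))"
        using 1 that by (simp add: net_iso_def)
      moreover have "S (emark H (f v) (g e)) (emark K (f' (f v)) (g' (g e)))"
        using 2 gm[OF that(1)] em[OF that] by (simp add: net_iso_def)
      ultimately show ?thesis by auto
    qed
  qed
qed

lemma net_iso_inv:
  assumes 1: "net_iso R f g G H" and ends: "\<And>e. e \<in> edges G \<Longrightarrow> ends G e \<subseteq> verts G"
  shows "net_iso (R\<inverse>\<inverse>) (inv_into (verts G) f) (inv_into (edges G) g) H G"
proof -
  let ?f = "inv_into (verts G) f" and ?g = "inv_into (edges G) g"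
  have bf: "bij_betw f (verts G) (verts H)" and bg: "bij_betw g (edges G) (edges H)"
    using 1 unfolding net_iso_def by auto
  have vs: "\<exists>v\<in>verts G. w = f v \<and> ?f w = v" if "w \<in> verts H" for w
    using that bf by (metis bij_betw_def bij_betw_inv_into_left image_iff)
  have es: "\<exists>e\<in>edges G. d = g e \<and> ?g d = e" if "d \<in> edges H" for d
    using that bg by (metis bij_betw_def bij_betw_inv_into_left image_iff)
  have inj: "inj_on f (verts G)" using bf by (simp add: bij_betw_def)
  have inv_im: "?f ` f ` A = A" if "A \<subseteq> verts G" for A
    using that inj by (simp add: inv_into_image_cancel)
  show ?thesis
    unfolding net_iso_def
  proof (intro conjI ballI)
    show "bij_betw ?f (verts H) (verts G)" "bij_betw ?g (edges H) (edges G)"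
      using bf bg by (auto intro: bij_betw_inv_into)
    show "ends G (?g d) = ?f ` ends H d" if "d \<in> edges H" for d
      using es[OF that] 1 ends inv_im unfolding net_iso_def by metis
    show "(R\<inverse>\<inverse>) (vmark H w) (vmark G (?f w))" if "w \<in> verts H" for w
      using vs[OF that] 1 unfolding net_iso_def by auto
    show "(R\<inverse>\<inverse>) (emark H w d) (emark G (?f w) (?g d))"
      if d: "d \<in> edges H" and w: "w \<in> ends H d" for d w
    proof -
      from es[OF d] obtain e where e: "e \<in> edges G" "d = g e" "?g d = e" by blast
      then obtain v where v: "v \<in> ends G e" "w = f v"
        using w 1 unfolding net_iso_def by blast
      then have "?f w = v" using ends[OF e(1)] inj by auto
      with v e 1 show ?thesis unfolding net_iso_def by auto
    qed
  qed
qed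

lemma net_iso_mono: "net_iso R f g G H \<Longrightarrow> (\<And>x y. R x y \<Longrightarrow> S x y) \<Longrightarrow> net_iso S f g G H"
  unfolding net_iso_def by blast

lemma net_iso_adj:
  assumes "net_iso R f g G H" "(u, v) \<in> adj G"
  shows "(f u, f v) \<in> adj H"
proof -
  from assms(2) obtain e where "e \<in> edges G" "ends G e = {u, v}" unfolding adj_def by blast
  moreover from this have "g e \<in> edges H" "ends H (g e) = {f u, f v}"
    using assms(1) unfolding net_iso_def bij_betw_def by auto
  ultimately show ?thesis unfolding adj_def by blast
qed

lemma net_iso_relpow:
  assumes "net_iso R f g G H" "(u, v) \<in> adj G ^^ k"
  shows "(f u, f v) \<in> adj H ^^ k"
  using assms(2)
proof (induction k arbitrary: v)
  case (Suc k)
  then obtain w where "(u, w) \<in> adj G ^^ k" "(w, v) \<in> adj G" by auto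
  with Suc.IH net_iso_adj[OF assms(1)] show ?case by auto
qed simp

lemma net_iso_gdist:
  assumes "net_iso R f g G H" "network G" "u \<in> verts G" "v \<in> verts G"
  shows "gdist H (f u) (f v) = gdist G u v"
proof -
  let ?f = "inv_into (verts G) f"
  have inj: "inj_on f (verts G)"
    using assms(1) unfolding net_iso_def bij_betw_def by blast
  have i: "net_iso (R\<inverse>\<inverse>) ?f (inv_into (edges G) g) H G"
    using net_iso_inv[OF assms(1)] network_ends[OF assms(2)] by blast
  have "(f u, f v) \<in> adj H ^^ k \<longleftrightarrow> (u, v) \<in> adj G ^^ k" for k
    using net_iso_relpow[OF assms(1), of u v k] net_iso_relpow[OF i, of "f u" "f v" k] inj assms(3,4)
    by auto
  then show ?thesis unfolding gdist_def by simp
qed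

lemma net_iso_ball:
  assumes i: "net_iso R f g G H" and G: "network G" and H: "network H" and u: "u \<in> verts G"
  shows "net_iso R f g (net_ball G u r) (net_ball H (f u) r)"
proof -
  have bf: "bij_betw f (verts G) (verts H)" and bg: "bij_betw g (edges G) (edges H)"
    and ends: "\<And>e. e \<in> edges G \<Longrightarrow> ends H (g e) = f ` ends G e"
    using i unfolding net_iso_def by auto
  let ?S = "{v \<in> verts G. gdist G u v \<le> r}" and ?S' = "{v \<in> verts H. gdist H (f u) v \<le> r}"
  have d: "gdist H (f u) (f v) = gdist G u v" if "v \<in> verts G" for v
    using net_iso_gdist[OF i G u that] .
  have fv: "bij_betw f ?S ?S'"
    using bf d by (intro bij_betw_Collect) auto
  have sub: "f ` ends G e \<subseteq> ?S' \<longleftrightarrow> ends G e \<subseteq> ?S" if "e \<in> edges G" for e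
  proof -
    have "ends G e \<subseteq> verts G" using network_ends[OF G that] .
    moreover have "f ` verts G = verts H" using bf by (simp add: bij_betw_def)
    ultimately show ?thesis using d by (auto simp: subset_iff)
  qed
  have ge: "bij_betw g {e \<in> edges G. ends G e \<subseteq> ?S} {e \<in> edges H. ends H e \<subseteq> ?S'}"
    using bg by (rule bij_betw_Collect) (simp add: ends sub)
  show ?thesis using i fv ge unfolding net_iso_def by simp
qed

section \<open>Isomorphism classes\<close>

definition iso0 :: "'x net \<Rightarrow> 'x net \<Rightarrow> bool" where
  "iso0 G H \<longleftrightarrow> network G \<and> network H \<and> (\<exists>f g. net_iso (=) f g G H)"

fun iso1 :: "'x net \<times> nat \<Rightarrow> 'x net \<times> nat \<Rightarrow> bool" where
  "iso1 (G, u) (H, u') \<longleftrightarrow> network G \<and> network H \<and> u \<in> verts G \<and> u' \<in> verts H \<and>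
     (\<exists>f g. net_iso (=) f g G H \<and> f u = u')"

fun iso2 :: "'x net \<times> nat \<times> nat \<Rightarrow> 'x net \<times> nat \<times> nat \<Rightarrow> bool" where
  "iso2 (G, u, v) (H, u', v') \<longleftrightarrow>
     network G \<and> network H \<and> u \<in> verts G \<and> v \<in> verts G \<and> u' \<in> verts H \<and> v' \<in> verts H \<and>
     (\<exists>f g. net_iso (=) f g G H \<and> f u = u' \<and> f v = v')"

lemma network_ex: "network \<lparr>verts = {0}, edges = {}, ends = (\<lambda>_. {}), vmark = m, emark = m'\<rparr>"
  unfolding network_def by simp

lemma net_iso_eq_inv:
  assumes "net_iso (=) f g G H" "network G"
  obtains f' g' where "net_iso (=) f' g' H G" "\<And>v. v \<in> verts G \<Longrightarrow> f' (f v) = v"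
proof
  show "net_iso (=) (inv_into (verts G) f) (inv_into (edges G) g) H G"
    using net_iso_inv[OF assms(1) network_ends[OF assms(2)]] by simp
  show "inv_into (verts G) f (f v) = v" if "v \<in> verts G" for v
    using assms(1) that unfolding net_iso_def by (meson bij_betw_inv_into_left)
qed

lemma net_iso_eq_comp:
  assumes "net_iso (=) f g G H" "net_iso (=) f' g' H K" "network H"
  shows "net_iso (=) (f' \<circ> f) (g' \<circ> g) G K"
  using net_iso_comp[OF assms(1,2) network_ends[OF assms(3)]] by (simp add: eq_OO)

lemma part_equivp_iso0: "part_equivp iso0"
proof (rule part_equivpI)
  let ?G = "\<lparr>verts = {0}, edges = {}, ends = (\<lambda>_. {}), vmark = undefined, emark = undefined\<rparr> :: 'a net"
  have "network ?G" by (rule network_ex)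
  moreover have "net_iso (=) id id ?G ?G" by (rule net_iso_id) (rule refl)
  ultimately show "\<exists>x::'a net. iso0 x x" unfolding iso0_def by (intro exI[of _ ?G]) auto
  show "symp (iso0 :: 'a net \<Rightarrow> _)"
  proof (rule sympI)
    fix G H :: "'a net" assume "iso0 G H"
    then obtain f g where "network G" "network H" "net_iso (=) f g G H"
      unfolding iso0_def by blast
    moreover from net_iso_eq_inv[OF this(3,1)] obtain f' g' where "net_iso (=) f' g' H G" .
    ultimately show "iso0 H G" unfolding iso0_def by blast
  qed
  show "transp (iso0 :: 'a net \<Rightarrow> _)"
  proof (rule transpI)
    fix G H K :: "'a net" assume "iso0 G H" "iso0 H K"
    then obtain f g f' g' where *: "network G" "network H" "network K"
        "net_iso (=) f g G H" "net_iso (=) f' g' H K"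
      unfolding iso0_def by blast
    from net_iso_eq_comp[OF *(4,5,2)] * show "iso0 G K" unfolding iso0_def by blast
  qed
qed

lemma part_equivp_iso1: "part_equivp iso1"
proof (rule part_equivpI)
  have "iso1 (\<lparr>verts = {0}, edges = {}, ends = (\<lambda>_. {}), vmark = undefined, emark = undefined\<rparr>, 0)
    (\<lparr>verts = {0}, edges = {}, ends = (\<lambda>_. {}), vmark = undefined, emark = undefined\<rparr> :: 'a net, 0)"
    using network_ex net_iso_id[of "(=)"] by fastforce
  then show "\<exists>x::'a net \<times> nat. iso1 x x" by blast
  show "symp (iso1 :: 'a net \<times> nat \<Rightarrow> _)"
    by (rule sympI) (clarsimp, metis net_iso_eq_inv)
  show "transp (iso1 :: 'a net \<times> nat \<Rightarrow> _)"
    by (rule transpI) (clarsimp, metis net_iso_eq_comp comp_apply)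
qed

lemma part_equivp_iso2: "part_equivp iso2"
proof (rule part_equivpI)
  have "iso2 (\<lparr>verts = {0}, edges = {}, ends = (\<lambda>_. {}), vmark = undefined, emark = undefined\<rparr>, 0, 0)
    (\<lparr>verts = {0}, edges = {}, ends = (\<lambda>_. {}), vmark = undefined, emark = undefined\<rparr> :: 'a net, 0, 0)"
    using network_ex net_iso_id[of "(=)"] by fastforce
  then show "\<exists>x::'a net \<times> nat \<times> nat. iso2 x x" by blast
  show "symp (iso2 :: 'a net \<times> nat \<times> nat \<Rightarrow> _)"
    by (rule sympI) (clarsimp, metis net_iso_eq_inv)
  show "transp (iso2 :: 'a net \<times> nat \<times> nat \<Rightarrow> _)"
    by (rule transpI) (clarsimp, metis net_iso_eq_comp comp_apply)
qed

text \<open>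
  The three spaces of isomorphism classes. For a network \<open>G\<close> and vertices \<open>u\<close>, \<open>v\<close> of \<open>G\<close>, the
  classes of \<open>G\<close>, of \<open>G\<close> with root \<open>u\<close> and of \<open>G\<close> with roots \<open>u\<close>, \<open>v\<close> are \<open>cls G\<close>,
  \<open>rcls (G, u)\<close> and \<open>bcls (G, u, v)\<close>.
\<close>

quotient_type 'x network_class = "'x net" / partial: iso0
  morphisms rep_cls cls
  by (rule part_equivp_iso0)

quotient_type 'x rooted = "'x net \<times> nat" / partial: iso1
  morphisms rep_rcls rcls
  by (rule part_equivp_iso1)

quotient_type 'x birooted = "'x net \<times> nat \<times> nat" / partial: iso2
  morphisms rep_bcls bcls
  by (rule part_equivp_iso2)

lift_definition unroot :: "'x rooted \<Rightarrow> 'x network_class" is "\<lambda>(G, u). G"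
  subgoal for x y
    by (cases x; cases y; hypsubst; unfold prod.case iso1.simps iso0_def; elim conjE exE;
        intro conjI exI; assumption)
  done

lift_definition root1 :: "'x birooted \<Rightarrow> 'x rooted" is "\<lambda>(G, u, v). (G, u)"
  subgoal for x y
    by (cases x; cases y; hypsubst; unfold prod.case iso1.simps iso2.simps; elim conjE exE;
        intro conjI exI; assumption)
  done

lift_definition root2 :: "'x birooted \<Rightarrow> 'x rooted" is "\<lambda>(G, u, v). (G, v)"
  subgoal for x y
    by (cases x; cases y; hypsubst; unfold prod.case iso1.simps iso2.simps; elim conjE exE;
        intro conjI exI; assumption)
  done

lemma iso1_refl: "network G \<Longrightarrow> u \<in> verts G \<Longrightarrow> iso1 (G, u) (G, u)"
  using net_iso_id[of "(=)" G] by auto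

lemma iso2_refl: "network G \<Longrightarrow> u \<in> verts G \<Longrightarrow> v \<in> verts G \<Longrightarrow> iso2 (G, u, v) (G, u, v)"
  using net_iso_id[of "(=)" G] by auto

lemma rooted_cases:
  obtains G u where "network G" "u \<in> verts G" "x = rcls (G, u)"
proof -
  have "iso1 (rep_rcls x) (rep_rcls x)" "rcls (rep_rcls x) = x"
    using Quotient_rooted by (auto simp: Quotient_def)
  then show thesis using that by (cases "rep_rcls x") auto
qed

lemma birooted_cases:
  obtains G u v where "network G" "u \<in> verts G" "v \<in> verts G" "x = bcls (G, u, v)"
proof -
  have "iso2 (rep_bcls x) (rep_bcls x)" "bcls (rep_bcls x) = x"
    using Quotient_birooted by (auto simp: Quotient_def)
  then show thesis using that by (cases "rep_bcls x") auto
qed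

lemma unroot_rcls [simp]: "network G \<Longrightarrow> u \<in> verts G \<Longrightarrow> unroot (rcls (G, u)) = cls G"
  using unroot.abs_eq[of "(G, u)"] iso1_refl[of G u] by (simp add: eq_onp_def)

lemma root1_bcls [simp]:
  "network G \<Longrightarrow> u \<in> verts G \<Longrightarrow> v \<in> verts G \<Longrightarrow> root1 (bcls (G, u, v)) = rcls (G, u)"
  using root1.abs_eq[of "(G, u, v)"] iso2_refl[of G u v] by (simp add: eq_onp_def)

lemma root2_bcls [simp]:
  "network G \<Longrightarrow> u \<in> verts G \<Longrightarrow> v \<in> verts G \<Longrightarrow> root2 (bcls (G, u, v)) = rcls (G, v)"
  using root2.abs_eq[of "(G, u, v)"] iso2_refl[of G u v] by (simp add: eq_onp_def)

lemma bcls_eqI: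
  assumes "iso2 a b" shows "bcls a = bcls b"
  using assms Quotient_rel_abs[OF Quotient_birooted] by blast

text \<open>
  The sum of \<open>h [G, u, v]\<close> over \<open>v\<close>, with values in \<open>[0, \<infinity>]\<close>. It runs over the vertices of \<open>G\<close>, not
  over the classes \<open>[G, u, v]\<close>: vertices exchanged by an automorphism are counted separately.
\<close>

lift_definition root_sum :: "('x birooted \<Rightarrow> ennreal) \<Rightarrow> 'x rooted \<Rightarrow> ennreal"
  is "\<lambda>h (G, u). \<integral>\<^sup>+ v. h (bcls (G, u, v)) \<partial>count_space (verts G)"
proof (clarsimp)
  fix h :: "'x birooted \<Rightarrow> ennreal" and G H :: "'x net" and u f g
  assume G: "network G" and H: "network H" and u: "u \<in> verts G" and fu: "f u \<in> verts H"
    and i: "net_iso (=) f g G H"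
  have bf: "bij_betw f (verts G) (verts H)" using i unfolding net_iso_def by blast
  have "(\<integral>\<^sup>+ v. h (bcls (H, f u, v)) \<partial>count_space (verts H)) =
        (\<integral>\<^sup>+ v. h (bcls (H, f u, f v)) \<partial>count_space (verts G))"
    using nn_integral_bij_count_space[OF bf, of "\<lambda>v. h (bcls (H, f u, v))"] by simp
  also have "\<dots> = (\<integral>\<^sup>+ v. h (bcls (G, u, v)) \<partial>count_space (verts G))"
  proof (rule nn_integral_cong)
    fix v assume "v \<in> space (count_space (verts G))"
    then have v: "v \<in> verts G" by simp
    then have "f v \<in> verts H" using bf by (auto simp: bij_betw_def)
    then have "iso2 (G, u, v) (H, f u, f v)" using G H u fu i v by auto
    then have "bcls (G, u, v) = bcls (H, f u, f v)" by (rule bcls_eqI)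
    then show "h (bcls (H, f u, f v)) = h (bcls (G, u, v))" by simp
  qed
  finally show "(\<integral>\<^sup>+ v. h (bcls (G, u, v)) \<partial>count_space (verts G)) =
    (\<integral>\<^sup>+ v. h (bcls (H, f u, v)) \<partial>count_space (verts H))" by simp
qed

lemma root_sum_rcls:
  "network G \<Longrightarrow> u \<in> verts G \<Longrightarrow>
    root_sum h (rcls (G, u)) = (\<integral>\<^sup>+ v. h (bcls (G, u, v)) \<partial>count_space (verts G))"
  using root_sum.abs_eq[of "(G, u)" h] iso1_refl[of G u] by (simp add: eq_onp_def)

section \<open>Local topologies\<close>

lemma net_iso_conj:
  assumes i: "net_iso R f g A B" and 1: "net_iso (=) p q A' A" and 2: "net_iso (=) p' q' B B'"
    and "\<And>e. e \<in> edges A \<Longrightarrow> ends A e \<subseteq> verts A" "\<And>e. e \<in> edges B \<Longrightarrow> ends B e \<subseteq> verts B"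
  shows "net_iso R (p' \<circ> (f \<circ> p)) (q' \<circ> (g \<circ> q)) A' B'"
  using net_iso_comp[OF net_iso_comp[OF 1 i assms(4)] 2 assms(5)] by (simp add: eq_OO OO_eq)

lemma near1_rsp:
  assumes "iso1 (G, u) (G', u')" "iso1 (H, v) (H', v')"
    and "\<exists>f g. net_iso R f g (net_ball G u r) (net_ball H v r) \<and> f u = v"
  shows "\<exists>f g. net_iso R f g (net_ball G' u' r) (net_ball H' v' r) \<and> f u' = v'"
proof -
  from assms obtain f g p q p' q' where i: "net_iso R f g (net_ball G u r) (net_ball H v r)" "f u = v"
    and 1: "net_iso (=) p q G G'" "p u = u'" and 2: "net_iso (=) p' q' H H'" "p' v = v'"
    and G: "network G" "network G'" "u \<in> verts G" "u' \<in> verts G'"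
    and H: "network H" "network H'" "v \<in> verts H" "v' \<in> verts H'" by auto
  obtain s t where s: "net_iso (=) s t G' G" "s u' = u"
    using net_iso_eq_inv[OF 1(1) G(1)] 1(2) G(3) by metis
  have "net_iso (=) s t (net_ball G' u' r) (net_ball G u r)"
    using net_iso_ball[OF s(1) G(2,1,4), of r] s(2) by simp
  moreover have "net_iso (=) p' q' (net_ball H v r) (net_ball H' v' r)"
    using net_iso_ball[OF 2(1) H(1-3), of r] 2(2) by simp
  ultimately have "net_iso R (p' \<circ> (f \<circ> s)) (q' \<circ> (g \<circ> t)) (net_ball G' u' r) (net_ball H' v' r)"
    using i(1) by (intro net_iso_conj) auto
  then have "net_iso R (p' \<circ> (f \<circ> s)) (q' \<circ> (g \<circ> t)) (net_ball G' u' r) (net_ball H' v' r) \<and>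
      (p' \<circ> (f \<circ> s)) u' = v'"
    using i s 2 by simp
  then show ?thesis by (intro exI)
qed

text \<open>
  \<open>near1 r \<epsilon> x y\<close>: the balls of radius \<open>r\<close> about the roots admit a root-preserving graph
  isomorphism under which corresponding marks are at distance less than \<open>\<epsilon>\<close>. In \<open>near2\<close> the
  ball is about the first root and has to contain the second root of \<open>x\<close>.
\<close>

lift_definition near1 :: "nat \<Rightarrow> real \<Rightarrow> 'x::metric_space rooted \<Rightarrow> 'x rooted \<Rightarrow> bool"
  is "\<lambda>r \<epsilon> (G, u) (H, u'). \<exists>f g.
        net_iso (\<lambda>a b. dist a b < \<epsilon>) f g (net_ball G u r) (net_ball H u' r) \<and> f u = u'"
  subgoal for r \<epsilon> x x' y y'
    by (cases x; cases x'; cases y; cases y'; hypsubst; unfold prod.case; rule iffI;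
        erule near1_rsp[rotated 2]; (assumption | erule part_equivp_symp[OF part_equivp_iso1]))
  done

lemma near2_rsp:
  assumes "iso2 (G, u, w) (G', u', w')" "iso2 (H, v, z) (H', v', z')"
    and "gdist G u w \<le> r \<and> (\<exists>f g. net_iso R f g (net_ball G u r) (net_ball H v r) \<and> f u = v \<and> f w = z)"
  shows "gdist G' u' w' \<le> r \<and>
    (\<exists>f g. net_iso R f g (net_ball G' u' r) (net_ball H' v' r) \<and> f u' = v' \<and> f w' = z')"
proof -
  from assms obtain f g p q p' q' where i: "net_iso R f g (net_ball G u r) (net_ball H v r)" "f u = v"
      "f w = z" and d: "gdist G u w \<le> r"
    and 1: "net_iso (=) p q G G'" "p u = u'" "p w = w'"
    and 2: "net_iso (=) p' q' H H'" "p' v = v'" "p' z = z'"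
    and G: "network G" "network G'" "u \<in> verts G" "u' \<in> verts G'" "w \<in> verts G"
    and H: "network H" "network H'" "v \<in> verts H" "v' \<in> verts H'" by auto
  obtain s t where s: "net_iso (=) s t G' G" "s u' = u" "s w' = w"
    using net_iso_eq_inv[OF 1(1) G(1)] 1(2,3) G(3,5) by metis
  have "net_iso (=) s t (net_ball G' u' r) (net_ball G u r)"
    using net_iso_ball[OF s(1) G(2,1,4), of r] s(2) by simp
  moreover have "net_iso (=) p' q' (net_ball H v r) (net_ball H' v' r)"
    using net_iso_ball[OF 2(1) H(1-3), of r] 2(2) by simp
  ultimately have "net_iso R (p' \<circ> (f \<circ> s)) (q' \<circ> (g \<circ> t)) (net_ball G' u' r) (net_ball H' v' r)"
    using i(1) by (intro net_iso_conj) auto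
  moreover have "gdist G' u' w' \<le> r"
    using net_iso_gdist[OF 1(1) G(1,3,5)] 1 d by simp
  ultimately have "gdist G' u' w' \<le> r \<and>
      net_iso R (p' \<circ> (f \<circ> s)) (q' \<circ> (g \<circ> t)) (net_ball G' u' r) (net_ball H' v' r) \<and>
      (p' \<circ> (f \<circ> s)) u' = v' \<and> (p' \<circ> (f \<circ> s)) w' = z'"
    using i s 2 by simp
  then show ?thesis by (elim conjE) (intro conjI exI)
qed

lift_definition near2 :: "nat \<Rightarrow> real \<Rightarrow> 'x::metric_space birooted \<Rightarrow> 'x birooted \<Rightarrow> bool"
  is "\<lambda>r \<epsilon> (G, u, v) (H, u', v'). gdist G u v \<le> r \<and> (\<exists>f g.
        net_iso (\<lambda>a b. dist a b < \<epsilon>) f g (net_ball G u r) (net_ball H u' r) \<and> f u = u' \<and> f v = v')"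
  subgoal for r \<epsilon> x x' y y'
    by (cases x; cases x'; cases y; cases y'; hypsubst; unfold prod.case; rule iffI;
        erule near2_rsp[rotated 2]; (assumption | erule part_equivp_symp[OF part_equivp_iso2]))
  done

lift_definition root_dist :: "'x birooted \<Rightarrow> nat" is "\<lambda>(G, u, v). gdist G u v"
  subgoal for x y
    by (cases x; cases y; hypsubst; unfold prod.case iso2.simps; elim conjE exE; hypsubst;
        rule net_iso_gdist[symmetric]; assumption)
  done

instantiation rooted :: (metric_space) topological_space
begin

definition open_rooted :: "'a rooted set \<Rightarrow> bool" where
  "open_rooted = generate_topology {{y. near1 r \<epsilon> x y} | r \<epsilon> x. 0 < \<epsilon>}"

instance
  by standard (auto simp: open_rooted_def intro: generate_topology.intros)

end

instantiation birooted :: (metric_space) topological_space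
begin

definition open_birooted :: "'a birooted set \<Rightarrow> bool" where
  "open_birooted = generate_topology {{y. near2 r \<epsilon> x y} | r \<epsilon> x. 0 < \<epsilon>}"

instance
  by standard (auto simp: open_birooted_def intro: generate_topology.intros)

end

text \<open>
  The generating sets are neighbourhoods of each of their points, because balls are finite. Hence
  convergence in these topologies is the local convergence of rooted and doubly rooted networks.
\<close>

lemma finite_net_ball:
  assumes G: "network G" and u: "u \<in> verts G"
  shows "finite (verts (net_ball G u r))" "finite (edges (net_ball G u r))"
proof -
  have fin1: "finite (adj G `` {v})" if "v \<in> verts G" for v
  proof (rule finite_subset)
    show "adj G `` {v} \<subseteq> (\<Union>e\<in>{e \<in> edges G. v \<in> ends G e}. ends G e)"
      unfolding adj_def by blast
    have "finite (ends G e)" if "e \<in> edges G" for e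
      using G that unfolding network_def by (metis finite.emptyI finite_insert)
    then show "finite (\<Union>e\<in>{e \<in> edges G. v \<in> ends G e}. ends G e)"
      using G that unfolding network_def by blast
  qed
  have fin: "finite ((adj G ^^ k) `` {u}) \<and> (adj G ^^ k) `` {u} \<subseteq> verts G" for k
  proof (induction k)
    case (Suc k)
    have "(adj G ^^ Suc k) `` {u} = (\<Union>w\<in>(adj G ^^ k) `` {u}. adj G `` {w})" by auto
    moreover have "adj G `` {w} \<subseteq> verts G" for w using adj_verts[OF G] by blast
    ultimately show ?case using Suc fin1 by auto
  qed (use u in auto)
  have "{v \<in> verts G. gdist G u v \<le> r} \<subseteq> (\<Union>k\<in>{..r}. (adj G ^^ k) `` {u})"
  proof
    fix v assume v: "v \<in> {v \<in> verts G. gdist G u v \<le> r}"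
    then have "(u, v) \<in> (adj G)\<^sup>*" using G u unfolding network_def by blast
    then have "\<exists>k. (u, v) \<in> adj G ^^ k" by (simp add: rtrancl_power)
    then have "(u, v) \<in> adj G ^^ gdist G u v" unfolding gdist_def by (rule LeastI_ex)
    then show "v \<in> (\<Union>k\<in>{..r}. (adj G ^^ k) `` {u})" using v by blast
  qed
  then show fv: "finite (verts (net_ball G u r))"
    using fin by (simp add: finite_subset)
  have "edges (net_ball G u r) \<subseteq> (\<Union>v\<in>verts (net_ball G u r). {e \<in> edges G. v \<in> ends G e})"
  proof
    fix e assume e: "e \<in> edges (net_ball G u r)"
    then have "ends G e \<noteq> {}" using G unfolding network_def by auto
    then show "e \<in> (\<Union>v\<in>verts (net_ball G u r). {e \<in> edges G. v \<in> ends G e})"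
      using e by auto
  qed
  moreover have "finite (\<Union>v\<in>verts (net_ball G u r). {e \<in> edges G. v \<in> ends G e})"
    using fv G unfolding network_def by auto
  ultimately show "finite (edges (net_ball G u r))" by (rule finite_subset)
qed

lemma net_iso_shrink:
  assumes i: "net_iso (\<lambda>a b. dist a b < \<epsilon>) f g (net_ball G u r) H" and "0 < \<epsilon>"
    and G: "network G" "u \<in> verts G"
  obtains \<delta> where "\<delta> < \<epsilon>" "net_iso (\<lambda>a b. dist a b < \<delta>) f g (net_ball G u r) H"
proof -
  let ?A = "net_ball G u r"
  let ?D = "insert 0 ((\<lambda>v. dist (vmark ?A v) (vmark H (f v))) ` verts ?A \<union>
    (\<lambda>(e, v). dist (emark ?A v e) (emark H (f v) (g e))) ` (SIGMA e:edges ?A. ends ?A e))"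
  have "finite (ends ?A e)" if "e \<in> edges ?A" for e
    using that finite_net_ball(1)[OF G, of r] by (auto intro: finite_subset)
  then have "finite (SIGMA e:edges ?A. ends ?A e)"
    using finite_net_ball(2)[OF G, of r] by (intro finite_SigmaI)
  then have fin: "finite ?D" using finite_net_ball(1)[OF G, of r] by blast
  have "\<forall>d\<in>?D. d < \<epsilon>" using i \<open>0 < \<epsilon>\<close> unfolding net_iso_def by auto
  then have "Max ?D < \<epsilon>" using fin by (subst Max_less_iff) auto
  then obtain \<delta> where d: "Max ?D < \<delta>" "\<delta> < \<epsilon>" using dense by blast
  then have D: "\<forall>d\<in>?D. d < \<delta>" using fin by (subst (asm) Max_less_iff) auto
  have "net_iso (\<lambda>a b. dist a b < \<delta>) f g ?A H"
    using i D unfolding net_iso_def by (auto simp del: verts_net_ball edges_net_ball)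
  with d that show thesis by blast
qed

lemma near1_rcls:
  "network G \<Longrightarrow> u \<in> verts G \<Longrightarrow> network H \<Longrightarrow> v \<in> verts H \<Longrightarrow>
    near1 r \<epsilon> (rcls (G, u)) (rcls (H, v)) \<longleftrightarrow> (\<exists>f g.
      net_iso (\<lambda>a b. dist a b < \<epsilon>) f g (net_ball G u r) (net_ball H v r) \<and> f u = v)"
  using near1.abs_eq[of "(G, u)" "(H, v)" r \<epsilon>] iso1_refl[of G u] iso1_refl[of H v]
  by (simp add: eq_onp_def)

lemma near2_bcls:
  "network G \<Longrightarrow> u \<in> verts G \<Longrightarrow> w \<in> verts G \<Longrightarrow> network H \<Longrightarrow> v \<in> verts H \<Longrightarrow> z \<in> verts H \<Longrightarrow>
    near2 r \<epsilon> (bcls (G, u, w)) (bcls (H, v, z)) \<longleftrightarrow> gdist G u w \<le> r \<and> (\<exists>f g.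
      net_iso (\<lambda>a b. dist a b < \<epsilon>) f g (net_ball G u r) (net_ball H v r) \<and> f u = v \<and> f w = z)"
  using near2.abs_eq[of "(G, u, w)" "(H, v, z)" r \<epsilon>] iso2_refl[of G u w] iso2_refl[of H v z]
  by (simp add: eq_onp_def)

lemma root_dist_bcls:
  "network G \<Longrightarrow> u \<in> verts G \<Longrightarrow> v \<in> verts G \<Longrightarrow> root_dist (bcls (G, u, v)) = gdist G u v"
  using root_dist.abs_eq[of "(G, u, v)"] iso2_refl[of G u v] by (simp add: eq_onp_def)

lemma near1_refl: "0 < \<epsilon> \<Longrightarrow> near1 r \<epsilon> x x"
  by (rule rooted_cases[of x]) (auto simp: near1_rcls intro!: exI[of _ id] net_iso_id)

lemma near2_refl: "0 < \<epsilon> \<Longrightarrow> root_dist x \<le> r \<Longrightarrow> near2 r \<epsilon> x x"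
  by (rule birooted_cases[of x])
    (auto simp: near2_bcls root_dist_bcls intro!: exI[of _ id] net_iso_id)

lemma net_iso_triangle:
  assumes "net_iso (\<lambda>a b. dist a b < \<delta>) f g A B"
    and "net_iso (\<lambda>a b. dist a b < \<epsilon> - \<delta>) f' g' B C"
    and "\<And>e. e \<in> edges B \<Longrightarrow> ends B e \<subseteq> verts B"
  shows "net_iso (\<lambda>a b. dist a b < \<epsilon>) (f' \<circ> f) (g' \<circ> g) A C"
proof -
  have "dist a c < \<epsilon>" if "dist a b < \<delta>" "dist b c < \<epsilon> - \<delta>" for a b c :: 'a
    using that dist_triangle[of a c b] by simp
  then show ?thesis
    by (intro net_iso_mono[OF net_iso_comp[OF assms]]) auto
qed

lemma near1_open:
  assumes "near1 r \<epsilon> x y" "0 < \<epsilon>"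
  shows "\<exists>\<delta>>0. \<forall>z. near1 r \<delta> y z \<longrightarrow> near1 r \<epsilon> x z"
proof -
  obtain G u where G: "network G" "u \<in> verts G" "x = rcls (G, u)" by (rule rooted_cases)
  obtain H v where H: "network H" "v \<in> verts H" "y = rcls (H, v)" by (rule rooted_cases)
  from assms G H obtain f g where
    i: "net_iso (\<lambda>a b. dist a b < \<epsilon>) f g (net_ball G u r) (net_ball H v r)" and f: "f u = v"
    by (auto simp: near1_rcls)
  obtain \<delta> where d: "\<delta> < \<epsilon>" "net_iso (\<lambda>a b. dist a b < \<delta>) f g (net_ball G u r) (net_ball H v r)"
    using net_iso_shrink[OF i assms(2) G(1,2)] .
  have "near1 r \<epsilon> x z" if n: "near1 r (\<epsilon> - \<delta>) y z" for z
  proof -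
    obtain K w where K: "network K" "w \<in> verts K" "z = rcls (K, w)" by (rule rooted_cases)
    from n H K obtain f' g' where
      i': "net_iso (\<lambda>a b. dist a b < \<epsilon> - \<delta>) f' g' (net_ball H v r) (net_ball K w r)"
      and f': "f' v = w"
      by (auto simp: near1_rcls)
    have "net_iso (\<lambda>a b. dist a b < \<epsilon>) (f' \<circ> f) (g' \<circ> g) (net_ball G u r) (net_ball K w r)"
      by (rule net_iso_triangle[OF d(2) i']) simp
    then have "\<exists>h k. net_iso (\<lambda>a b. dist a b < \<epsilon>) h k (net_ball G u r) (net_ball K w r) \<and> h u = w"
      using f f' comp_apply by metis
    then show ?thesis using G K by (simp add: near1_rcls)
  qed
  then show ?thesis using d(1) by (intro exI[of _ "\<epsilon> - \<delta>"]) auto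
qed

lemma near2_open:
  assumes "near2 r \<epsilon> x y" "0 < \<epsilon>"
  shows "root_dist y \<le> r \<and> (\<exists>\<delta>>0. \<forall>z. near2 r \<delta> y z \<longrightarrow> near2 r \<epsilon> x z)"
proof -
  obtain G u s where G: "network G" "u \<in> verts G" "s \<in> verts G" "x = bcls (G, u, s)"
    by (rule birooted_cases)
  obtain H v t where H: "network H" "v \<in> verts H" "t \<in> verts H" "y = bcls (H, v, t)"
    by (rule birooted_cases)
  from assms G H obtain f g where le: "gdist G u s \<le> r" and
    i: "net_iso (\<lambda>a b. dist a b < \<epsilon>) f g (net_ball G u r) (net_ball H v r)"
    and f: "f u = v" "f s = t"
    by (auto simp: near2_bcls)
  have "f s \<in> verts (net_ball H v r)"
    using i le G(3) unfolding net_iso_def bij_betw_def by auto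
  then have "gdist H v t \<le> r" using f by simp
  moreover
  obtain \<delta> where d: "\<delta> < \<epsilon>" "net_iso (\<lambda>a b. dist a b < \<delta>) f g (net_ball G u r) (net_ball H v r)"
    using net_iso_shrink[OF i assms(2) G(1,2)] .
  have "near2 r \<epsilon> x z" if n: "near2 r (\<epsilon> - \<delta>) y z" for z
  proof -
    obtain K w k where K: "network K" "w \<in> verts K" "k \<in> verts K" "z = bcls (K, w, k)"
      by (rule birooted_cases)
    from n H K obtain f' g' where
      i': "net_iso (\<lambda>a b. dist a b < \<epsilon> - \<delta>) f' g' (net_ball H v r) (net_ball K w r)"
      and f': "f' v = w" "f' t = k"
      by (auto simp: near2_bcls)
    have "net_iso (\<lambda>a b. dist a b < \<epsilon>) (f' \<circ> f) (g' \<circ> g) (net_ball G u r) (net_ball K w r)"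
      by (rule net_iso_triangle[OF d(2) i']) simp
    then have "\<exists>h j. net_iso (\<lambda>a b. dist a b < \<epsilon>) h j (net_ball G u r) (net_ball K w r) \<and>
        h u = w \<and> h s = k"
      using f f' comp_apply by metis
    then show ?thesis using G K le by (simp add: near2_bcls)
  qed
  ultimately show ?thesis using d(1) H root_dist_bcls[of H v t]
    by (auto intro!: exI[of _ "\<epsilon> - \<delta>"])
qed

lemma eventually_generate_topology:
  assumes "generate_topology \<B> S" "x \<in> S"
    and "\<And>B. B \<in> \<B> \<Longrightarrow> x \<in> B \<Longrightarrow> eventually (\<lambda>n. X n \<in> B) F"
  shows "eventually (\<lambda>n. X n \<in> S) F"
  using assms(1,2)
proof (induction rule: generate_topology.induct)
  case (Int a b)
  then show ?case by (auto intro: eventually_conj)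
next
  case (UN K)
  then obtain k where "k \<in> K" "x \<in> k" "eventually (\<lambda>n. X n \<in> k) F" by blast
  then show ?case by (auto elim: eventually_mono)
qed (use assms(3) in auto)

lemma tendsto_rooted_iff:
  fixes x :: "'x::metric_space rooted"
  shows "(X \<longlongrightarrow> x) F \<longleftrightarrow> (\<forall>r. \<forall>\<epsilon>>0. eventually (\<lambda>n. near1 r \<epsilon> x (X n)) F)"
proof (intro iffI allI impI)
  fix r and \<epsilon> :: real assume X: "(X \<longlongrightarrow> x) F" and e: "0 < \<epsilon>"
  have "open {y. near1 r \<epsilon> x y}"
    unfolding open_rooted_def using e by (intro generate_topology.Basis) blast
  with topological_tendstoD[OF X this] near1_refl[OF e, of r x]
  show "eventually (\<lambda>n. near1 r \<epsilon> x (X n)) F" by simp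
next
  assume *: "\<forall>r. \<forall>\<epsilon>>0. eventually (\<lambda>n. near1 r \<epsilon> x (X n)) F"
  show "(X \<longlongrightarrow> x) F"
  proof (rule topological_tendstoI)
    fix S :: "'x rooted set" assume "open S" "x \<in> S"
    then show "eventually (\<lambda>n. X n \<in> S) F"
      unfolding open_rooted_def
    proof (rule eventually_generate_topology)
      fix B assume "B \<in> {{y. near1 r \<epsilon> x y} | r \<epsilon> x. 0 < (\<epsilon>::real)}" "x \<in> B"
      then obtain r \<epsilon> y where B: "B = {z. near1 r \<epsilon> y z}" "0 < \<epsilon>" "near1 r \<epsilon> y x" by blast
      then obtain \<delta> where "0 < \<delta>" "\<forall>z. near1 r \<delta> x z \<longrightarrow> near1 r \<epsilon> y z"
        using near1_open by blast
      with * B(1) show "eventually (\<lambda>n. X n \<in> B) F"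
        by (metis (mono_tags, lifting) eventually_mono mem_Collect_eq)
    qed
  qed
qed

lemma tendsto_birooted_iff:
  fixes x :: "'x::metric_space birooted"
  shows "(X \<longlongrightarrow> x) F \<longleftrightarrow>
    (\<forall>r\<ge>root_dist x. \<forall>\<epsilon>>0. eventually (\<lambda>n. near2 r \<epsilon> x (X n)) F)"
proof (intro iffI allI impI)
  fix r and \<epsilon> :: real assume X: "(X \<longlongrightarrow> x) F" and e: "0 < \<epsilon>" and r: "root_dist x \<le> r"
  have "open {y. near2 r \<epsilon> x y}"
    unfolding open_birooted_def using e by (intro generate_topology.Basis) blast
  with topological_tendstoD[OF X this] near2_refl[OF e r]
  show "eventually (\<lambda>n. near2 r \<epsilon> x (X n)) F" by simp
next
  assume *: "\<forall>r\<ge>root_dist x. \<forall>\<epsilon>>0. eventually (\<lambda>n. near2 r \<epsilon> x (X n)) F"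
  show "(X \<longlongrightarrow> x) F"
  proof (rule topological_tendstoI)
    fix S :: "'x birooted set" assume "open S" "x \<in> S"
    then show "eventually (\<lambda>n. X n \<in> S) F"
      unfolding open_birooted_def
    proof (rule eventually_generate_topology)
      fix B assume "B \<in> {{y. near2 r \<epsilon> x y} | r \<epsilon> x. 0 < (\<epsilon>::real)}" "x \<in> B"
      then obtain r \<epsilon> y where B: "B = {z. near2 r \<epsilon> y z}" "0 < \<epsilon>" "near2 r \<epsilon> y x" by blast
      then obtain \<delta> where "root_dist x \<le> r" "0 < \<delta>" "\<forall>z. near2 r \<delta> x z \<longrightarrow> near2 r \<epsilon> y z"
        using near2_open by blast
      with * B(1) show "eventually (\<lambda>n. X n \<in> B) F"
        by (metis (mono_tags, lifting) eventually_mono mem_Collect_eq)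
    qed
  qed
qed

section \<open>Non-rooted networks and invariant events\<close>

definition nonrooted :: "'x::metric_space network_class measure" where
  "nonrooted = sigma UNIV {B. unroot -` B \<in> sets borel}"

lemma space_nonrooted [simp]: "space nonrooted = UNIV"
  by (simp add: nonrooted_def space_measure_of_conv)

lemma sets_nonrooted: "sets nonrooted = {B. unroot -` B \<in> sets borel}"
proof -
  have "sigma_algebra UNIV {B :: 'a network_class set. unroot -` B \<in> sets borel}"
    unfolding sigma_algebra_iff2
    by (auto simp: vimage_Diff vimage_UN Compl_eq_Diff_UNIV[symmetric] vimage_Compl)
  then show ?thesis unfolding nonrooted_def by (rule sigma_algebra.sets_measure_of_eq)
qed

lemma measurable_unroot: "unroot \<in> borel \<rightarrow>\<^sub>M nonrooted"
  by (rule measurableI) (auto simp: sets_nonrooted)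

definition invariant_events :: "'x::metric_space rooted set set" where
  "invariant_events = {A \<in> sets borel. \<forall>G u v. network G \<longrightarrow> u \<in> verts G \<longrightarrow> v \<in> verts G \<longrightarrow>
     rcls (G, u) \<in> A \<longrightarrow> rcls (G, v) \<in> A}"

section \<open>Biasing and root-change\<close>

text \<open>
  Here \<open>\<mu>\<close> and \<open>\<nu>\<close> are the distributions of random rooted networks: nothing below depends on the
  underlying probability spaces.
\<close>

definition biasing :: "'x::metric_space rooted measure \<Rightarrow> 'x rooted measure \<Rightarrow> bool" where
  "biasing \<mu> \<nu> \<longleftrightarrow> (\<exists>w :: 'x rooted \<Rightarrow> real.
     w \<in> borel_measurable borel \<and> (\<forall>x. 0 \<le> w x) \<and>
     0 < (\<integral>\<^sup>+ x. ennreal (w x) \<partial>\<mu>) \<and> (\<integral>\<^sup>+ x. ennreal (w x) \<partial>\<mu>) < \<infinity> \<and>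
     \<nu> = density \<mu> (\<lambda>x. ennreal (w x) / (\<integral>\<^sup>+ y. ennreal (w y) \<partial>\<mu>)))"

definition root_change :: "'x::metric_space rooted measure \<Rightarrow> 'x rooted measure \<Rightarrow> bool" where
  "root_change \<mu> \<nu> \<longleftrightarrow> sets \<nu> = sets borel \<and> (\<exists>T :: 'x birooted \<Rightarrow> real.
     T \<in> borel_measurable borel \<and> (\<forall>z. 0 \<le> T z) \<and>
     (AE x in \<mu>. root_sum (\<lambda>z. ennreal (T z)) x = 1) \<and>
     (\<forall>A\<in>sets borel.
        emeasure \<nu> A = (\<integral>\<^sup>+ x. root_sum (\<lambda>z. ennreal (T z) * indicator A (root2 z)) x \<partial>\<mu>)))"

definition biasing_root_change :: "'x::metric_space rooted measure \<Rightarrow> 'x rooted measure \<Rightarrow> bool"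
  where "biasing_root_change \<mu> \<nu> \<longleftrightarrow> (\<exists>\<rho>. biasing \<mu> \<rho> \<and> root_change \<rho> \<nu>)"

definition same_network_coupling :: "'x::metric_space rooted measure \<Rightarrow> 'x rooted measure \<Rightarrow> bool"
  where
  "same_network_coupling \<mu> \<nu> \<longleftrightarrow> (\<exists>\<gamma> :: ('x rooted \<times> 'x rooted) measure.
     prob_space \<gamma> \<and> sets \<gamma> = sets (borel \<Otimes>\<^sub>M borel) \<and>
     distr \<gamma> borel fst = \<mu> \<and> distr \<gamma> borel snd = \<nu> \<and>
     (AE (x, y) in \<gamma>. unroot x = unroot y))"

definition doubly_rooted_coupling :: "'x::metric_space rooted measure \<Rightarrow> 'x rooted measure \<Rightarrow> bool"
  where
  "doubly_rooted_coupling \<mu> \<nu> \<longleftrightarrow> (\<exists>\<gamma> :: 'x birooted measure.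
     prob_space \<gamma> \<and> sets \<gamma> = sets borel \<and>
     distr \<gamma> borel root1 = \<mu> \<and> distr \<gamma> borel root2 = \<nu>)"

definition same_nonrooted_law :: "'x::metric_space rooted measure \<Rightarrow> 'x rooted measure \<Rightarrow> bool"
  where "same_nonrooted_law \<mu> \<nu> \<longleftrightarrow> distr \<mu> nonrooted unroot = distr \<nu> nonrooted unroot"

definition agree_on_invariant_events ::
  "'x::metric_space rooted measure \<Rightarrow> 'x rooted measure \<Rightarrow> bool"
  where "agree_on_invariant_events \<mu> \<nu> \<longleftrightarrow> (\<forall>A\<in>invariant_events. emeasure \<mu> A = emeasure \<nu> A)"

end

theory Submission
  imports Defs
begin

text \<open>
  The conditions are proved equivalent along a cycle: a root-change gives a random doubly-rooted
  network, this gives a coupling, a coupling forces agreement on the invariant events, and agreement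
  on the invariant events gives a root-change. Since agreement is symmetric, so is the existence of a
  root-change, and biasing by the constant weight 1 then gives the last condition in both directions.

  The first steps rest on the measurability of sums over the second root
  (\<open>measurable_root_sum\<close>). This holds because a vertex that satisfies an open
  condition persists, at the same distance from the root, in all networks that agree closely enough
  on a large ball: sums over an open set of pairs are lower semicontinuous. A root-change with
  kernel \<open>T\<close> is then the second marginal of the measure with density \<open>T\<close> with respect to
  \<open>vertex_measure \<mu>\<close>, and this measure is the required doubly-rooted network. To see that its two
  roots give a coupling in the sense of the definition, the relation of lying on the same network
  must be measurable in the product (\<open>measurable_same_network\<close>). Its ingredients are a
  Koenig-type argument, by which rooted networks with nearly isomorphic balls of all radii are
  isomorphic (\<open>near1_all_imp_eq\<close>), and a countable family of finite networks that approximates all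
  balls.

  The substantial step is to find a root-change of \<open>\<mu>\<close> into \<open>\<nu>\<close> when both agree on the invariant
  events (locale \<open>transport\<close>). Regard \<open>\<mu>\<close> as mass to be sent and \<open>\<nu>\<close> as demand to be met, where mass
  may be moved only within a network. Spread the mass over the pairs (sender, receiver) with a
  positive weight that is summable around each vertex, and the demand likewise; on the space of
  pairs, move the minimum of the two spread measures, and repeat with what is left. All rounds together
  move at most total mass 1, and each round moves at least what could still be moved in the limit.
  Hence in the limit nothing can be moved: the leftover mass and the leftover demand are spread over
  disjoint sets of pairs. As the weight is positive, they live on disjoint invariant events.
  But every invariant event carries equal mass and demand, and each round takes the same amount from
  both, so the leftovers also agree on invariant events. Both are therefore zero, and the total
  amount sent along each pair is the kernel of the root-change.
\<close>

section \<open>Distances in balls\<close>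

lemma relpow_adj_gdist:
  assumes "network G" "u \<in> verts G" "v \<in> verts G"
  shows "(u, v) \<in> adj G ^^ gdist G u v"
proof -
  have "(u, v) \<in> (adj G)\<^sup>*" using assms unfolding network_def by blast
  then have "\<exists>k. (u, v) \<in> adj G ^^ k" by (simp add: rtrancl_power)
  then show ?thesis unfolding gdist_def by (rule LeastI_ex)
qed

lemma gdist_le: "(u, v) \<in> adj G ^^ k \<Longrightarrow> gdist G u v \<le> k"
  unfolding gdist_def by (rule Least_le)

lemma gdist_self [simp]: "gdist G u u = 0"
  using gdist_le[where u = u and v = u and k = 0] by simp

lemma gdist_triangle:
  assumes "network G" "u \<in> verts G" "v \<in> verts G" "w \<in> verts G"
  shows "gdist G u w \<le> gdist G u v + gdist G v w"
  using relpow_adj_gdist[OF assms(1,2,3)] relpow_adj_gdist[OF assms(1,3,4)]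
  by (intro gdist_le) (auto simp: relpow_add)

lemma gdist_commute: "gdist G u v = gdist G v u"
proof -
  have "sym (adj G)" unfolding sym_def adj_def by (auto simp: insert_commute)
  then have "(adj G ^^ k)\<inverse> = adj G ^^ k" for k
    by (induction k) (auto simp: converse_relcomp sym_conv_converse_eq relpow_commute)
  then have "(u, v) \<in> adj G ^^ k \<longleftrightarrow> (v, u) \<in> adj G ^^ k" for k by (metis converse_iff)
  then show ?thesis unfolding gdist_def by simp
qed

lemma relpow_adj_verts:
  assumes "network G" "u \<in> verts G" "(u, v) \<in> adj G ^^ k"
  shows "v \<in> verts G"
  using assms(3) by (induction k arbitrary: v) (use assms(1,2) adj_verts in auto)

lemma relpow_adj_net_ball_subset: "(v, w) \<in> adj (net_ball G u r) ^^ k \<Longrightarrow> (v, w) \<in> adj G ^^ k"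
proof (induction k arbitrary: w)
  case (Suc k)
  then obtain x where "(v, x) \<in> adj G ^^ k" "(x, w) \<in> adj (net_ball G u r)" by auto
  moreover from this(2) have "(x, w) \<in> adj G" by (auto simp: adj_def)
  ultimately show ?case by auto
qed simp

lemma relpow_adj_net_ball:
  assumes "network G" "u \<in> verts G" "v \<in> verts G"
    and "(v, w) \<in> adj G ^^ k" "gdist G u v + k \<le> r"
  shows "(v, w) \<in> adj (net_ball G u r) ^^ k"
  using assms(4,5)
proof (induction k arbitrary: w)
  case (Suc k)
  then obtain x where x: "(v, x) \<in> adj G ^^ k" "(x, w) \<in> adj G" by auto
  have mem: "y \<in> verts G \<and> gdist G u y \<le> r" if "(v, y) \<in> adj G ^^ j" "j \<le> Suc k" for y j
    using relpow_adj_verts[OF assms(1,3) that(1)] gdist_triangle[OF assms(1-3), of y]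
      gdist_le[OF that(1)] that(2) Suc.prems(2) by auto
  from x(2) obtain e where "e \<in> edges G" "ends G e = {x, w}" unfolding adj_def by auto
  then have "(x, w) \<in> adj (net_ball G u r)"
    using mem[OF x(1)] mem[OF Suc.prems(1)] unfolding adj_def by auto
  moreover have "(v, x) \<in> adj (net_ball G u r) ^^ k" using Suc.IH[OF x(1)] Suc.prems(2) by simp
  ultimately show ?case by auto
qed simp

lemma net_iso_ball_gdist_le:
  assumes i: "net_iso R f g (net_ball G u r) (net_ball H u' r)" 
    and G: "network G" "u \<in> verts G" "v \<in> verts G" "w \<in> verts G"
    and le: "gdist G u v + gdist G v w \<le> r"
  shows "gdist H (f v) (f w) \<le> gdist G v w"
proof (rule gdist_le, rule relpow_adj_net_ball_subset)
  show "(f v, f w) \<in> adj (net_ball H u' r) ^^ gdist G v w"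
    by (rule net_iso_relpow[OF i], rule relpow_adj_net_ball) (use G le relpow_adj_gdist in auto)
qed

text \<open>
  A geodesic that starts at \<open>v\<close> and has length at most \<open>r\<close> stays in every ball about \<open>u\<close> of radius
  at least \<open>d(u, v) + r\<close>. So an isomorphism of large balls preserves the distances that matter here,
  and smaller balls about nearby vertices correspond to each other.
\<close>

lemma net_iso_subball:
  assumes i: "net_iso R f g (net_ball G u r) (net_ball H u' r)" and fu: "f u = u'"
    and G: "network G" "u \<in> verts G" "v \<in> verts G" and H: "network H" "u' \<in> verts H"
    and le: "gdist G u v + s \<le> r"
  shows "f v \<in> verts H" "gdist H u' (f v) = gdist G u v"
    "net_iso R f g (net_ball G v s) (net_ball H (f v) s)"
proof -
  let ?B = "verts (net_ball G u r)" and ?C = "verts (net_ball H u' r)"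
  let ?f = "inv_into ?B f" and ?g = "inv_into (edges (net_ball G u r)) g"
  have bf: "bij_betw f ?B ?C" and bg: "bij_betw g (edges (net_ball G u r)) (edges (net_ball H u' r))"
    and ends: "\<And>e. e \<in> edges (net_ball G u r) \<Longrightarrow> ends H (g e) = f ` ends G e"
    using i unfolding net_iso_def by auto
  have inv: "net_iso (R\<inverse>\<inverse>) ?f ?g (net_ball H u' r) (net_ball G u r)"
    by (rule net_iso_inv[OF i]) simp
  have ff: "?f (f x) = x" if "x \<in> ?B" for x
    using bf that by (meson bij_betw_inv_into_left)
  have fm: "f x \<in> verts H \<and> gdist H u' (f x) \<le> r" if "x \<in> ?B" for x
    using bf that unfolding bij_betw_def by auto
  have uB: "u \<in> ?B" using G(2) by simp
  have root: "gdist H u' (f x) = gdist G u x" if "x \<in> ?B" for x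
  proof (rule antisym)
    show "gdist H u' (f x) \<le> gdist G u x"
      using net_iso_ball_gdist_le[OF i G(1,2,2), of x] that fu by auto
    show "gdist G u x \<le> gdist H u' (f x)"
      using net_iso_ball_gdist_le[OF inv H(1,2,2), of "f x"] fm[OF that] ff[OF that] ff[OF uB] fu
      by auto
  qed
  have vB: "v \<in> ?B" using G(3) le by simp
  show fv: "f v \<in> verts H" and dv: "gdist H u' (f v) = gdist G u v"
    using fm[OF vB] root[OF vB] by auto
  have sub: "x \<in> ?B" if "x \<in> verts G" "gdist G v x \<le> s" for x
    using that le gdist_triangle[OF G that(1)] by auto
  have subH: "y \<in> ?C" if "y \<in> verts H" "gdist H (f v) y \<le> s" for y
    using that le dv gdist_triangle[OF H fv that(1)] by auto
  have img: "f x \<in> verts H \<and> gdist H (f v) (f x) \<le> s" if "x \<in> verts G" "gdist G v x \<le> s" for x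
    using net_iso_ball_gdist_le[OF i G that(1)] that le fm[OF sub[OF that]] by auto
  have pre: "\<exists>x. x \<in> verts G \<and> gdist G v x \<le> s \<and> f x = y" if y: "y \<in> verts H" "gdist H (f v) y \<le> s" for y
  proof -
    have "y \<in> f ` ?B" using subH[OF y] bf by (simp add: bij_betw_def)
    then obtain x where x: "x \<in> ?B" "y = f x" by blast
    have "gdist G v x \<le> gdist H (f v) y"
      using net_iso_ball_gdist_le[OF inv H(1,2) fv y(1)] ff[OF vB] ff[OF x(1)] x(2) y(2) dv le by auto
    then show ?thesis using x y(2) by auto
  qed
  let ?S = "{x \<in> verts G. gdist G v x \<le> s}" and ?S' = "{x \<in> verts H. gdist H (f v) x \<le> s}"
  have SB: "?S \<subseteq> ?B" using sub by blast
  have fS: "f ` ?S = ?S'"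
  proof
    show "f ` ?S \<subseteq> ?S'" using img by blast
    show "?S' \<subseteq> f ` ?S" using pre by blast
  qed
  have injB: "inj_on f ?B" using bf by (simp add: bij_betw_def)
  have bS: "bij_betw f ?S ?S'"
    using fS inj_on_subset[OF injB SB] by (simp add: bij_betw_def)
  let ?E = "{e \<in> edges G. ends G e \<subseteq> ?S}" and ?E' = "{e \<in> edges H. ends H e \<subseteq> ?S'}"
  have EB: "?E \<subseteq> edges (net_ball G u r)" using SB by auto
  have E'B: "?E' \<subseteq> edges (net_ball H u' r)" using subH by auto
  have inj2: "inj_on g ?E" using bg EB by (meson bij_betw_def inj_on_subset)
  have "g ` ?E = ?E'"
  proof
    show "g ` ?E \<subseteq> ?E'"
    proof
      fix d assume "d \<in> g ` ?E"
      then obtain e where e: "e \<in> ?E" "d = g e" by blast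
      then have "d \<in> edges (net_ball H u' r)" using EB bg unfolding bij_betw_def by blast
      moreover have "ends H d \<subseteq> ?S'"
      proof -
        have "ends H d = f ` ends G e" using ends[of e] e EB by blast
        also have "\<dots> \<subseteq> f ` ?S" using e(1) by blast
        finally show ?thesis using fS by simp
      qed
      ultimately show "d \<in> ?E'" by auto
    qed
    show "?E' \<subseteq> g ` ?E"
    proof
      fix d assume d: "d \<in> ?E'"
      then have "d \<in> g ` edges (net_ball G u r)" using E'B bg unfolding bij_betw_def by blast
      then obtain e where e: "e \<in> edges (net_ball G u r)" "d = g e" by blast
      have "f ` ends G e \<subseteq> f ` ?S" using ends[OF e(1)] d e(2) fS by auto
      moreover have "ends G e \<subseteq> ?B" using e(1) by auto
      ultimately have "ends G e \<subseteq> ?S" using inj_on_image_subset_iff[OF injB _ SB] by blast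
      then show "d \<in> g ` ?E" using e by auto
    qed
  qed
  then have bE: "bij_betw g ?E ?E'" using inj2 by (simp add: bij_betw_def)
  have *: "e \<in> edges (net_ball G u r)" if "e \<in> ?E" for e using that EB by blast
  have **: "x \<in> verts (net_ball G u r)" if "x \<in> ?S" for x using that SB by blast
  show "net_iso R f g (net_ball G v s) (net_ball H (f v) s)"
    unfolding net_iso_def
  proof (intro conjI ballI)
    show "bij_betw f (verts (net_ball G v s)) (verts (net_ball H (f v) s))" using bS by simp
    show "bij_betw g (edges (net_ball G v s)) (edges (net_ball H (f v) s))" using bE by simp
    show "ends (net_ball H (f v) s) (g e) = f ` ends (net_ball G v s) e"
      if "e \<in> edges (net_ball G v s)" for e
      using ends[OF *, of e] that by simp
    show "R (vmark (net_ball G v s) x) (vmark (net_ball H (f v) s) (f x))"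
      if "x \<in> verts (net_ball G v s)" for x
      using i **[of x] that unfolding net_iso_def by simp
    show "R (emark (net_ball G v s) x e) (emark (net_ball H (f v) s) (f x) (g e))"
      if "e \<in> edges (net_ball G v s)" "x \<in> ends (net_ball G v s) e" for e x
      using i *[of e] that unfolding net_iso_def by simp
  qed
qed

section \<open>Roots of the same network\<close>

text \<open>
  Exchanging the roots reduces statements about the second root, and sums over the first root for a
  given second one, to \<open>root1\<close> and \<open>root_sum\<close>.
\<close>

lift_definition flip :: "'x birooted \<Rightarrow> 'x birooted" is "\<lambda>(G, u, v). (G, v, u)"
  by (clarsimp, blast)

lemma flip_bcls [simp]:
  "network G \<Longrightarrow> u \<in> verts G \<Longrightarrow> v \<in> verts G \<Longrightarrow> flip (bcls (G, u, v)) = bcls (G, v, u)"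
  using flip.abs_eq[of "(G, u, v)"] iso2_refl[of G u v] by (simp add: eq_onp_def)

lemma flip_flip [simp]: "flip (flip z) = z"
  by (rule birooted_cases[of z]) simp

lemma root1_flip [simp]: "root1 (flip z) = root2 z"
  by (rule birooted_cases[of z]) simp

lemma root2_flip [simp]: "root2 (flip z) = root1 z"
  by (rule birooted_cases[of z]) simp

lemma root_dist_flip [simp]: "root_dist (flip z) = root_dist z"
  by (rule birooted_cases[of z]) (simp add: root_dist_bcls gdist_commute)

lemma birooted_fibre:
  assumes "network G" "u \<in> verts G"
  shows "root1 z = rcls (G, u) \<longleftrightarrow> (\<exists>v\<in>verts G. z = bcls (G, u, v))"
proof
  assume z: "root1 z = rcls (G, u)"
  obtain H u' v' where H: "network H" "u' \<in> verts H" "v' \<in> verts H" "z = bcls (H, u', v')"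
    by (rule birooted_cases)
  with z have "rcls (H, u') = rcls (G, u)" by simp
  then have "iso1 (H, u') (G, u)"
    using Quotient_rel[OF Quotient_rooted, of "(H, u')" "(G, u)"] iso1_refl[of H u'] iso1_refl[of G u] H assms
    by simp
  then obtain f g where f: "net_iso (=) f g H G" "f u' = u" by auto
  moreover have "f v' \<in> verts G" using f(1) H(3) unfolding net_iso_def bij_betw_def by auto
  ultimately have "iso2 (H, u', v') (G, u, f v')" using H assms by auto
  then have "z = bcls (G, u, f v')" using H(4) bcls_eqI by metis
  then show "\<exists>v\<in>verts G. z = bcls (G, u, v)" using \<open>f v' \<in> verts G\<close> by blast
qed (use assms in auto)

text \<open>
  An isomorphism between the underlying networks carries the second root into the first network.
  So couplings of rooted networks on the same network are doubly-rooted networks in disguise.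
\<close>

lemma unroot_eq_iff: "unroot x = unroot y \<longleftrightarrow> (\<exists>z. root1 z = x \<and> root2 z = y)"
proof
  assume e: "unroot x = unroot y"
  obtain G u where G: "network G" "u \<in> verts G" "x = rcls (G, u)" by (rule rooted_cases)
  obtain H v where H: "network H" "v \<in> verts H" "y = rcls (H, v)" by (rule rooted_cases)
  have "iso0 H H" "iso0 G G"
    using G(1) H(1) net_iso_id[of "(=)", OF refl] unfolding iso0_def by blast+
  then have "iso0 H G"
    using e G H Quotient_rel[OF Quotient_network_class, of H G] by simp
  then obtain f g where f: "net_iso (=) f g H G" unfolding iso0_def by blast
  then have fv: "f v \<in> verts G" using H(2) unfolding net_iso_def bij_betw_def by auto
  then have "iso1 (H, v) (G, f v)" using f G H by auto
  then have "y = rcls (G, f v)" using H(3) Quotient_rel_abs[OF Quotient_rooted] by metis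
  then show "\<exists>z. root1 z = x \<and> root2 z = y"
    using G fv by (intro exI[of _ "bcls (G, u, f v)"]) simp
next
  assume "\<exists>z. root1 z = x \<and> root2 z = y"
  then obtain z where z: "root1 z = x" "root2 z = y" by blast
  then show "unroot x = unroot y" by (cases z rule: birooted_cases) auto
qed

lemma invariant_events_iff:
  "A \<in> invariant_events \<longleftrightarrow> A \<in> sets borel \<and> (\<forall>z. root1 z \<in> A \<longrightarrow> root2 z \<in> A)"
proof -
  have "(\<forall>G u v. network G \<longrightarrow> u \<in> verts G \<longrightarrow> v \<in> verts G \<longrightarrow> rcls (G, u) \<in> A \<longrightarrow> rcls (G, v) \<in> A)
    \<longleftrightarrow> (\<forall>z. root1 z \<in> A \<longrightarrow> root2 z \<in> A)" (is "?l \<longleftrightarrow> ?r")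
  proof
    assume l: ?l
    show ?r
    proof (intro allI impI)
      fix z assume "root1 z \<in> A"
      moreover obtain G u v where G: "network G" "u \<in> verts G" "v \<in> verts G" "z = bcls (G, u, v)"
        by (rule birooted_cases)
      moreover from G have "root1 z = rcls (G, u)" "root2 z = rcls (G, v)" by simp_all
      ultimately show "root2 z \<in> A" using l by metis
    qed
  next
    assume r: ?r
    show ?l
    proof (intro allI impI)
      fix G u v assume "network G" "u \<in> verts G" "v \<in> verts G" "rcls (G, u) \<in> A"
      with r[rule_format, of "bcls (G, u, v)"] show "rcls (G, v) \<in> A" by simp
    qed
  qed
  then show ?thesis unfolding invariant_events_def by simp
qed

section \<open>Continuity of the root maps\<close>

lemma near1_mono:
  assumes "near1 r \<epsilon> x y" "r' \<le> r" "\<epsilon> \<le> \<epsilon>'"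
  shows "near1 r' \<epsilon>' x y"
proof -
  obtain G u where G: "network G" "u \<in> verts G" "x = rcls (G, u)" by (rule rooted_cases)
  obtain H v where H: "network H" "v \<in> verts H" "y = rcls (H, v)" by (rule rooted_cases)
  from assms G H obtain f g where
    i: "net_iso (\<lambda>a b. dist a b < \<epsilon>) f g (net_ball G u r) (net_ball H v r)" and f: "f u = v"
    by (auto simp: near1_rcls)
  have "net_iso (\<lambda>a b. dist a b < \<epsilon>) f g (net_ball G u r') (net_ball H v r')"
    using net_iso_subball(3)[OF i f G(1,2,2) H(1,2), of r'] assms(2) f by simp
  then have "net_iso (\<lambda>a b. dist a b < \<epsilon>') f g (net_ball G u r') (net_ball H v r')"
    by (rule net_iso_mono) (use assms(3) in auto)
  with f G H show ?thesis by (auto simp: near1_rcls)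
qed

lemma near2_imp_near1_root1: "near2 r \<epsilon> z w \<Longrightarrow> near1 r \<epsilon> (root1 z) (root1 w)"
  by (cases z rule: birooted_cases; cases w rule: birooted_cases)
    (auto simp: near1_rcls near2_bcls)

lemma near2_imp_root_dist_eq:
  assumes "near2 r \<epsilon> z w" shows "root_dist w = root_dist z"
proof -
  obtain G u s where G: "network G" "u \<in> verts G" "s \<in> verts G" "z = bcls (G, u, s)"
    by (rule birooted_cases)
  obtain H v t where H: "network H" "v \<in> verts H" "t \<in> verts H" "w = bcls (H, v, t)"
    by (rule birooted_cases)
  from assms G H obtain f g where le: "gdist G u s \<le> r" and
    i: "net_iso (\<lambda>a b. dist a b < \<epsilon>) f g (net_ball G u r) (net_ball H v r)"
    and f: "f u = v" "f s = t"
    by (auto simp: near2_bcls)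
  show ?thesis
    using net_iso_subball(2)[OF i f(1) G(1-3) H(1,2), of 0] le f G H by (simp add: root_dist_bcls)
qed

lemma near2_mono:
  assumes "near2 r \<epsilon> z w" "r' \<le> r" "\<epsilon> \<le> \<epsilon>'" "root_dist z \<le> r'"
  shows "near2 r' \<epsilon>' z w"
proof -
  obtain G u s where G: "network G" "u \<in> verts G" "s \<in> verts G" "z = bcls (G, u, s)"
    by (rule birooted_cases)
  obtain H v t where H: "network H" "v \<in> verts H" "t \<in> verts H" "w = bcls (H, v, t)"
    by (rule birooted_cases)
  from assms G H obtain f g where
    i: "net_iso (\<lambda>a b. dist a b < \<epsilon>) f g (net_ball G u r) (net_ball H v r)"
    and f: "f u = v" "f s = t"
    by (auto simp: near2_bcls)
  have "net_iso (\<lambda>a b. dist a b < \<epsilon>) f g (net_ball G u r') (net_ball H v r')"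
    using net_iso_subball(3)[OF i f(1) G(1,2,2) H(1,2), of r'] assms(2) f by simp
  then have "net_iso (\<lambda>a b. dist a b < \<epsilon>') f g (net_ball G u r') (net_ball H v r')"
    by (rule net_iso_mono) (use assms(3) in auto)
  with f G H assms(4) show ?thesis by (auto simp: near2_bcls root_dist_bcls)
qed

text \<open>
  The ball about the second root lies in the ball about the first root whose radius is larger by the
  distance of the roots.
\<close>

lemma near2_flip:
  assumes "near2 (root_dist z + r) \<epsilon> z w" "root_dist z \<le> r"
  shows "near2 r \<epsilon> (flip z) (flip w)"
proof -
  obtain G u s where G: "network G" "u \<in> verts G" "s \<in> verts G" "z = bcls (G, u, s)"
    by (rule birooted_cases)
  obtain H v t where H: "network H" "v \<in> verts H" "t \<in> verts H" "w = bcls (H, v, t)"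
    by (rule birooted_cases)
  have d: "root_dist z = gdist G u s" using G by (simp add: root_dist_bcls)
  from assms(1) G H d obtain f g where
    i: "net_iso (\<lambda>a b. dist a b < \<epsilon>) f g (net_ball G u (gdist G u s + r)) (net_ball H v (gdist G u s + r))"
    and f: "f u = v" "f s = t"
    by (auto simp: near2_bcls)
  have "net_iso (\<lambda>a b. dist a b < \<epsilon>) f g (net_ball G s r) (net_ball H t r)"
    using net_iso_subball(3)[OF i f(1) G(1,2,3) H(1,2), of r] f by simp
  moreover have "gdist G s u \<le> r" using assms(2) d by (simp add: gdist_commute)
  ultimately show ?thesis using f G H by (auto simp: near2_bcls)
qed

lemma open_near1: "0 < \<epsilon> \<Longrightarrow> open {y. near1 r \<epsilon> x y}"
  unfolding open_rooted_def by (intro generate_topology.Basis) blast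

lemma open_near2: "0 < \<epsilon> \<Longrightarrow> open {y. near2 r \<epsilon> x y}"
  unfolding open_birooted_def by (intro generate_topology.Basis) blast

text \<open>
  Neighbourhoods centred at the point itself suffice, because by monotonicity in the radius and the
  precision a finite intersection of them contains another one.
\<close>

lemma open_rooted_iff:
  fixes S :: "'x::metric_space rooted set"
  shows "open S \<longleftrightarrow> (\<forall>x\<in>S. \<exists>r. \<exists>\<epsilon>>0. \<forall>y. near1 r \<epsilon> x y \<longrightarrow> y \<in> S)"
proof
  assume "open S"
  then show "\<forall>x\<in>S. \<exists>r. \<exists>\<epsilon>>0. \<forall>y. near1 r \<epsilon> x y \<longrightarrow> y \<in> S"
    unfolding open_rooted_def
  proof (induction rule: generate_topology.induct)
    case UNIV then show ?case by (auto intro: exI[of _ 1])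
  next
    case (Int a b)
    show ?case
    proof
      fix x assume x: "x \<in> a \<inter> b"
      then obtain r \<epsilon> r' \<epsilon>' where *: "0 < \<epsilon>" "\<forall>y. near1 r \<epsilon> x y \<longrightarrow> y \<in> a"
          "0 < \<epsilon>'" "\<forall>y. near1 r' \<epsilon>' x y \<longrightarrow> y \<in> b" using Int.IH by blast
      have "y \<in> a \<inter> b" if "near1 (max r r') (min \<epsilon> \<epsilon>') x y" for y
        using * near1_mono[OF that, of r \<epsilon>] near1_mono[OF that, of r' \<epsilon>'] by auto
      then show "\<exists>r. \<exists>\<epsilon>>0. \<forall>y. near1 r \<epsilon> x y \<longrightarrow> y \<in> a \<inter> b"
        using *(1,3) by (intro exI[of _ "max r r'"] exI[of _ "min \<epsilon> \<epsilon>'"]) auto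
    qed
  next
    case (UN K) then show ?case by (meson UnionE UnionI)
  next
    case (Basis s)
    then obtain r \<epsilon> y where "s = {z. near1 r \<epsilon> y z}" "0 < \<epsilon>" by blast
    then show ?case using near1_open by blast
  qed
next
  assume *: "\<forall>x\<in>S. \<exists>r. \<exists>\<epsilon>>0. \<forall>y. near1 r \<epsilon> x y \<longrightarrow> y \<in> S"
  show "open S"
  proof (rule Topological_Spaces.openI)
    fix x assume "x \<in> S"
    with * obtain r and \<epsilon> :: real where "0 < \<epsilon>" "\<forall>y. near1 r \<epsilon> x y \<longrightarrow> y \<in> S" by blast
    then show "\<exists>T. open T \<and> x \<in> T \<and> T \<subseteq> S"
      using near1_refl[of \<epsilon> r x] open_near1[of \<epsilon> r x] by (intro exI[of _ "{y. near1 r \<epsilon> x y}"]) auto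
  qed
qed

lemma open_birooted_iff:
  fixes S :: "'x::metric_space birooted set"
  shows "open S \<longleftrightarrow> (\<forall>x\<in>S. \<exists>r\<ge>root_dist x. \<exists>\<epsilon>>0. \<forall>y. near2 r \<epsilon> x y \<longrightarrow> y \<in> S)"
proof
  assume "open S"
  then show "\<forall>x\<in>S. \<exists>r\<ge>root_dist x. \<exists>\<epsilon>>0. \<forall>y. near2 r \<epsilon> x y \<longrightarrow> y \<in> S"
    unfolding open_birooted_def
  proof (induction rule: generate_topology.induct)
    case UNIV
    have "\<exists>\<epsilon>::real. \<epsilon> > 0" using zero_less_one by blast
    then show ?case by auto
  next
    case (Int a b)
    show ?case
    proof
      fix x assume x: "x \<in> a \<inter> b"
      then obtain r \<epsilon> r' \<epsilon>' where *: "0 < \<epsilon>" "root_dist x \<le> r" "\<forall>y. near2 r \<epsilon> x y \<longrightarrow> y \<in> a"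
          "0 < \<epsilon>'" "root_dist x \<le> r'" "\<forall>y. near2 r' \<epsilon>' x y \<longrightarrow> y \<in> b" using Int.IH by blast
      have "y \<in> a \<inter> b" if "near2 (max r r') (min \<epsilon> \<epsilon>') x y" for y
        using * near2_mono[OF that, of r \<epsilon>] near2_mono[OF that, of r' \<epsilon>'] by auto
      then show "\<exists>r\<ge>root_dist x. \<exists>\<epsilon>>0. \<forall>y. near2 r \<epsilon> x y \<longrightarrow> y \<in> a \<inter> b"
        using * by (intro exI[of _ "max r r'"] conjI exI[of _ "min \<epsilon> \<epsilon>'"]) auto
    qed
  next
    case (UN K) then show ?case by (meson UnionE UnionI)
  next
    case (Basis s)
    then obtain r \<epsilon> y where "s = {z. near2 r \<epsilon> y z}" "0 < \<epsilon>" by blast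
    then have "root_dist x \<le> r \<and> (\<exists>\<delta>>0. \<forall>w. near2 r \<delta> x w \<longrightarrow> w \<in> s)" if "x \<in> s" for x
      using near2_open[of r \<epsilon> y x] that by simp
    then show ?case by blast
  qed
next
  assume *: "\<forall>x\<in>S. \<exists>r\<ge>root_dist x. \<exists>\<epsilon>>0. \<forall>y. near2 r \<epsilon> x y \<longrightarrow> y \<in> S"
  show "open S"
  proof (rule Topological_Spaces.openI)
    fix x assume "x \<in> S"
    with * obtain r and \<epsilon> :: real where "0 < \<epsilon>" "root_dist x \<le> r" "\<forall>y. near2 r \<epsilon> x y \<longrightarrow> y \<in> S" by blast
    then show "\<exists>T. open T \<and> x \<in> T \<and> T \<subseteq> S"
      using near2_refl[of \<epsilon> x r] open_near2[of \<epsilon> r x] by (intro exI[of _ "{y. near2 r \<epsilon> x y}"]) auto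
  qed
qed

lemma continuous_root1: "continuous_on UNIV (root1 :: 'x::metric_space birooted \<Rightarrow> _)"
proof (subst continuous_on_open_vimage; safe?)
  fix B :: "'x rooted set" assume B: "open B"
  show "open (root1 -` B \<inter> UNIV)"
    unfolding open_birooted_iff
  proof
    fix z assume "z \<in> root1 -` B \<inter> UNIV"
    then obtain r and \<epsilon> :: real where e: "0 < \<epsilon>" "\<forall>y. near1 r \<epsilon> (root1 z) y \<longrightarrow> y \<in> B"
      using B unfolding open_rooted_iff by blast
    have "root1 w \<in> B" if "near2 (max r (root_dist z)) \<epsilon> z w" for w
      using e near1_mono[OF near2_imp_near1_root1[OF that], of r \<epsilon>] by auto
    then show "\<exists>r\<ge>root_dist z. \<exists>\<epsilon>>0. \<forall>y. near2 r \<epsilon> z y \<longrightarrow> y \<in> root1 -` B \<inter> UNIV"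
      using e(1) by (intro exI[of _ "max r (root_dist z)"]) auto
  qed
qed simp

lemma continuous_flip: "continuous_on UNIV (flip :: 'x::metric_space birooted \<Rightarrow> _)"
proof (subst continuous_on_open_vimage; safe?)
  fix B :: "'x birooted set" assume B: "open B"
  show "open (flip -` B \<inter> UNIV)"
    unfolding open_birooted_iff
  proof
    fix z assume "z \<in> flip -` B \<inter> UNIV"
    then obtain r and \<epsilon> :: real where e: "0 < \<epsilon>" "root_dist z \<le> r"
        "\<forall>y. near2 r \<epsilon> (flip z) y \<longrightarrow> y \<in> B"
      using B unfolding open_birooted_iff by force
    have "flip w \<in> B" if "near2 (root_dist z + r) \<epsilon> z w" for w
      using e near2_flip[OF that] by auto
    then show "\<exists>r\<ge>root_dist z. \<exists>\<epsilon>>0. \<forall>y. near2 r \<epsilon> z y \<longrightarrow> y \<in> flip -` B \<inter> UNIV"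
      using e(1) by (intro exI[of _ "root_dist z + r"]) auto
  qed
qed simp

lemma open_root_dist: "open {z :: 'x::metric_space birooted. root_dist z = d}"
  unfolding open_birooted_iff using near2_imp_root_dist_eq zero_less_one by blast

lemma measurable_root1 [measurable]: "root1 \<in> borel \<rightarrow>\<^sub>M borel"
  by (rule borel_measurable_continuous_onI[OF continuous_root1])

lemma measurable_flip [measurable]: "flip \<in> borel \<rightarrow>\<^sub>M borel"
  by (rule borel_measurable_continuous_onI[OF continuous_flip])

lemma measurable_root2 [measurable]: "root2 \<in> borel \<rightarrow>\<^sub>M borel"
proof -
  have "root2 = root1 \<circ> (flip :: 'a birooted \<Rightarrow> _)" by (simp add: fun_eq_iff)
  then show ?thesis using measurable_comp[OF measurable_flip measurable_root1] by metis
qed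

lemma measurable_root_dist [measurable]: "root_dist \<in> borel \<rightarrow>\<^sub>M count_space UNIV"
  by (subst measurable_count_space_eq2_countable)
    (auto simp: vimage_def intro!: borel_open open_root_dist)

section \<open>Sums over the second root\<close>

lemma root_sum_fibre:
  obtains G u where "network G" "u \<in> verts G" "x = rcls (G, u)"
    "\<And>h. root_sum h x = (\<integral>\<^sup>+ v. h (bcls (G, u, v)) \<partial>count_space (verts G))"
    "\<And>z. root1 z = x \<longleftrightarrow> (\<exists>v\<in>verts G. z = bcls (G, u, v))"
proof -
  obtain G u where "network G" "u \<in> verts G" "x = rcls (G, u)" by (rule rooted_cases)
  then show thesis using that[of G u] by (simp add: root_sum_rcls birooted_fibre)
qed

lemma root_sum_cong: "(\<And>z. root1 z = x \<Longrightarrow> f z = g z) \<Longrightarrow> root_sum f x = root_sum g x"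
proof (rule root_sum_fibre[of x])
  fix G u
  assume fg: "\<And>z. root1 z = x \<Longrightarrow> f z = g z"
    and sum: "\<And>h. root_sum h x = (\<integral>\<^sup>+ v. h (bcls (G, u, v)) \<partial>count_space (verts G))"
    and fibre: "\<And>z. root1 z = x \<longleftrightarrow> (\<exists>v\<in>verts G. z = bcls (G, u, v))"
  show "root_sum f x = root_sum g x"
    unfolding sum
  proof (rule nn_integral_cong)
    fix v assume "v \<in> space (count_space (verts G))"
    then have "root1 (bcls (G, u, v)) = x" using fibre by auto
    then show "f (bcls (G, u, v)) = g (bcls (G, u, v))" by (rule fg)
  qed
qed

lemma root_sum_mono: "(\<And>z. root1 z = x \<Longrightarrow> f z \<le> g z) \<Longrightarrow> root_sum f x \<le> root_sum g x"
proof (rule root_sum_fibre[of x])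
  fix G u
  assume fg: "\<And>z. root1 z = x \<Longrightarrow> f z \<le> g z"
    and sum: "\<And>h. root_sum h x = (\<integral>\<^sup>+ v. h (bcls (G, u, v)) \<partial>count_space (verts G))"
    and fibre: "\<And>z. root1 z = x \<longleftrightarrow> (\<exists>v\<in>verts G. z = bcls (G, u, v))"
  show "root_sum f x \<le> root_sum g x"
    unfolding sum
  proof (rule nn_integral_mono)
    fix v assume "v \<in> space (count_space (verts G))"
    then have "root1 (bcls (G, u, v)) = x" using fibre by auto
    then show "f (bcls (G, u, v)) \<le> g (bcls (G, u, v))" by (rule fg)
  qed
qed

lemma root_sum_add: "root_sum (\<lambda>z. f z + g z) x = root_sum f x + root_sum g x"
  by (rule root_sum_fibre[of x]) (auto intro!: nn_integral_add)

lemma root_sum_cmult: "root_sum (\<lambda>z. c * f z) x = c * root_sum f x"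
  by (rule root_sum_fibre[of x]) (auto intro!: nn_integral_cmult)

lemma root_sum_mult_root1: "root_sum (\<lambda>z. c (root1 z) * f z) x = c x * root_sum f x"
  by (subst root_sum_cmult[symmetric]) (auto intro: root_sum_cong)

lemma root_sum_suminf: "root_sum (\<lambda>z. \<Sum>n. f n z) x = (\<Sum>n. root_sum (f n) x)"
  by (rule root_sum_fibre[of x]) (auto intro!: nn_integral_suminf)

lemma root_sum_SUP: "incseq f \<Longrightarrow> root_sum (\<lambda>z. SUP n. f n z) x = (SUP n. root_sum (f n) x)"
  by (rule root_sum_fibre[of x])
    (auto intro!: nn_integral_monotone_convergence_SUP simp: incseq_def le_fun_def)

lemma le_root_sum: "h z \<le> root_sum h (root1 z)"
proof (rule root_sum_fibre[of "root1 z"])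
  fix G u assume *: "\<And>h. root_sum h (root1 z) = (\<integral>\<^sup>+ v. h (bcls (G, u, v)) \<partial>count_space (verts G))"
    "\<And>w. root1 w = root1 z \<longleftrightarrow> (\<exists>v\<in>verts G. w = bcls (G, u, v))"
  then obtain v where v: "v \<in> verts G" "z = bcls (G, u, v)" by blast
  have "h z = (\<integral>\<^sup>+ w. h (bcls (G, u, w)) * indicator {v} w \<partial>count_space (verts G))"
    using v by (subst nn_integral_count_space'[of "{v}"]) auto
  also have "\<dots> \<le> root_sum h (root1 z)"
    unfolding * by (intro nn_integral_mono) (auto simp: indicator_def)
  finally show ?thesis .
qed

lemma root_sum_eq_0_iff: "root_sum h x = 0 \<longleftrightarrow> (\<forall>z. root1 z = x \<longrightarrow> h z = 0)"
proof
  assume "root_sum h x = 0"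
  then show "\<forall>z. root1 z = x \<longrightarrow> h z = 0" using le_root_sum[of h] by (metis le_zero_eq)
next
  assume "\<forall>z. root1 z = x \<longrightarrow> h z = 0"
  then have "root_sum h x = root_sum (\<lambda>z. 0 * h z) x" by (intro root_sum_cong) simp
  also have "\<dots> = 0" by (subst root_sum_cmult) simp
  finally show "root_sum h x = 0" .
qed

lemma root_sum_indicator:
  assumes "network G" "u \<in> verts G"
  shows "root_sum (indicator S) (rcls (G, u)) =
    emeasure (count_space UNIV) {v \<in> verts G. bcls (G, u, v) \<in> S}"
proof -
  have "root_sum (indicator S) (rcls (G, u)) =
      (\<integral>\<^sup>+ v. indicator {v \<in> verts G. bcls (G, u, v) \<in> S} v \<partial>count_space (verts G))"
    unfolding root_sum_rcls[OF assms] by (intro nn_integral_cong) (auto simp: indicator_def)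
  also have "\<dots> = emeasure (count_space (verts G)) {v \<in> verts G. bcls (G, u, v) \<in> S}"
    by (intro nn_integral_indicator) auto
  finally show ?thesis by (auto simp: emeasure_count_space)
qed

text \<open>
  Local finiteness. On pairs of roots at a fixed distance the sums are finite, so they can be
  subtracted from each other.
\<close>

lemma root_sum_sphere_finite: "root_sum (indicator (S \<inter> {z. root_dist z = d})) x < \<infinity>"
proof -
  obtain G u where G: "network G" "u \<in> verts G" "x = rcls (G, u)" by (rule rooted_cases)
  have "{v \<in> verts G. bcls (G, u, v) \<in> S \<inter> {z. root_dist z = d}} \<subseteq> verts (net_ball G u d)"
    using G by (auto simp: root_dist_bcls)
  then have "finite {v \<in> verts G. bcls (G, u, v) \<in> S \<inter> {z. root_dist z = d}}"
    by (rule finite_subset) (rule finite_net_ball(1)[OF G(1,2)])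
  then show ?thesis using G by (simp add: root_sum_indicator emeasure_count_space of_nat_less_top)
qed

text \<open>
  Finitely many second roots in \<open>S\<close> persist, and remain distinct, in every network that agrees
  closely enough with the given one on a ball that contains them.
\<close>

lemma open_root_sum_indicator:
  fixes S :: "'x::metric_space birooted set"
  assumes "open S"
  shows "open {x. c < root_sum (indicator S) x}"
  unfolding open_rooted_iff
proof
  fix x assume "x \<in> {x. c < root_sum (indicator S) x}"
  then have c: "c < root_sum (indicator S) x" by simp
  obtain G u where G: "network G" "u \<in> verts G" "x = rcls (G, u)" by (rule rooted_cases)
  let ?V = "{v \<in> verts G. bcls (G, u, v) \<in> S}"
  have c': "c < emeasure (count_space UNIV) ?V" using c G by (simp add: root_sum_indicator)
  obtain F where F: "finite F" "F \<subseteq> ?V" "c < of_nat (card F)"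
  proof (cases "finite ?V")
    case True
    then show ?thesis using c' that[of ?V] by (simp add: emeasure_count_space)
  next
    case False
    have "c < \<infinity>" using c' by (rule order_less_le_trans) simp
    then obtain n where "c < of_nat n" using ennreal_Ex_less_of_nat by auto
    moreover have "\<exists>F. finite F \<and> card F = n \<and> F \<subseteq> ?V"
      by (rule infinite_arbitrarily_large[OF False])
    ultimately show ?thesis using that by blast
  qed
  have "\<forall>v\<in>F. \<exists>r \<epsilon>. root_dist (bcls (G, u, v)) \<le> r \<and> 0 < \<epsilon> \<and>
      (\<forall>w. near2 r \<epsilon> (bcls (G, u, v)) w \<longrightarrow> w \<in> S)"
    using assms F(2) unfolding open_birooted_iff by blast
  then obtain r \<epsilon> where re: "\<And>v. v \<in> F \<Longrightarrow> root_dist (bcls (G, u, v)) \<le> r v" "\<And>v. v \<in> F \<Longrightarrow> 0 < \<epsilon> v"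
    "\<And>v w. v \<in> F \<Longrightarrow> near2 (r v) (\<epsilon> v) (bcls (G, u, v)) w \<Longrightarrow> w \<in> S"
    by metis
  define R where "R = Max (insert 0 (r ` F))"
  define E where "E = Min (insert (1::real) (\<epsilon> ` F))"
  have R: "r v \<le> R" if "v \<in> F" for v using F(1) that by (auto simp: R_def intro!: Max_ge)
  have E: "E \<le> \<epsilon> v" if "v \<in> F" for v using F(1) that by (auto simp: E_def intro!: Min_le)
  have E0: "0 < E" using F(1) re(2) by (auto simp: E_def)
  have FR: "gdist G u v \<le> R" if "v \<in> F" for v
    using re(1)[OF that] R[OF that] F(2) G that by (auto simp: root_dist_bcls)
  have "c < root_sum (indicator S) y" if n: "near1 R E x y" for y
  proof -
    obtain H t where H: "network H" "t \<in> verts H" "y = rcls (H, t)" by (rule rooted_cases)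
    from n G H obtain f g where
      i: "net_iso (\<lambda>a b. dist a b < E) f g (net_ball G u R) (net_ball H t R)" and f: "f u = t"
      by (auto simp: near1_rcls)
    have inj: "inj_on f F"
    proof (rule inj_on_subset)
      show "inj_on f (verts (net_ball G u R))" using i unfolding net_iso_def bij_betw_def by blast
      show "F \<subseteq> verts (net_ball G u R)" using F(2) FR by auto
    qed
    have "f v \<in> verts H \<and> bcls (H, t, f v) \<in> S" if v: "v \<in> F" for v
    proof
      have vG: "v \<in> verts G" using F(2) v by auto
      show fv: "f v \<in> verts H"
        using net_iso_subball(1)[OF i f G(1,2) vG H(1,2), of 0] FR[OF v] by simp
      have "near2 R E (bcls (G, u, v)) (bcls (H, t, f v))"
        using i f G H vG fv FR[OF v] by (auto simp: near2_bcls)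
      then have "near2 (r v) (\<epsilon> v) (bcls (G, u, v)) (bcls (H, t, f v))"
        by (rule near2_mono) (use R E re(1) v in auto)
      then show "bcls (H, t, f v) \<in> S" using re(3) v by blast
    qed
    then have "f ` F \<subseteq> {w \<in> verts H. bcls (H, t, w) \<in> S}" by auto
    then have "emeasure (count_space UNIV) (f ` F) \<le> root_sum (indicator S) y"
      unfolding H(3) root_sum_indicator[OF H(1,2)] by (intro emeasure_mono) auto
    moreover have "emeasure (count_space UNIV) (f ` F) = of_nat (card F)"
      using F(1) inj by (simp add: emeasure_count_space card_image)
    ultimately show ?thesis using F(3) by (metis order_less_le_trans)
  qed
  with E0 show "\<exists>r. \<exists>\<epsilon>>0. \<forall>y. near1 r \<epsilon> x y \<longrightarrow> y \<in> {x. c < root_sum (indicator S) x}" by blast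
qed

text \<open>
  A Dynkin argument from the open sets, which are stable under intersection. Fixing the distance \<open>d\<close>
  makes the step to the complement a subtraction of finite sums.
\<close>

lemma measurable_root_sum_indicator_sphere:
  fixes B :: "'x::metric_space birooted set"
  assumes "B \<in> sets borel"
  shows "root_sum (indicator (B \<inter> {z. root_dist z = d})) \<in> borel_measurable borel"
proof -
  let ?D = "{z :: 'x birooted. root_dist z = d}"
  have op: "root_sum (indicator (B \<inter> ?D)) \<in> borel_measurable borel" if "open B" for B
    using open_root_sum_indicator[OF open_Int[OF that open_root_dist[of d]]]
    by (intro borel_measurableI_greater) (auto simp: borel_open)
  have "Int_stable {S :: 'x birooted set. open S}" by (auto simp: Int_stable_def)
  moreover have "{S. open S} \<subseteq> Pow (UNIV :: 'x birooted set)" by simp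
  moreover have "B \<in> sigma_sets UNIV {S. open S}" using assms by (simp add: borel_def)
  ultimately show ?thesis
  proof (induction rule: sigma_sets_induct_disjoint)
    case (basic A) then show ?case using op by simp
  next
    case empty then show ?case using op[OF open_empty] unfolding Int_empty_left .
  next
    case (compl A)
    let ?f = "root_sum (indicator (A \<inter> ?D))" and ?g = "root_sum (indicator ((UNIV - A) \<inter> ?D))"
    have "?g x = root_sum (indicator (UNIV \<inter> ?D)) x - ?f x" for x
    proof -
      have "root_sum (indicator (UNIV \<inter> ?D)) x
          = root_sum (\<lambda>z. indicator (A \<inter> ?D) z + indicator ((UNIV - A) \<inter> ?D) z) x"
        by (rule root_sum_cong) (auto simp: indicator_def)
      also have "\<dots> = ?f x + ?g x" by (rule root_sum_add)
      finally show ?thesis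
        using root_sum_sphere_finite[of A d x] by (simp add: ennreal_add_diff_cancel_left)
    qed
    moreover have "(\<lambda>x. root_sum (indicator (UNIV \<inter> ?D)) x - ?f x) \<in> borel_measurable borel"
      using op[OF open_UNIV] compl.IH by measurable
    ultimately show ?case by (simp add: fun_eq_iff[symmetric])
  next
    case (union A)
    have "root_sum (indicator (\<Union>(range A) \<inter> ?D)) x = (\<Sum>i. root_sum (indicator (A i \<inter> ?D)) x)" for x
    proof -
      have "disjoint_family (\<lambda>i. A i \<inter> ?D)" using union(1) by (auto simp: disjoint_family_on_def)
      then have "indicator (\<Union>(range A) \<inter> ?D) z = (\<Sum>i. indicator (A i \<inter> ?D) z :: ennreal)" for z
        by (subst suminf_indicator) auto
      then have "root_sum (indicator (\<Union>(range A) \<inter> ?D)) x =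
          root_sum (\<lambda>z. \<Sum>i. indicator (A i \<inter> ?D) z) x"
        by (rule root_sum_cong)
      then show ?thesis by (simp add: root_sum_suminf)
    qed
    moreover have "(\<lambda>x. \<Sum>i. root_sum (indicator (A i \<inter> ?D)) x) \<in> borel_measurable borel"
      using union.IH by measurable
    ultimately show ?case by (simp add: fun_eq_iff[symmetric])
  qed
qed

lemma measurable_root_sum [measurable]:
  fixes h :: "'x::metric_space birooted \<Rightarrow> ennreal"
  assumes "h \<in> borel_measurable borel"
  shows "root_sum h \<in> borel_measurable borel"
  using assms
proof (induction rule: borel_measurable_induct)
  case (cong f g) then show ?case by (simp add: fun_eq_iff[symmetric])
next
  case (set A)
  have "root_sum (indicator A) x = (\<Sum>d. root_sum (indicator (A \<inter> {z. root_dist z = d})) x)" for x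
  proof -
    have "indicator A z = (\<Sum>d. indicator (A \<inter> {z. root_dist z = d}) z :: ennreal)" for z
      by (subst suminf_indicator) (auto simp: disjoint_family_on_def indicator_def)
    then have "root_sum (indicator A) x = root_sum (\<lambda>z. \<Sum>d. indicator (A \<inter> {z. root_dist z = d}) z) x"
      by (rule root_sum_cong)
    then show ?thesis by (simp add: root_sum_suminf)
  qed
  moreover have "(\<lambda>x. \<Sum>d. root_sum (indicator (A \<inter> {z. root_dist z = d})) x) \<in> borel_measurable borel"
    using measurable_root_sum_indicator_sphere[OF set] by measurable
  ultimately show ?case by (simp add: fun_eq_iff[symmetric])
next
  case (mult u v)
  then show ?case unfolding root_sum_cmult[abs_def] by measurable
next
  case (add u v)
  then show ?case unfolding root_sum_add[abs_def] by measurable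
next
  case (seq U)
  have "Sup (range U) = (\<lambda>z. SUP n. U n z)" by (simp add: fun_eq_iff image_comp)
  then have "root_sum (Sup (range U)) = (\<lambda>x. SUP n. root_sum (U n) x)"
    using root_sum_SUP[OF seq(3)] by presburger
  moreover have "(\<lambda>x. SUP n. root_sum (U n) x) \<in> borel_measurable borel"
    using seq.IH by measurable
  ultimately show ?case by (simp only:)
qed

section \<open>The measure of pairs of roots\<close>

text \<open>
  The measure that integrates \<open>h\<close> to the \<open>\<mu>\<close>-mean of the sum of \<open>h [G, o, v]\<close> over all vertices \<open>v\<close>.
  It is in general infinite. Root-changes are second marginals of its densities.
\<close>

definition vertex_measure :: "'x::metric_space rooted measure \<Rightarrow> 'x birooted measure" where
  "vertex_measure \<mu> = measure_of UNIV (sets borel) (\<lambda>B. \<integral>\<^sup>+ x. root_sum (indicator B) x \<partial>\<mu>)"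

lemma sets_vertex_measure [simp, measurable_cong]: "sets (vertex_measure \<mu>) = sets borel"
  using sets.sigma_sets_eq[of "borel :: 'a birooted measure"] by (simp add: vertex_measure_def)

lemma space_vertex_measure [simp]: "space (vertex_measure \<mu>) = UNIV"
  using sets_eq_imp_space_eq[OF sets_vertex_measure] by simp

lemma emeasure_vertex_measure:
  fixes \<mu> :: "'x::metric_space rooted measure"
  assumes [measurable_cong]: "sets \<mu> = sets borel" and B: "B \<in> sets borel"
  shows "emeasure (vertex_measure \<mu>) B = (\<integral>\<^sup>+ x. root_sum (indicator B) x \<partial>\<mu>)"
  unfolding vertex_measure_def
proof (rule emeasure_measure_of_sigma)
  show "sigma_algebra UNIV (sets (borel :: 'x birooted measure))"
    using sets.sigma_algebra_axioms[of "borel :: 'x birooted measure"] by simp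
  show "positive (sets borel) (\<lambda>B :: 'x birooted set. \<integral>\<^sup>+ x. root_sum (indicator B) x \<partial>\<mu>)"
  proof -
    have "(\<integral>\<^sup>+ x. root_sum (indicator {}) x \<partial>\<mu>) = (\<integral>\<^sup>+ x. 0 \<partial>\<mu>)"
      by (rule nn_integral_cong) (simp add: root_sum_eq_0_iff)
    then show ?thesis unfolding positive_def by simp
  qed
  show "countably_additive (sets borel) (\<lambda>B :: 'x birooted set. \<integral>\<^sup>+ x. root_sum (indicator B) x \<partial>\<mu>)"
  proof (rule countably_additiveI)
    fix F :: "nat \<Rightarrow> 'x birooted set" assume F: "range F \<subseteq> sets borel" "disjoint_family F"
    have [measurable]: "F i \<in> sets borel" for i using F(1) by auto
    have "root_sum (indicator (\<Union>(range F))) x = (\<Sum>i. root_sum (indicator (F i)) x)" for x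
    proof -
      have "root_sum (indicator (\<Union>(range F))) x = root_sum (\<lambda>z. \<Sum>i. indicator (F i) z) x"
        by (rule root_sum_cong) (simp add: suminf_indicator[OF F(2)])
      then show ?thesis by (simp add: root_sum_suminf)
    qed
    then show "(\<Sum>i. \<integral>\<^sup>+ x. root_sum (indicator (F i)) x \<partial>\<mu>) =
        (\<integral>\<^sup>+ x. root_sum (indicator (\<Union>(range F))) x \<partial>\<mu>)"
      by (simp add: nn_integral_suminf[symmetric])
  qed
qed (rule B)

lemma nn_integral_vertex_measure:
  fixes \<mu> :: "'x::metric_space rooted measure"
  assumes \<mu> [measurable_cong]: "sets \<mu> = sets borel" and h: "h \<in> borel_measurable borel"
  shows "(\<integral>\<^sup>+ z. h z \<partial>vertex_measure \<mu>) = (\<integral>\<^sup>+ x. root_sum h x \<partial>\<mu>)"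
  using h
proof (induction rule: borel_measurable_induct)
  case (cong f g)
  then have "f = g" by (simp add: fun_eq_iff)
  then show ?case using cong by simp
next
  case (set A) then show ?case using emeasure_vertex_measure[OF \<mu>] by simp
next
  case (mult u v)
  then have [measurable]: "u \<in> borel_measurable borel" by simp
  show ?case using mult by (simp add: root_sum_cmult nn_integral_cmult)
next
  case (add u v)
  then have [measurable]: "u \<in> borel_measurable borel" "v \<in> borel_measurable borel" by simp_all
  show ?case using add by (simp add: root_sum_add nn_integral_add)
next
  case (seq U)
  have [measurable]: "U i \<in> borel_measurable borel" for i by (rule seq)
  have inc: "incseq (\<lambda>n. root_sum (U n))"
    using seq(3) unfolding incseq_def le_fun_def by (auto intro: root_sum_mono)
  have e: "Sup (range U) = (\<lambda>z. SUP n. U n z)" by (simp add: fun_eq_iff image_comp)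
  have "(\<integral>\<^sup>+ z. (SUP n. U n z) \<partial>vertex_measure \<mu>) = (SUP n. \<integral>\<^sup>+ z. U n z \<partial>vertex_measure \<mu>)"
    by (rule nn_integral_monotone_convergence_SUP[OF seq(3)]) measurable
  also have "\<dots> = (SUP n. \<integral>\<^sup>+ x. root_sum (U n) x \<partial>\<mu>)" using seq.IH by simp
  also have "\<dots> = (\<integral>\<^sup>+ x. (SUP n. root_sum (U n) x) \<partial>\<mu>)"
    by (rule nn_integral_monotone_convergence_SUP[symmetric, OF inc]) measurable
  also have "\<dots> = (\<integral>\<^sup>+ x. root_sum (\<lambda>z. SUP n. U n z) x \<partial>\<mu>)"
    by (simp only: root_sum_SUP[OF seq(3)])
  finally show ?case unfolding e .
qed


section \<open>Local convergence separates rooted networks\<close>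

text \<open>
  Compactness of a countable product of finite sets, by a diagonal argument.
\<close>

lemma pointwise_constant_subsequence:
  fixes h :: "nat \<Rightarrow> 'i::countable \<Rightarrow> nat"
  assumes fin: "\<And>i. \<exists>F. finite F \<and> (\<forall>\<^sub>F n in sequentially. h n i \<in> F)"
  shows "\<exists>s l. strict_mono s \<and> (\<forall>i. \<forall>\<^sub>F n in sequentially. h (s n) i = l i)"
proof -
  define P where "P k s \<longleftrightarrow> (\<exists>l. \<forall>\<^sub>F n in sequentially. h (s n) (from_nat k) = l)" for k s
  interpret subseqs P
  proof
    fix k and s :: "nat \<Rightarrow> nat" assume s: "strict_mono s"
    obtain F where F: "finite F" "\<forall>\<^sub>F n in sequentially. h n (from_nat k) \<in> F" using fin by blast
    have "\<forall>\<^sub>F n in sequentially. h (s n) (from_nat k) \<in> F" by (rule eventually_subseq[OF s F(2)])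
    then obtain n0 where n0: "\<And>n. n \<ge> n0 \<Longrightarrow> h (s n) (from_nat k) \<in> F"
      unfolding eventually_sequentially by blast
    have "{n0..} \<subseteq> (\<Union>l\<in>F. {n. h (s n) (from_nat k) = l})" using n0 by auto
    then have "infinite (\<Union>l\<in>F. {n. h (s n) (from_nat k) = l})"
      using infinite_super infinite_Ici by blast
    then obtain l where l: "infinite {n. h (s n) (from_nat k) = l}" using F(1) by blast
    define r where "r = enumerate {n. h (s n) (from_nat k) = l}"
    have "strict_mono r" unfolding r_def by (rule strict_mono_enumerate[OF l])
    moreover have "h (s (r n)) (from_nat k) = l" for n
      using enumerate_in_set[OF l, of n] by (simp add: r_def)
    ultimately show "\<exists>r. strict_mono r \<and> P k (s \<circ> r)" unfolding P_def by auto
  qed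
  have "P k (diagseq \<circ> (+) (Suc k))" for k
  proof (rule diagseq_holds)
    fix r s n assume "strict_mono (r :: nat \<Rightarrow> nat)" "P n s"
    then show "P n (s \<circ> r)" unfolding P_def using eventually_subseq by fastforce
  qed
  then have "\<exists>l. \<forall>\<^sub>F n in sequentially. h (diagseq (Suc k + n)) (from_nat k) = l" for k
    unfolding P_def comp_def .
  then have "\<exists>l. \<forall>\<^sub>F n in sequentially. h (diagseq (n + Suc k)) (from_nat k) = l" for k
    by (subst add.commute)
  then have "\<exists>l. \<forall>\<^sub>F n in sequentially. h (diagseq n) (from_nat k) = l" for k
    using eventually_sequentially_seg[of "\<lambda>n. h (diagseq n) (from_nat k) = _" "Suc k"] by blast
  then have "\<exists>l. \<forall>\<^sub>F n in sequentially. h (diagseq n) i = l" for i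
    by (metis from_nat_to_nat)
  then have "\<exists>l. \<forall>i. \<forall>\<^sub>F n in sequentially. h (diagseq n) i = l i" by metis
  with subseq_diagseq show ?thesis by blast
qed

lemma net_iso_cong:
  assumes "net_iso R f g A B" "\<And>v. v \<in> verts A \<Longrightarrow> f v = f' v" "\<And>e. e \<in> edges A \<Longrightarrow> g e = g' e"
    and "\<And>e. e \<in> edges A \<Longrightarrow> ends A e \<subseteq> verts A"
  shows "net_iso R f' g' A B"
  unfolding net_iso_def
proof (intro conjI ballI)
  show "bij_betw f' (verts A) (verts B)" "bij_betw g' (edges A) (edges B)"
    using assms(1-3) bij_betw_cong[of "verts A" f f'] bij_betw_cong[of "edges A" g g']
    unfolding net_iso_def by auto
  show "ends B (g' e) = f' ` ends A e" if e: "e \<in> edges A" for e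
  proof -
    have "f ` ends A e = f' ` ends A e" using assms(2,4) e by (intro image_cong) auto
    then show ?thesis using assms(1,3) e unfolding net_iso_def by auto
  qed
  show "R (vmark A v) (vmark B (f' v))" if "v \<in> verts A" for v
    using assms(1,2) that unfolding net_iso_def by auto
  show "R (emark A v e) (emark B (f' v) (g' e))" if e: "e \<in> edges A" "v \<in> ends A e" for e v
  proof -
    have "v \<in> verts A" using assms(4) e by auto
    then have "f' v = f v" "g' e = g e" using assms(2,3) e by auto
    then show ?thesis using assms(1) e unfolding net_iso_def by auto
  qed
qed

lemma net_iso_eqI_dist:
  assumes "\<And>\<epsilon>. 0 < \<epsilon> \<Longrightarrow> net_iso (\<lambda>a b. dist a b < \<epsilon>) f g A B"
  shows "net_iso (=) f g A B"
proof -
  have eq: "a = b" if "\<And>\<epsilon>. 0 < \<epsilon> \<Longrightarrow> dist a b < \<epsilon>" for a b :: 'a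
    using that[of "dist a b"] by (metis less_irrefl zero_less_dist_iff)
  show ?thesis
    using assms[of 1] eq assms unfolding net_iso_def by (auto 0 3)
qed

lemma edge_in_net_ball:
  assumes "network G" "e \<in> edges G"
  shows "\<exists>d. e \<in> edges (net_ball G u d)"
proof -
  obtain a b where ab: "a \<in> verts G" "b \<in> verts G" "ends G e = {a, b}"
    using assms unfolding network_def by blast
  then show ?thesis
    using assms(2) by (intro exI[of _ "max (gdist G u a) (gdist G u b)"]) auto
qed

lemma net_iso_of_balls:
  assumes iso: "\<And>d. net_iso R f g (net_ball G u d) (net_ball H t d)"
    and G: "network G" and H: "network H"
  shows "net_iso R f g G H"
proof -
  have vs: "verts K = (\<Union>d\<in>UNIV. verts (net_ball K w d))" for K :: "'b net" and w by auto
  have es: "edges K = (\<Union>d\<in>UNIV. edges (net_ball K w d))" if "network K" for K :: "'b net" and w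
    using edge_in_net_ball[OF that] by auto
  have mono: "d \<le> d' \<Longrightarrow> verts (net_ball K w d) \<subseteq> verts (net_ball K w d')"
    "d \<le> d' \<Longrightarrow> edges (net_ball K w d) \<subseteq> edges (net_ball K w d')" for K :: "'b net" and w d d'
    by (auto intro: order_trans simp: subset_iff)
  have "bij_betw f (verts G) (verts H)"
    unfolding vs[of G u] vs[of H t]
  proof (rule bij_betw_UNION_chain)
    show "verts (net_ball G u i) \<subseteq> verts (net_ball G u j) \<or> verts (net_ball G u j) \<subseteq> verts (net_ball G u i)" for i j
      using mono(1) linear by metis
  qed (use iso in \<open>simp add: net_iso_def\<close>)
  moreover have "bij_betw g (edges G) (edges H)"
    unfolding es[OF G, of u] es[OF H, of t]
  proof (rule bij_betw_UNION_chain)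
    show "edges (net_ball G u i) \<subseteq> edges (net_ball G u j) \<or> edges (net_ball G u j) \<subseteq> edges (net_ball G u i)" for i j
      using mono(2) linear by metis
  qed (use iso in \<open>simp add: net_iso_def\<close>)
  moreover have "ends H (g e) = f ` ends G e \<and> (\<forall>v\<in>ends G e. R (emark G v e) (emark H (f v) (g e)))"
    if e: "e \<in> edges G" for e
  proof -
    obtain d where "e \<in> edges (net_ball G u d)" using edge_in_net_ball[OF G e] by blast
    then show ?thesis using iso[of d] unfolding net_iso_def by simp
  qed
  moreover have "R (vmark G v) (vmark H (f v))" if "v \<in> verts G" for v
    using iso[of "gdist G u v"] that unfolding net_iso_def by simp
  ultimately show ?thesis unfolding net_iso_def by blast
qed

text \<open>
  Koenig's lemma. Take nearly mark-preserving isomorphisms of the balls of radius \<open>n\<close>, with an error that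
  tends to 0. Each vertex and each edge has only finitely many possible images, as distances from
  the root are preserved, so along a subsequence all images become constant. On each ball the limit
  coincides with isomorphisms of arbitrarily small error, so it preserves marks exactly.
\<close>

lemma near1_all_imp_eq:
  assumes "\<And>r \<epsilon>. 0 < \<epsilon> \<Longrightarrow> near1 r \<epsilon> x y"
  shows "x = y"
proof -
  obtain G u where G: "network G" "u \<in> verts G" "x = rcls (G, u)" by (rule rooted_cases)
  obtain H t where H: "network H" "t \<in> verts H" "y = rcls (H, t)" by (rule rooted_cases)
  let ?\<epsilon> = "\<lambda>n. 1 / real (Suc n)"
  have "\<forall>n. \<exists>f g. net_iso (\<lambda>a b. dist a b < ?\<epsilon> n) f g (net_ball G u n) (net_ball H t n) \<and> f u = t"
    using assms[of "?\<epsilon> _"] G H by (simp add: near1_rcls)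
  then obtain f g where
    i: "\<And>n. net_iso (\<lambda>a b. dist a b < ?\<epsilon> n) (f n) (g n) (net_ball G u n) (net_ball H t n)"
    and f: "\<And>n. f n u = t" by metis
  have sub: "net_iso (\<lambda>a b. dist a b < ?\<epsilon> n) (f n) (g n) (net_ball G u d) (net_ball H t d)" if "d \<le> n" for n d
    using net_iso_subball(3)[OF i f G(1,2,2) H(1,2), of d] f that by simp
  \<comment> \<open>The vertex maps and the edge maps as one family, with the constant 0 off the network.\<close>
  define h where "h n i = (case i of Inl v \<Rightarrow> if v \<in> verts G then f n v else 0
    | Inr e \<Rightarrow> if e \<in> edges G then g n e else 0)" for n i
  have fin: "\<exists>F. finite F \<and> (\<forall>\<^sub>F n in sequentially. h n i \<in> F)" for i
  proof (cases "(\<exists>v\<in>verts G. i = Inl v) \<or> (\<exists>e\<in>edges G. i = Inr e)")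
    case False
    then have "h n i = 0" for n by (cases i) (auto simp: h_def)
    then show ?thesis by (intro exI[of _ "{0}"]) simp
  next
    case True
    then show ?thesis
    proof (elim disjE bexE)
      fix v assume v: "v \<in> verts G" "i = Inl v"
      let ?d = "gdist G u v"
      have "h n i \<in> verts (net_ball H t ?d)" if "?d \<le> n" for n
        using sub[OF that] v unfolding net_iso_def bij_betw_def by (auto simp: h_def)
      then show ?thesis
        by (intro exI[of _ "verts (net_ball H t ?d)"] conjI finite_net_ball(1)[OF H(1,2)]
          eventually_mono[OF eventually_ge_at_top[of ?d]])
    next
      fix e assume e: "e \<in> edges G" "i = Inr e"
      obtain d where d: "e \<in> edges (net_ball G u d)" using edge_in_net_ball[OF G(1) e(1)] by blast
      have "h n i \<in> edges (net_ball H t d)" if "d \<le> n" for n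
        using sub[OF that] e d unfolding net_iso_def bij_betw_def by (auto simp: h_def)
      then show ?thesis
        by (intro exI[of _ "edges (net_ball H t d)"] conjI finite_net_ball(2)[OF H(1,2)]
          eventually_mono[OF eventually_ge_at_top[of d]])
    qed
  qed
  obtain s l where s: "strict_mono s" and l: "\<And>i. \<forall>\<^sub>F n in sequentially. h (s n) i = l i"
    using pointwise_constant_subsequence[of h, OF fin] by blast
  define f' where "f' v = l (Inl v)" for v
  define g' where "g' e = l (Inr e)" for e
  have "net_iso (\<lambda>a b. dist a b < \<epsilon>) f' g' (net_ball G u d) (net_ball H t d) \<and> f' u = t"
    if e: "0 < \<epsilon>" for \<epsilon> d
  proof -
    have ev: "\<forall>\<^sub>F n in sequentially. \<forall>v\<in>verts (net_ball G u d). f (s n) v = f' v"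
    proof (rule eventually_ball_finite[OF finite_net_ball(1)[OF G(1,2)]], rule ballI)
      fix v assume "v \<in> verts (net_ball G u d)"
      then have "h n (Inl v) = f n v" for n by (simp add: h_def)
      then show "\<forall>\<^sub>F n in sequentially. f (s n) v = f' v" using l[of "Inl v"] by (simp add: f'_def)
    qed
    have ee: "\<forall>\<^sub>F n in sequentially. \<forall>e\<in>edges (net_ball G u d). g (s n) e = g' e"
    proof (rule eventually_ball_finite[OF finite_net_ball(2)[OF G(1,2)]], rule ballI)
      fix e assume "e \<in> edges (net_ball G u d)"
      then have "h n (Inr e) = g n e" for n by (simp add: h_def)
      then show "\<forall>\<^sub>F n in sequentially. g (s n) e = g' e" using l[of "Inr e"] by (simp add: g'_def)
    qed
    obtain N where N: "?\<epsilon> N < \<epsilon>" using e nat_approx_posE by blast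
    have "\<forall>\<^sub>F n in sequentially. max d N \<le> s n"
      using filterlim_subseq[OF s] unfolding filterlim_at_top by blast
    with ev ee have "\<forall>\<^sub>F n in sequentially. (\<forall>v\<in>verts (net_ball G u d). f (s n) v = f' v) \<and>
        (\<forall>e\<in>edges (net_ball G u d). g (s n) e = g' e) \<and> max d N \<le> s n"
      by eventually_elim blast
    then obtain n where n: "\<And>v. v \<in> verts (net_ball G u d) \<Longrightarrow> f (s n) v = f' v"
      "\<And>e. e \<in> edges (net_ball G u d) \<Longrightarrow> g (s n) e = g' e" "max d N \<le> s n"
      using eventually_happens'[OF sequentially_bot] by blast
    have "net_iso (\<lambda>a b. dist a b < ?\<epsilon> (s n)) f' g' (net_ball G u d) (net_ball H t d)"
      by (rule net_iso_cong[OF sub]) (use n in auto)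
    moreover have "?\<epsilon> (s n) < \<epsilon>"
    proof -
      have "?\<epsilon> (s n) \<le> ?\<epsilon> N" using n(3) by (intro divide_left_mono) auto
      then show ?thesis using N by simp
    qed
    ultimately have "net_iso (\<lambda>a b. dist a b < \<epsilon>) f' g' (net_ball G u d) (net_ball H t d)"
      by (auto elim!: net_iso_mono)
    moreover have "f' u = t" using n(1)[of u] f G(2) by simp
    ultimately show ?thesis by blast
  qed
  note iso = this
  have "net_iso (=) f' g' (net_ball G u d) (net_ball H t d)" for d
    by (rule net_iso_eqI_dist) (use iso in blast)
  then have "net_iso (=) f' g' G H" by (rule net_iso_of_balls[OF _ G(1) H(1)])
  moreover have "f' u = t" using iso[OF zero_less_one] by blast
  ultimately have "iso1 (G, u) (H, t)" using G H unfolding iso1.simps by blast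
  then show ?thesis using G H Quotient_rel_abs[OF Quotient_rooted] by metis
qed

section \<open>Countably many events separate rooted networks\<close>

text \<open>
  Invert the first isomorphism and compose; the errors add up by the triangle inequality.
\<close>

lemma net_iso_span:
  assumes i: "net_iso (\<lambda>a b. dist a b < \<delta>) f g A B" and j: "net_iso (\<lambda>a b. dist a b < \<epsilon>) f' g' A C"
    and ends: "\<And>e. e \<in> edges A \<Longrightarrow> ends A e \<subseteq> verts A" and v: "v \<in> verts A"
  shows "\<exists>h k. net_iso (\<lambda>a b. dist a b < \<delta> + \<epsilon>) h k B C \<and> h (f v) = f' v"
proof -
  let ?f = "inv_into (verts A) f" and ?g = "inv_into (edges A) g"
  have "net_iso ((\<lambda>a b. dist a b < \<delta>)\<inverse>\<inverse> OO (\<lambda>a b. dist a b < \<epsilon>)) (f' \<circ> ?f) (g' \<circ> ?g) B C"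
    by (rule net_iso_comp[OF net_iso_inv[OF i ends] j ends])
  then have "net_iso (\<lambda>a b. dist a b < \<delta> + \<epsilon>) (f' \<circ> ?f) (g' \<circ> ?g) B C"
  proof (rule net_iso_mono)
    fix a c :: 'a assume "((\<lambda>a b. dist a b < \<delta>)\<inverse>\<inverse> OO (\<lambda>a b. dist a b < \<epsilon>)) a c"
    then obtain b where "dist b a < \<delta>" "dist b c < \<epsilon>" by auto
    then show "dist a c < \<delta> + \<epsilon>" using dist_triangle3[of a c b] by simp
  qed
  moreover have "?f (f v) = v"
    using i v unfolding net_iso_def by (meson bij_betw_inv_into_left)
  ultimately show ?thesis by (intro exI[of _ "f' \<circ> ?f"] exI[of _ "g' \<circ> ?g"]) simp
qed

lemma near1_span:
  assumes "near1 r \<delta> w x" "near1 r \<epsilon> w y"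
  shows "near1 r (\<delta> + \<epsilon>) x y"
proof -
  obtain A v where A: "network A" "v \<in> verts A" "w = rcls (A, v)" by (rule rooted_cases)
  obtain G u where G: "network G" "u \<in> verts G" "x = rcls (G, u)" by (rule rooted_cases)
  obtain H t where H: "network H" "t \<in> verts H" "y = rcls (H, t)" by (rule rooted_cases)
  from assms A G H obtain f g f' g' where
    i: "net_iso (\<lambda>a b. dist a b < \<delta>) f g (net_ball A v r) (net_ball G u r)" "f v = u"
    and j: "net_iso (\<lambda>a b. dist a b < \<epsilon>) f' g' (net_ball A v r) (net_ball H t r)" "f' v = t"
    by (auto simp: near1_rcls)
  show ?thesis
    using net_iso_span[OF i(1) j(1), of v] i(2) j(2) A G H by (simp add: near1_rcls)
qed

text \<open>
  Codes of finite networks with vertices \<open>0, \<dots>, n - 1\<close> and marks in the range of \<open>D\<close>: the number of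
  vertices, the list of the end points of the edges, the indices of the vertex marks, and for each
  edge the indices of its marks at all vertices, incident or not. As a type of lists it is countable.
\<close>

type_synonym net_code = "nat \<times> (nat \<times> nat) list \<times> nat list \<times> nat list list"

fun decode :: "(nat \<Rightarrow> 'x) \<Rightarrow> net_code \<Rightarrow> 'x net" where
  "decode D (n, es, vs, ms) = \<lparr>verts = {..<n}, edges = {..<length es},
    ends = (\<lambda>e. {fst (es ! e), snd (es ! e)}), vmark = (\<lambda>v. D (vs ! v)), emark = (\<lambda>v e. D (ms ! e ! v))\<rparr>"

lemma finite_net_approx_code:
  fixes B :: "'x::metric_space net"
  assumes fin: "finite (verts B)" "finite (edges B)"
    and ends: "\<And>e. e \<in> edges B \<Longrightarrow> \<exists>a\<in>verts B. \<exists>b\<in>verts B. ends B e = {a, b}"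
    and dense: "\<And>a. \<exists>i. dist (D i) a < \<epsilon>"
  shows "\<exists>c f g. net_iso (\<lambda>a b. dist a b < \<epsilon>) f g (decode D c) B \<and>
    (\<forall>e\<in>edges (decode D c). ends (decode D c) e \<subseteq> verts (decode D c))"
proof -
  obtain f where f: "bij_betw f {0..<card (verts B)} (verts B)" using ex_bij_betw_nat_finite[OF fin(1)] by blast
  obtain g where g: "bij_betw g {0..<card (edges B)} (edges B)" using ex_bij_betw_nat_finite[OF fin(2)] by blast
  let ?n = "card (verts B)" and ?m = "card (edges B)"
  have "\<exists>a b. a < ?n \<and> b < ?n \<and> ends B (g e) = {f a, f b}" if "e < ?m" for e
  proof -
    have "g e \<in> edges B" using g that by (auto simp: bij_betw_def)
    then obtain a b where "a \<in> verts B" "b \<in> verts B" "ends B (g e) = {a, b}" using ends by blast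
    moreover have "\<exists>i<?n. v = f i" if "v \<in> verts B" for v
      using f that unfolding bij_betw_def by force
    ultimately show ?thesis by metis
  qed
  then obtain p q where pq: "\<And>e. e < ?m \<Longrightarrow> p e < ?n \<and> q e < ?n \<and> ends B (g e) = {f (p e), f (q e)}"
    by metis
  obtain \<eta> where \<eta>: "\<And>a. dist (D (\<eta> a)) a < \<epsilon>" using dense by metis
  define c where "c = (?n, map (\<lambda>e. (p e, q e)) [0..<?m], map (\<lambda>v. \<eta> (vmark B (f v))) [0..<?n],
    map (\<lambda>e. map (\<lambda>v. \<eta> (emark B (f v) (g e))) [0..<?n]) [0..<?m])"
  have "net_iso (\<lambda>a b. dist a b < \<epsilon>) f g (decode D c) B"
    unfolding net_iso_def c_def
  proof (intro conjI ballI, goal_cases)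
    case 1 then show ?case using f by (simp add: atLeast0LessThan)
  next
    case 2 then show ?case using g by (simp add: atLeast0LessThan)
  next
    case (3 e) then show ?case using pq by simp
  next
    case (4 v) then show ?case using \<eta> by simp
  next
    case (5 e v)
    then have "e < ?m" "v < ?n" using pq[of e] by auto
    then show ?case using \<eta> by simp
  qed
  moreover have "\<forall>e\<in>edges (decode D c). ends (decode D c) e \<subseteq> verts (decode D c)"
    using pq by (auto simp: c_def)
  ultimately show ?thesis by blast
qed

text \<open>
  For each code, radius and precision choose one rooted network whose ball is close to the coded
  network, if there is any. The ball of a given \<open>x\<close> is close to some coded network, which is then also
  close to the ball of the chosen network.
\<close>

lemma countable_near1_dense:
  "\<exists>S :: 'x::polish_space rooted set. countable S \<and> (\<forall>x r. \<forall>\<epsilon>>0. \<exists>s\<in>S. near1 r \<epsilon> s x)"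
proof -
  obtain K :: "'x set" where K: "countable K" "\<And>U. open U \<Longrightarrow> U \<noteq> {} \<Longrightarrow> \<exists>d\<in>K. d \<in> U"
    by (rule countable_dense_setE) blast
  define D where "D = from_nat_into K"
  have "K \<noteq> {}" using K(2)[of UNIV] by auto
  then have rD: "range D = K" unfolding D_def by (rule range_from_nat_into) (rule K(1))
  have D: "\<exists>i. dist (D i) a < \<epsilon>" if e: "0 < \<epsilon>" for a \<epsilon>
  proof -
    have "ball a \<epsilon> \<noteq> {}" using e by simp
    then obtain d where "d \<in> K" "d \<in> ball a \<epsilon>" using K(2)[OF open_ball] by blast
    then show ?thesis using rD by (auto simp: dist_commute)
  qed
  define Q where "Q = (\<lambda>(c, \<rho>, r, j) x. \<exists>G u f g. network G \<and> u \<in> verts G \<and> x = rcls (G, u) \<and>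
    net_iso (\<lambda>a b. dist a b < 1 / real (Suc j)) f g (decode D c) (net_ball G u r) \<and>
    \<rho> \<in> verts (decode D c) \<and> f \<rho> = u \<and>
    (\<forall>e\<in>edges (decode D c). ends (decode D c) e \<subseteq> verts (decode D c)))"
  define S where "S = range (\<lambda>code. SOME x. Q code x)"
  have "\<exists>s\<in>S. near1 r \<epsilon> s x" if e: "0 < \<epsilon>" for x r \<epsilon>
  proof -
    obtain j where j: "1 / real (Suc j) < \<epsilon> / 2" using e nat_approx_posE[of "\<epsilon> / 2"] by auto
    obtain G u where G: "network G" "u \<in> verts G" "x = rcls (G, u)" by (rule rooted_cases)
    have "\<exists>c f g. net_iso (\<lambda>a b. dist a b < 1 / real (Suc j)) f g (decode D c) (net_ball G u r) \<and>
        (\<forall>e\<in>edges (decode D c). ends (decode D c) e \<subseteq> verts (decode D c))"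
    proof (rule finite_net_approx_code[OF finite_net_ball[OF G(1,2)]])
      fix e assume e: "e \<in> edges (net_ball G u r)"
      then have "e \<in> edges G" by simp
      then obtain a b where "ends G e = {a, b}" using G(1) unfolding network_def by blast
      with e show "\<exists>a\<in>verts (net_ball G u r). \<exists>b\<in>verts (net_ball G u r). ends (net_ball G u r) e = {a, b}"
        by auto
    qed (rule D, simp)
    then obtain c f g where c: "net_iso (\<lambda>a b. dist a b < 1 / real (Suc j)) f g (decode D c) (net_ball G u r)"
      "\<forall>e\<in>edges (decode D c). ends (decode D c) e \<subseteq> verts (decode D c)" by blast
    have "u \<in> f ` verts (decode D c)" using c(1) G(2) unfolding net_iso_def bij_betw_def by auto
    then obtain \<rho> where \<rho>: "\<rho> \<in> verts (decode D c)" "f \<rho> = u" by auto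
    have "Q (c, \<rho>, r, j) x" unfolding Q_def using G c \<rho> by auto
    then have "Q (c, \<rho>, r, j) (SOME x. Q (c, \<rho>, r, j) x)" by (rule someI)
    then obtain G' u' f' g' where s: "network G'" "u' \<in> verts G'"
        "(SOME x. Q (c, \<rho>, r, j) x) = rcls (G', u')"
        "net_iso (\<lambda>a b. dist a b < 1 / real (Suc j)) f' g' (decode D c) (net_ball G' u' r)" "f' \<rho> = u'"
      unfolding Q_def by auto
    obtain h k where h: "net_iso (\<lambda>a b. dist a b < 1 / real (Suc j) + 1 / real (Suc j)) h k
        (net_ball G' u' r) (net_ball G u r)" "h (f' \<rho>) = f \<rho>"
      using net_iso_span[OF s(4) c(1) _ \<rho>(1)] c(2) by blast
    have "net_iso (\<lambda>a b. dist a b < \<epsilon>) h k (net_ball G' u' r) (net_ball G u r)"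
      by (rule net_iso_mono[OF h(1)]) (use j in linarith)
    then have "near1 r \<epsilon> (rcls (G', u')) x"
      using h(2) s \<rho> G by (auto simp: near1_rcls)
    then show ?thesis using s(3) unfolding S_def by (metis rangeI)
  qed
  moreover have "countable S" unfolding S_def by simp
  ultimately show ?thesis by blast
qed

lemma countable_separating_events:
  "\<exists>C :: nat \<Rightarrow> 'x::polish_space rooted set. (\<forall>i. C i \<in> sets borel) \<and>
    (\<forall>x y. (\<forall>i. x \<in> C i \<longleftrightarrow> y \<in> C i) \<longrightarrow> x = y)"
proof -
  obtain S :: "'x rooted set" where S: "countable S" "\<And>x r \<epsilon>. 0 < \<epsilon> \<Longrightarrow> \<exists>s\<in>S. near1 r \<epsilon> s x"
    using countable_near1_dense by blast
  let ?E = "\<lambda>(s, r, j). {y. near1 r (1 / real (Suc j)) s y}"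
  define \<C> where "\<C> = ?E ` (S \<times> UNIV)"
  have "S \<noteq> {}" using S(2)[of 1] by auto
  then have "\<C> \<noteq> {}" unfolding \<C>_def by auto
  moreover have "countable \<C>" unfolding \<C>_def using S(1) by simp
  ultimately have range: "range (from_nat_into \<C>) = \<C>" by (rule range_from_nat_into)
  have "C \<in> sets borel" if "C \<in> \<C>" for C
    using that unfolding \<C>_def by (auto intro!: borel_open open_near1)
  then have "from_nat_into \<C> i \<in> sets borel" for i using range by blast
  moreover have "x = y" if "\<forall>i. x \<in> from_nat_into \<C> i \<longleftrightarrow> y \<in> from_nat_into \<C> i" for x y
  proof (rule near1_all_imp_eq)
    fix r and \<epsilon> :: real assume "0 < \<epsilon>"
    then obtain j where j: "1 / real (Suc j) < \<epsilon> / 2" using nat_approx_posE[of "\<epsilon> / 2"] by auto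
    obtain s where s: "s \<in> S" "near1 r (1 / real (Suc j)) s x" using S(2)[of "1 / real (Suc j)"] by auto
    have "?E (s, r, j) \<in> \<C>" unfolding \<C>_def using s(1) by blast
    then obtain i where "?E (s, r, j) = from_nat_into \<C> i" using range by blast
    then have "near1 r (1 / real (Suc j)) s y" using that s(2) by auto
    with s(2) have "near1 r (1 / real (Suc j) + 1 / real (Suc j)) x y" by (rule near1_span)
    then show "near1 r \<epsilon> x y" by (rule near1_mono) (use j in auto)
  qed
  ultimately show ?thesis by blast
qed

lemma finite_sphere_fibre: "finite {z. root1 z = x \<and> root_dist z = d}"
proof -
  obtain G u where G: "network G" "u \<in> verts G" "x = rcls (G, u)" by (rule rooted_cases)
  have "{z. root1 z = x \<and> root_dist z = d} \<subseteq> (\<lambda>v. bcls (G, u, v)) ` verts (net_ball G u d)"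
    using G birooted_fibre[OF G(1,2)] by (auto simp: root_dist_bcls)
  then show ?thesis by (rule finite_subset) (intro finite_imageI finite_net_ball(1)[OF G(1,2)])
qed

text \<open>
  On the network of \<open>x\<close> there are only finitely many vertices at distance \<open>d\<close> from the root. Hence
  one of them has class \<open>y\<close> as soon as for every \<open>n\<close> some of them belongs to the same sets
  among \<open>C 0, \<dots>, C n\<close> as \<open>y\<close>. For fixed \<open>n\<close> this is a finite union of measurable rectangles, one for each
  pattern of memberships.
\<close>

lemma measurable_same_network:
  "{(x, y). unroot x = unroot y} \<in> sets (borel \<Otimes>\<^sub>M (borel :: 'x::polish_space rooted measure))"
proof -
  obtain C :: "nat \<Rightarrow> 'x rooted set" where C [measurable]: "\<And>i. C i \<in> sets borel"
    and sep: "\<And>x y. (\<And>i. x \<in> C i \<longleftrightarrow> y \<in> C i) \<Longrightarrow> x = y"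
    using countable_separating_events by blast
  define pattern where "pattern n J y \<longleftrightarrow> (\<forall>i\<in>{..n}. y \<in> C i \<longleftrightarrow> i \<in> J)" for n J y
  have [measurable]: "Measurable.pred borel (pattern n J)" for n J
    unfolding pattern_def[abs_def] by measurable
  define E where "E d n = (\<Union>J\<in>Pow {..n}.
    {x. root_sum (indicator {z. root_dist z = d \<and> pattern n J (root2 z)}) x \<noteq> 0} \<times> {y. pattern n J y})" for d n
  have "unroot x = unroot y \<longleftrightarrow> (\<exists>d. \<forall>n. (x, y) \<in> E d n)" for x y
  proof
    assume "unroot x = unroot y"
    then obtain z where z: "root1 z = x" "root2 z = y" using unroot_eq_iff by blast
    have "(x, y) \<in> E (root_dist z) n" for n
      unfolding E_def using z
      by (intro UN_I[of "{i. i \<le> n \<and> y \<in> C i}"]) (auto simp: root_sum_eq_0_iff pattern_def)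
    then show "\<exists>d. \<forall>n. (x, y) \<in> E d n" by blast
  next
    assume "\<exists>d. \<forall>n. (x, y) \<in> E d n"
    then obtain d where d: "\<And>n. (x, y) \<in> E d n" by blast
    have "\<exists>z. root1 z = x \<and> root_dist z = d \<and> (\<forall>i\<in>{..n}. root2 z \<in> C i \<longleftrightarrow> y \<in> C i)" for n
      using d[of n] unfolding E_def by (auto simp: root_sum_eq_0_iff pattern_def indicator_def split: if_splits)
    then obtain Z where "\<forall>n. root1 (Z n) = x \<and> root_dist (Z n) = d \<and>
        (\<forall>i\<in>{..n}. root2 (Z n) \<in> C i \<longleftrightarrow> y \<in> C i)"
      by (rule choice[OF allI, THEN exE])
    then have Z: "\<And>n. root1 (Z n) = x" "\<And>n. root_dist (Z n) = d"
      "\<And>n i. i \<le> n \<Longrightarrow> root2 (Z n) \<in> C i \<longleftrightarrow> y \<in> C i" by simp_all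
    have "finite (range Z)" by (rule finite_subset[OF _ finite_sphere_fibre[of x d]]) (use Z in auto)
    then obtain z where z: "infinite {n. Z n = z}"
      using inf_img_fin_domE[of Z UNIV] by (auto simp: vimage_def)
    have "root2 z \<in> C i \<longleftrightarrow> y \<in> C i" for i
    proof -
      have "\<exists>n\<ge>i. n \<in> {n. Z n = z}" using z unfolding infinite_nat_iff_unbounded_le by blast
      then obtain n where "i \<le> n" "Z n = z" by blast
      then show ?thesis using Z(3)[of i n] by simp
    qed
    then have "root2 z = y" by (rule sep)
    moreover obtain n where "Z n = z" using not_finite_existsD[OF z] by blast
    ultimately show "unroot x = unroot y" using Z(1)[of n] unroot_eq_iff by blast
  qed
  then have "{(x, y). unroot x = unroot y} = (\<Union>d. \<Inter>n. E d n)"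
    by (intro set_eqI) (simp add: split_beta)
  moreover have "E d n \<in> sets (borel \<Otimes>\<^sub>M borel)" for d n
    unfolding E_def by (intro sets.finite_UN pair_measureI) measurable
  ultimately show ?thesis by auto
qed


section \<open>From root-changes to couplings to invariant events\<close>

text \<open>
  The invariant events are precisely the preimages of measurable sets of non-rooted networks.
\<close>

lemma same_nonrooted_law_iff_agree:
  fixes \<mu> \<nu> :: "'x::metric_space rooted measure"
  assumes "sets \<mu> = sets borel" "sets \<nu> = sets borel"
  shows "same_nonrooted_law \<mu> \<nu> \<longleftrightarrow> agree_on_invariant_events \<mu> \<nu>"
proof -
  have sp: "space \<mu> = UNIV" "space \<nu> = UNIV" using assms[THEN sets_eq_imp_space_eq] by auto
  have u: "unroot \<in> \<mu> \<rightarrow>\<^sub>M nonrooted" "unroot \<in> \<nu> \<rightarrow>\<^sub>M nonrooted"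
    using measurable_unroot assms by (auto cong: measurable_cong_sets)
  have em: "emeasure (distr \<rho> nonrooted unroot) B = emeasure \<rho> (unroot -` B)"
    if "\<rho> \<in> {\<mu>, \<nu>}" "B \<in> sets nonrooted" for \<rho> B
    using that u sp by (auto simp: emeasure_distr)
  show ?thesis
  proof
    assume law: "same_nonrooted_law \<mu> \<nu>"
    show "agree_on_invariant_events \<mu> \<nu>"
      unfolding agree_on_invariant_events_def
    proof
      fix A :: "'x rooted set" assume A: "A \<in> invariant_events"
      have "unroot -` unroot ` A = A"
      proof
        show "unroot -` unroot ` A \<subseteq> A"
        proof
          fix x assume "x \<in> unroot -` unroot ` A"
          then obtain y where "y \<in> A" "unroot y = unroot x" by auto
          then show "x \<in> A" using A unfolding unroot_eq_iff invariant_events_iff by blast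
        qed
      qed auto
      moreover from this have "unroot ` A \<in> sets nonrooted"
        using A by (simp add: sets_nonrooted invariant_events_iff)
      ultimately show "emeasure \<mu> A = emeasure \<nu> A"
        using law em[of \<mu> "unroot ` A"] em[of \<nu> "unroot ` A"] unfolding same_nonrooted_law_def by simp
    qed
  next
    assume agree: "agree_on_invariant_events \<mu> \<nu>"
    have "emeasure (distr \<mu> nonrooted unroot) B = emeasure (distr \<nu> nonrooted unroot) B"
      if B: "B \<in> sets nonrooted" for B
    proof -
      have "unroot (root1 z) = unroot (root2 z)" for z using unroot_eq_iff by blast
      then have "unroot -` B \<in> invariant_events"
        using B unfolding invariant_events_iff sets_nonrooted by (metis mem_Collect_eq vimage_eq)
      then show ?thesis using agree em B unfolding agree_on_invariant_events_def by simp
    qed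
    then show "same_nonrooted_law \<mu> \<nu>"
      unfolding same_nonrooted_law_def by (intro measure_eqI) auto
  qed
qed

text \<open>
  Choose the second root with the law that the kernel prescribes.
\<close>

lemma root_change_imp_doubly_rooted_coupling:
  assumes \<mu> [measurable_cong]: "sets \<mu> = sets borel" and "prob_space \<mu>" and "root_change \<mu> \<nu>"
  shows "doubly_rooted_coupling \<mu> \<nu>"
proof -
  interpret prob_space \<mu> by fact
  obtain T :: "'a birooted \<Rightarrow> real" where T [measurable]: "T \<in> borel_measurable borel"
    and sum1: "AE x in \<mu>. root_sum (\<lambda>z. ennreal (T z)) x = 1" and \<nu>: "sets \<nu> = sets borel"
    "\<And>A. A \<in> sets borel \<Longrightarrow>
      emeasure \<nu> A = (\<integral>\<^sup>+ x. root_sum (\<lambda>z. ennreal (T z) * indicator A (root2 z)) x \<partial>\<mu>)"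
    using assms(3) unfolding root_change_def by blast
  define \<gamma> where "\<gamma> = density (vertex_measure \<mu>) (\<lambda>z. ennreal (T z))"
  have em: "emeasure \<gamma> B = (\<integral>\<^sup>+ x. root_sum (\<lambda>z. ennreal (T z) * indicator B z) x \<partial>\<mu>)"
    if [measurable]: "B \<in> sets borel" for B
    unfolding \<gamma>_def by (simp add: emeasure_density nn_integral_vertex_measure[OF \<mu>])
  have sets [simp, measurable_cong]: "sets \<gamma> = sets borel" by (simp add: \<gamma>_def)
  have space [simp]: "space \<gamma> = UNIV" by (simp add: \<gamma>_def)
  have r1: "emeasure \<gamma> (root1 -` A) = emeasure \<mu> A" if A [measurable]: "A \<in> sets borel" for A
  proof -
    have "root1 -` A \<in> sets borel" using measurable_sets[OF measurable_root1 A] by simp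
    then have "emeasure \<gamma> (root1 -` A) =
        (\<integral>\<^sup>+ x. root_sum (\<lambda>z. indicator A (root1 z) * ennreal (T z)) x \<partial>\<mu>)"
      by (simp add: em mult.commute indicator_vimage)
    also have "\<dots> = (\<integral>\<^sup>+ x. indicator A x \<partial>\<mu>)"
      using sum1 by (intro nn_integral_cong_AE) (auto simp: root_sum_mult_root1[of "indicator A"])
    finally show ?thesis using A \<mu> by simp
  qed
  have r2: "emeasure \<gamma> (root2 -` A) = emeasure \<nu> A" if A [measurable]: "A \<in> sets borel" for A
  proof -
    have "root2 -` A \<in> sets borel" using measurable_sets[OF measurable_root2 A] by simp
    then show ?thesis by (simp add: em \<nu>(2) indicator_vimage)
  qed
  have "distr \<gamma> borel root1 = \<mu>"
    by (rule measure_eqI) (auto simp: \<mu> emeasure_distr r1)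
  moreover have "distr \<gamma> borel root2 = \<nu>"
    by (rule measure_eqI) (auto simp: \<nu>(1) emeasure_distr r2)
  moreover have "prob_space \<gamma>"
    using r1[of UNIV] emeasure_space_1 sets_eq_imp_space_eq[OF \<mu>] by (intro prob_spaceI) simp
  ultimately show ?thesis unfolding doubly_rooted_coupling_def using sets by blast
qed

text \<open>
  The two components of the coupling lie in an invariant event simultaneously.
\<close>

lemma same_network_coupling_imp_agree:
  assumes "same_network_coupling \<mu> \<nu>"
  shows "agree_on_invariant_events \<mu> \<nu>"
  unfolding agree_on_invariant_events_def
proof
  fix A :: "'a rooted set" assume A: "A \<in> invariant_events"
  then have [measurable]: "A \<in> sets borel" by (simp add: invariant_events_iff)
  obtain \<gamma> :: "('a rooted \<times> 'a rooted) measure" where [measurable_cong]: "sets \<gamma> = sets (borel \<Otimes>\<^sub>M borel)"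
    and d: "distr \<gamma> borel fst = \<mu>" "distr \<gamma> borel snd = \<nu>"
    and ae: "AE (x, y) in \<gamma>. unroot x = unroot y"
    using assms unfolding same_network_coupling_def by blast
  have inv: "x \<in> A \<longleftrightarrow> y \<in> A" if "unroot x = unroot y" for x y
  proof -
    obtain z where z: "root1 z = x" "root2 z = y" using \<open>unroot x = unroot y\<close> unroot_eq_iff by blast
    moreover have "\<And>z. root1 z \<in> A \<Longrightarrow> root2 z \<in> A" using A by (simp add: invariant_events_iff)
    from this[of z] this[of "flip z"] z show ?thesis by auto
  qed
  have "emeasure \<mu> A = emeasure \<gamma> (fst -` A \<inter> space \<gamma>)"
    unfolding d(1)[symmetric] by (rule emeasure_distr) measurable
  also have "\<dots> = emeasure \<gamma> (snd -` A \<inter> space \<gamma>)"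
  proof (rule emeasure_eq_AE)
    show "AE z in \<gamma>. z \<in> fst -` A \<inter> space \<gamma> \<longleftrightarrow> z \<in> snd -` A \<inter> space \<gamma>"
      using ae by eventually_elim (auto dest: inv)
  qed measurable
  also have "\<dots> = emeasure \<nu> A"
    unfolding d(2)[symmetric] by (rule emeasure_distr[symmetric]) measurable
  finally show "emeasure \<mu> A = emeasure \<nu> A" .
qed

text \<open>
  Bias by the constant weight 1, which does not change \<open>\<mu>\<close>.
\<close>

lemma root_change_imp_biasing_root_change:
  assumes "prob_space \<mu>" "root_change \<mu> \<nu>"
  shows "biasing_root_change \<mu> \<nu>"
proof -
  interpret prob_space \<mu> by fact
  have "(\<integral>\<^sup>+ x. ennreal 1 \<partial>\<mu>) = 1" by (simp add: emeasure_space_1)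
  then have "biasing \<mu> \<mu>"
    unfolding biasing_def by (intro exI[of _ "\<lambda>_. 1"]) (simp add: density_1)
  then show ?thesis using assms(2) unfolding biasing_root_change_def by blast
qed

lemma doubly_rooted_imp_same_network_coupling:
  fixes \<mu> \<nu> :: "'x::polish_space rooted measure"
  assumes "doubly_rooted_coupling \<mu> \<nu>"
  shows "same_network_coupling \<mu> \<nu>"
proof -
  obtain \<gamma> :: "'x birooted measure" where \<gamma>: "prob_space \<gamma>" and [measurable_cong]: "sets \<gamma> = sets borel"
    and d: "distr \<gamma> borel root1 = \<mu>" "distr \<gamma> borel root2 = \<nu>"
    using assms unfolding doubly_rooted_coupling_def by blast
  let ?r = "\<lambda>z. (root1 z, root2 z)"
  let ?\<gamma> = "distr \<gamma> (borel \<Otimes>\<^sub>M borel) ?r"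
  have "prob_space ?\<gamma>" by (rule prob_space.prob_space_distr[OF \<gamma>]) measurable
  moreover have "distr ?\<gamma> borel fst = \<mu>" "distr ?\<gamma> borel snd = \<nu>"
    unfolding d[symmetric] by (subst distr_distr; simp add: comp_def)+
  moreover have "AE (x, y) in ?\<gamma>. unroot x = unroot y"
  proof (subst AE_distr_iff)
    show "{p \<in> space (borel \<Otimes>\<^sub>M borel). case p of (x :: 'x rooted, y) \<Rightarrow> unroot x = unroot y} \<in> sets (borel \<Otimes>\<^sub>M borel)"
    proof -
      have "{p \<in> space (borel \<Otimes>\<^sub>M borel). case p of (x :: 'x rooted, y) \<Rightarrow> unroot x = unroot y}
          = {(x :: 'x rooted, y). unroot x = unroot y}"
        by (auto simp: space_pair_measure)
      then show ?thesis using measurable_same_network by (simp only:)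
    qed
    show "AE z in \<gamma>. case ?r z of (x, y) \<Rightarrow> unroot x = unroot y"
      using unroot_eq_iff by (intro AE_I2) auto
  qed measurable
  ultimately show ?thesis unfolding same_network_coupling_def by (intro exI[of _ ?\<gamma>]) simp
qed

section \<open>Auxiliary densities\<close>

text \<open>
  The reference measure is the sum of the two measures.
\<close>

lemma finite_measures_common_density:
  assumes "finite_measure P" "finite_measure Q" and PQ: "sets Q = sets P"
  obtains M p q where "sets M = sets P" "p \<in> borel_measurable M" "q \<in> borel_measurable M"
    "density M p = P" "density M q = Q" "AE x in M. p x \<noteq> (\<infinity> :: ennreal)" "AE x in M. q x \<noteq> (\<infinity> :: ennreal)"
proof -
  interpret P: finite_measure P by fact
  interpret Q: finite_measure Q by fact
  define M where "M = measure_of (space P) (sets P) (\<lambda>A. emeasure P A + emeasure Q A)"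
  have sets: "sets M = sets P" by (simp add: M_def)
  have em: "emeasure M A = emeasure P A + emeasure Q A" if A: "A \<in> sets P" for A
    unfolding M_def
  proof (rule emeasure_measure_of_sigma)
    show "countably_additive (sets P) (\<lambda>A. emeasure P A + emeasure Q A)"
      by (intro countably_additiveI)
        (simp add: suminf_add[symmetric] suminf_emeasure[of _ P] suminf_emeasure[of _ Q] PQ)
  qed (auto simp: positive_def sets.sigma_algebra_axioms A)
  have space: "space M = space P" "space Q = space P"
    using sets_eq_imp_space_eq sets PQ by blast+
  interpret M: finite_measure M
    by (rule finite_measureI) (use em[of "space P"] space P.emeasure_finite Q.emeasure_finite in auto)
  have ac: "absolutely_continuous M P" "absolutely_continuous M Q"
    unfolding absolutely_continuous_def null_sets_def by (auto simp: sets em PQ)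
  have "AE x in M. RN_deriv M P x \<noteq> \<infinity>"
    by (rule M.RN_deriv_finite) (use P.sigma_finite_measure_axioms ac sets PQ in auto)
  moreover have "AE x in M. RN_deriv M Q x \<noteq> \<infinity>"
    by (rule M.RN_deriv_finite) (use Q.sigma_finite_measure_axioms ac sets PQ in auto)
  ultimately show thesis
    using that[of M "RN_deriv M P" "RN_deriv M Q"] ac sets PQ
    by (auto intro!: M.density_RN_deriv)
qed

text \<open>
  Give each nonempty sphere of radius \<open>d\<close> the total weight \<open>(1 / 2) ^ (d + 1)\<close>, distributed evenly over
  its finitely many vertices. With this weight vertex measures become finite without losing any pair
  of roots.
\<close>

lemma spreading_weight:
  "\<exists>k :: 'x::metric_space birooted \<Rightarrow> ennreal. k \<in> borel_measurable borel \<and>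
    (\<forall>z. 0 < k z) \<and> (\<forall>x. root_sum k x \<le> 1)"
proof -
  let ?S = "\<lambda>d. indicator {z :: 'x birooted. root_dist z = d} :: _ \<Rightarrow> ennreal"
  define w where "w d x = ennreal ((1 / 2) ^ Suc d) / root_sum (?S d) x" for d x
  define c where "c z = w (root_dist z) (root1 z)" for z
  have [measurable]: "w d \<in> borel_measurable borel" for d
    unfolding w_def by measurable
  have [measurable]: "c \<in> borel_measurable borel"
    unfolding c_def by (rule measurable_compose_countable) measurable
  have pos: "0 < c z" for z
  proof -
    have "root_sum (?S (root_dist z)) (root1 z) < \<infinity>"
      using root_sum_sphere_finite[of UNIV "root_dist z" "root1 z"] by simp
    then show ?thesis by (simp add: c_def w_def ennreal_zero_less_divide)
  qed
  have le: "root_sum c x \<le> 1" for x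
  proof -
    have "root_sum c x = root_sum (\<lambda>z. \<Sum>d. w d x * ?S d z) x"
    proof (rule root_sum_cong)
      fix z :: "'x birooted" assume z: "root1 z = x"
      have "(\<Sum>d. w d x * ?S d z) = (\<Sum>d\<in>{root_dist z}. w d x * ?S d z)"
        by (rule suminf_finite) auto
      then show "c z = (\<Sum>d. w d x * ?S d z)" using z by (simp add: c_def)
    qed
    also have "\<dots> = (\<Sum>d. w d x * root_sum (?S d) x)"
      by (simp add: root_sum_suminf root_sum_cmult)
    also have "\<dots> \<le> (\<Sum>d. ennreal ((1 / 2) ^ Suc d))"
    proof (rule suminf_le)
      fix d
      show "w d x * root_sum (?S d) x \<le> ennreal ((1 / 2) ^ Suc d)"
        using root_sum_sphere_finite[of UNIV d x]
        by (cases "root_sum (?S d) x = 0") (auto simp: w_def ennreal_divide_times ennreal_times_divide)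
    qed auto
    also have "\<dots> = ennreal 1"
      using power_half_series by (intro suminf_ennreal_eq) auto
    also have "\<dots> = 1" by simp
    finally show ?thesis .
  qed
  show ?thesis using pos le by (intro exI[of _ c]) simp
qed

section \<open>Greedy transport along networks\<close>

text \<open>
  Division by a density is harmless where it vanishes: then \<open>u = 0\<close>, and \<open>0 / 0 = 0\<close>.
\<close>

lemma ennreal_divide_le_of_le_mult:
  fixes a p u :: ennreal
  assumes "u \<le> a * p"
  shows "u / p \<le> a"
proof (cases "p = 0 \<or> p = \<infinity>")
  case True
  then show ?thesis using assms by (auto simp: divide_ennreal_def)
next
  case False
  then have "u / p \<le> a * p / p" using assms by (intro divide_right_mono_ennreal) auto
  also have "\<dots> = a" using False by (simp add: ennreal_mult_divide_eq less_top[symmetric])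
  finally show ?thesis .
qed

lemma ennreal_divide_times_cancel:
  fixes a p u :: ennreal
  assumes "u \<le> a * p" "p \<noteq> \<infinity>"
  shows "p * (u / p) = u"
  using assms by (cases "p = 0") (auto simp: ennreal_times_divide ennreal_mult_divide_eq mult.commute[of p])

text \<open>
  By the integral formulas, \<open>p\<close> is the density of \<open>\<mu>\<close> spread over the pairs (sender, receiver) by the
  weight \<open>k\<close> around the sender, and \<open>q\<close> is the density of \<open>\<nu>\<close> spread over the same pairs by the weight
  around the receiver, which explains the occurrence of \<open>flip\<close>. Both are relative to the same measure \<open>M\<close>.
\<close>

locale transport =
  fixes \<mu> \<nu> :: "'x::metric_space rooted measure"
    and k p q :: "'x birooted \<Rightarrow> ennreal" and M :: "'x birooted measure"
  assumes prob: "prob_space \<mu>" "prob_space \<nu>"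
    and sets_\<mu> [simp, measurable_cong]: "sets \<mu> = sets borel"
    and sets_\<nu> [simp, measurable_cong]: "sets \<nu> = sets borel"
    and sets_M [simp, measurable_cong]: "sets M = sets borel"
    and k [measurable]: "k \<in> borel_measurable borel" and k_pos: "\<And>z. 0 < k z"
    and k_sum: "\<And>x. root_sum k x \<le> 1"
    and p [measurable]: "p \<in> borel_measurable borel" and p_fin: "AE z in M. p z \<noteq> \<infinity>"
    and q [measurable]: "q \<in> borel_measurable borel" and q_fin: "AE z in M. q z \<noteq> \<infinity>"
    and nn_integral_p: "\<And>h. h \<in> borel_measurable borel \<Longrightarrow>
      (\<integral>\<^sup>+ x. root_sum (\<lambda>z. k z * h z) x \<partial>\<mu>) = (\<integral>\<^sup>+ z. p z * h z \<partial>M)"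
    and nn_integral_q: "\<And>h. h \<in> borel_measurable borel \<Longrightarrow>
      (\<integral>\<^sup>+ y. root_sum (\<lambda>z. k z * h (flip z)) y \<partial>\<nu>) = (\<integral>\<^sup>+ z. q z * h z \<partial>M)"
    and agree: "agree_on_invariant_events \<mu> \<nu>"
begin

text \<open>
  If \<open>\<mu>\<close> and \<open>\<nu>\<close> are reduced to the densities \<open>a\<close> and \<open>b\<close>, this is the density of the largest measure
  below both spread measures: what is moved in one round.
\<close>

definition joint :: "('x rooted \<Rightarrow> ennreal) \<Rightarrow> ('x rooted \<Rightarrow> ennreal) \<Rightarrow> 'x birooted \<Rightarrow> ennreal" where
  "joint a b z = min (a (root1 z) * p z) (b (root2 z) * q z)"

text \<open>
  The moved mass relative to the vertex measure of \<open>\<mu>\<close>, that is, the part of a kernel that moves it.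
\<close>

definition forward :: "('x rooted \<Rightarrow> ennreal) \<Rightarrow> ('x rooted \<Rightarrow> ennreal) \<Rightarrow> 'x birooted \<Rightarrow> ennreal" where
  "forward a b z = k z * (joint a b z / p z)"

text \<open>
  The moved mass relative to the vertex measure of \<open>\<nu>\<close>. The first root is the receiver here.
\<close>

definition backward :: "('x rooted \<Rightarrow> ennreal) \<Rightarrow> ('x rooted \<Rightarrow> ennreal) \<Rightarrow> 'x birooted \<Rightarrow> ennreal" where
  "backward a b z = k z * (joint a b (flip z) / q (flip z))"

text \<open>
  The densities, relative to \<open>\<mu>\<close> and \<open>\<nu>\<close>, of the mass and of the demand that are left after \<open>n\<close> rounds.
\<close>

fun rest :: "nat \<Rightarrow> ('x rooted \<Rightarrow> ennreal) \<times> ('x rooted \<Rightarrow> ennreal)" where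
  "rest 0 = (\<lambda>x. 1, \<lambda>y. 1)"
| "rest (Suc n) = (let (a, b) = rest n in
    (\<lambda>x. a x - root_sum (forward a b) x, \<lambda>y. b y - root_sum (backward a b) y))"

definition stock where "stock n = fst (rest n)"
definition demand where "demand n = snd (rest n)"

abbreviation "moved n \<equiv> joint (stock n) (demand n)"
abbreviation "sent n \<equiv> forward (stock n) (demand n)"
abbreviation "received n \<equiv> backward (stock n) (demand n)"

lemma stock_0 [simp]: "stock 0 x = 1" and demand_0 [simp]: "demand 0 x = 1"
  by (simp_all add: stock_def demand_def)

lemma stock_Suc: "stock (Suc n) x = stock n x - root_sum (sent n) x"
  and demand_Suc: "demand (Suc n) x = demand n x - root_sum (received n) x"
  by (simp_all add: stock_def demand_def split_beta)

lemma measurable_joint [measurable]: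
  assumes [measurable]: "a \<in> borel_measurable borel" "b \<in> borel_measurable borel"
  shows "joint a b \<in> borel_measurable borel"
  unfolding joint_def[abs_def] by measurable

lemma measurable_forward [measurable]:
  assumes [measurable]: "a \<in> borel_measurable borel" "b \<in> borel_measurable borel"
  shows "forward a b \<in> borel_measurable borel"
  unfolding forward_def[abs_def] by measurable

lemma measurable_backward [measurable]:
  assumes [measurable]: "a \<in> borel_measurable borel" "b \<in> borel_measurable borel"
  shows "backward a b \<in> borel_measurable borel"
  unfolding backward_def[abs_def] by measurable

lemma measurable_stock_demand:
  "stock n \<in> borel_measurable borel \<and> demand n \<in> borel_measurable borel"
proof (induction n)
  case 0
  have "stock 0 = (\<lambda>x. 1)" "demand 0 = (\<lambda>x. 1)" by (simp_all add: fun_eq_iff)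
  then show ?case by simp
next
  case (Suc n)
  then have [measurable]: "stock n \<in> borel_measurable borel" "demand n \<in> borel_measurable borel"
    by simp_all
  have "stock (Suc n) = (\<lambda>x. stock n x - root_sum (sent n) x)"
    "demand (Suc n) = (\<lambda>x. demand n x - root_sum (received n) x)"
    by (simp_all add: fun_eq_iff stock_Suc demand_Suc)
  then show ?case by simp
qed

lemma measurable_stock [measurable]: "stock n \<in> borel_measurable borel"
  and measurable_demand [measurable]: "demand n \<in> borel_measurable borel"
  using measurable_stock_demand by simp_all

text \<open>
  As the weight around a vertex sums to at most 1, its mass suffices for all that is sent.
\<close>

lemma root_sum_forward_le: "root_sum (forward a b) x \<le> a x"
proof -
  have "root_sum (forward a b) x \<le> root_sum (\<lambda>z. a (root1 z) * k z) x"
  proof (rule root_sum_mono)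
    fix z
    have "joint a b z / p z \<le> a (root1 z)"
      by (rule ennreal_divide_le_of_le_mult) (simp add: joint_def)
    then show "forward a b z \<le> a (root1 z) * k z"
      unfolding forward_def by (metis mult.commute mult_left_mono zero_le)
  qed
  also have "\<dots> = a x * root_sum k x" by (rule root_sum_mult_root1)
  also have "\<dots> \<le> a x * 1" by (intro mult_left_mono k_sum) simp
  finally show ?thesis by simp
qed

lemma root_sum_backward_le: "root_sum (backward a b) y \<le> b y"
proof -
  have "root_sum (backward a b) y \<le> root_sum (\<lambda>z. b (root1 z) * k z) y"
  proof (rule root_sum_mono)
    fix z
    have "joint a b (flip z) / q (flip z) \<le> b (root1 z)"
      by (rule ennreal_divide_le_of_le_mult) (simp add: joint_def)
    then show "backward a b z \<le> b (root1 z) * k z"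
      unfolding backward_def by (metis mult.commute mult_left_mono zero_le)
  qed
  also have "\<dots> = b y * root_sum k y" by (rule root_sum_mult_root1)
  also have "\<dots> \<le> b y * 1" by (intro mult_left_mono k_sum) simp
  finally show ?thesis by simp
qed

definition kernel :: "'x birooted \<Rightarrow> ennreal" where "kernel z = (\<Sum>n. sent n z)"
definition unsent :: "'x rooted \<Rightarrow> ennreal" where "unsent x = (INF n. stock n x)"
definition unmet :: "'x rooted \<Rightarrow> ennreal" where "unmet y = (INF n. demand n y)"
definition met :: "'x rooted \<Rightarrow> ennreal" where "met y = (\<Sum>n. root_sum (received n) y)"

lemma measurable_kernel [measurable]: "kernel \<in> borel_measurable borel"
  unfolding kernel_def[abs_def] by measurable

lemma measurable_unsent [measurable]: "unsent \<in> borel_measurable borel"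
  unfolding unsent_def[abs_def] by measurable

lemma measurable_unmet [measurable]: "unmet \<in> borel_measurable borel"
  unfolding unmet_def[abs_def] by measurable

lemma measurable_met [measurable]: "met \<in> borel_measurable borel"
  unfolding met_def[abs_def] by measurable

text \<open>
  The steps of a decreasing sequence telescope. In \<open>ennreal\<close> the truncated difference is a true one
  because no step exceeds what is left.
\<close>

lemma suminf_steps_add_INF:
  fixes r s :: "nat \<Rightarrow> ennreal"
  assumes "r 0 = 1" "\<And>n. r (Suc n) = r n - s n" "\<And>n. s n \<le> r n"
  shows "(\<Sum>n. s n) + (INF n. r n) = 1"
proof -
  have r1: "r n \<le> 1" for n
  proof (induction n)
    case (Suc n)
    have "r n - s n \<le> r n" by (rule diff_le_self_ennreal)
    then show ?case using Suc assms(2) by (metis order_trans)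
  qed (simp add: assms)
  have step: "r (Suc n) + s n = r n" for n
    unfolding assms(2) by (rule diff_add_cancel_ennreal[OF assms(3)])
  have part: "(\<Sum>i<n. s i) + r n = 1" for n
  proof (induction n)
    case (Suc n)
    have "(\<Sum>i<Suc n. s i) + r (Suc n) = (\<Sum>i<n. s i) + (r (Suc n) + s n)" by (simp add: ac_simps)
    then show ?case using Suc step by simp
  qed (simp add: assms)
  have "decseq r"
    using assms(2) by (intro decseq_SucI) (simp add: diff_le_self_ennreal)
  then have "r \<longlonglongrightarrow> (INF n. r n)" by (rule LIMSEQ_INF)
  moreover have "(\<lambda>n. \<Sum>i<n. s i) \<longlonglongrightarrow> (\<Sum>n. s n)" by (rule summable_LIMSEQ) simp
  ultimately have "(\<lambda>n. (\<Sum>i<n. s i) + r n) \<longlonglongrightarrow> (\<Sum>n. s n) + (INF n. r n)" by (intro tendsto_add)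
  then show ?thesis unfolding part by (simp add: LIMSEQ_const_iff)
qed

lemma kernel_add_unsent: "root_sum kernel x + unsent x = 1"
proof -
  have "root_sum kernel x = (\<Sum>n. root_sum (sent n) x)"
    unfolding kernel_def[abs_def] by (rule root_sum_suminf)
  then show ?thesis
    unfolding unsent_def
    using suminf_steps_add_INF[of "\<lambda>n. stock n x" "\<lambda>n. root_sum (sent n) x"]
    by (simp add: stock_Suc root_sum_forward_le)
qed

lemma met_add_unmet: "met y + unmet y = 1"
  unfolding met_def unmet_def
  by (rule suminf_steps_add_INF) (simp_all add: demand_Suc root_sum_backward_le)

lemma nn_integral_sent:
  assumes [measurable]: "h \<in> borel_measurable borel"
  shows "(\<integral>\<^sup>+ x. root_sum (\<lambda>z. sent n z * h z) x \<partial>\<mu>) = (\<integral>\<^sup>+ z. moved n z * h z \<partial>M)"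
proof -
  have "(\<integral>\<^sup>+ x. root_sum (\<lambda>z. sent n z * h z) x \<partial>\<mu>) =
      (\<integral>\<^sup>+ x. root_sum (\<lambda>z. k z * (moved n z / p z * h z)) x \<partial>\<mu>)"
    by (simp add: forward_def mult.assoc)
  also have "\<dots> = (\<integral>\<^sup>+ z. p z * (moved n z / p z * h z) \<partial>M)"
    by (rule nn_integral_p) measurable
  also have "\<dots> = (\<integral>\<^sup>+ z. moved n z * h z \<partial>M)"
  proof (rule nn_integral_cong_AE)
    show "AE z in M. p z * (moved n z / p z * h z) = moved n z * h z"
      using p_fin
    proof eventually_elim
      case (elim z)
      have "p z * (moved n z / p z) = moved n z"
        by (rule ennreal_divide_times_cancel[of _ "stock n (root1 z)"]) (use elim in \<open>auto simp: joint_def\<close>)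
      then show ?case by (simp add: mult.assoc[symmetric])
    qed
  qed
  finally show ?thesis .
qed

lemma nn_integral_received:
  assumes [measurable]: "h \<in> borel_measurable borel"
  shows "(\<integral>\<^sup>+ y. root_sum (\<lambda>z. received n z * h (flip z)) y \<partial>\<nu>) = (\<integral>\<^sup>+ z. moved n z * h z \<partial>M)"
proof -
  have "(\<integral>\<^sup>+ y. root_sum (\<lambda>z. received n z * h (flip z)) y \<partial>\<nu>) =
      (\<integral>\<^sup>+ y. root_sum (\<lambda>z. k z * ((\<lambda>w. moved n w / q w * h w) (flip z))) y \<partial>\<nu>)"
    by (simp add: backward_def mult.assoc)
  also have "\<dots> = (\<integral>\<^sup>+ z. q z * (moved n z / q z * h z) \<partial>M)"
    by (rule nn_integral_q) measurable
  also have "\<dots> = (\<integral>\<^sup>+ z. moved n z * h z \<partial>M)"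
  proof (rule nn_integral_cong_AE)
    show "AE z in M. q z * (moved n z / q z * h z) = moved n z * h z"
      using q_fin
    proof eventually_elim
      case (elim z)
      have "q z * (moved n z / q z) = moved n z"
        by (rule ennreal_divide_times_cancel[of _ "demand n (root2 z)"]) (use elim in \<open>auto simp: joint_def\<close>)
      then show ?case by (simp add: mult.assoc[symmetric])
    qed
  qed
  finally show ?thesis .
qed

text \<open>
  What is sent in a round is what is received, so summing over the rounds shows that the kernel carries \<open>\<mu>\<close>
  to the part \<open>met\<close> of \<open>\<nu>\<close>.
\<close>

lemma nn_integral_kernel:
  assumes [measurable]: "f \<in> borel_measurable borel"
  shows "(\<integral>\<^sup>+ x. root_sum (\<lambda>z. kernel z * f (root2 z)) x \<partial>\<mu>) = (\<integral>\<^sup>+ y. f y * met y \<partial>\<nu>)"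
proof -
  have "(\<integral>\<^sup>+ x. root_sum (\<lambda>z. kernel z * f (root2 z)) x \<partial>\<mu>) =
      (\<integral>\<^sup>+ x. (\<Sum>n. root_sum (\<lambda>z. sent n z * f (root2 z)) x) \<partial>\<mu>)"
    by (simp add: kernel_def root_sum_suminf[symmetric])
  also have "\<dots> = (\<Sum>n. \<integral>\<^sup>+ x. root_sum (\<lambda>z. sent n z * f (root2 z)) x \<partial>\<mu>)"
    by (rule nn_integral_suminf) measurable
  also have "\<dots> = (\<Sum>n. \<integral>\<^sup>+ y. root_sum (\<lambda>z. received n z * f (root2 (flip z))) y \<partial>\<nu>)"
    by (simp only: nn_integral_sent[of "\<lambda>z. f (root2 z)"] nn_integral_received[of "\<lambda>z. f (root2 z)"]
        measurable_compose[OF measurable_root2 assms])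
  also have "\<dots> = (\<Sum>n. \<integral>\<^sup>+ y. f y * root_sum (received n) y \<partial>\<nu>)"
    by (simp add: root_sum_mult_root1[symmetric] mult.commute)
  also have "\<dots> = (\<integral>\<^sup>+ y. (\<Sum>n. f y * root_sum (received n) y) \<partial>\<nu>)"
    by (rule nn_integral_suminf[symmetric]) measurable
  also have "\<dots> = (\<integral>\<^sup>+ y. f y * met y \<partial>\<nu>)" by (simp add: met_def)
  finally show ?thesis .
qed

text \<open>
  Each round moves at least the mass that could be moved between the limits, and all rounds
  together move at most 1.
\<close>

lemma joint_limit_null: "AE z in M. joint unsent unmet z = 0"
proof -
  have "(\<Sum>n. \<integral>\<^sup>+ z. moved n z \<partial>M) = (\<Sum>n. \<integral>\<^sup>+ x. root_sum (sent n) x \<partial>\<mu>)"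
    using nn_integral_sent[of "\<lambda>_. 1"] by simp
  also have "\<dots> = (\<integral>\<^sup>+ x. root_sum kernel x \<partial>\<mu>)"
    unfolding kernel_def[abs_def] root_sum_suminf by (rule nn_integral_suminf[symmetric]) measurable
  also have "\<dots> \<le> (\<integral>\<^sup>+ x. 1 \<partial>\<mu>)"
    by (intro nn_integral_mono) (metis kernel_add_unsent le_iff_add)
  also have "\<dots> = 1" using prob_space.emeasure_space_1[OF prob(1)] by simp
  finally have le: "(\<Sum>n. \<integral>\<^sup>+ z. moved n z \<partial>M) \<le> 1" .
  have "joint unsent unmet z \<le> moved n z" for n z
    unfolding joint_def unsent_def unmet_def
    by (intro min.mono mult_right_mono INF_lower) auto
  then have "(\<Sum>n::nat. \<integral>\<^sup>+ z. joint unsent unmet z \<partial>M) \<le> (\<Sum>n. \<integral>\<^sup>+ z. moved n z \<partial>M)"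
    by (intro suminf_le nn_integral_mono) auto
  with le have "(\<Sum>n::nat. \<integral>\<^sup>+ z. joint unsent unmet z \<partial>M) \<le> 1" by simp
  moreover have "(\<Sum>n::nat. c) = \<infinity>" if "c \<noteq> 0" for c :: ennreal
  proof -
    have "(\<Sum>n::nat. c) = (\<integral>\<^sup>+ n. c \<partial>count_space (UNIV :: nat set))"
      by (rule nn_integral_count_space_nat[symmetric])
    then show ?thesis using that by (simp add: ennreal_mult_top)
  qed
  ultimately have "(\<integral>\<^sup>+ z. joint unsent unmet z \<partial>M) = 0"
    by (metis infinity_ennreal_def ennreal_one_neq_top top.extremum_uniqueI)
  then show ?thesis by (subst (asm) nn_integral_0_iff_AE) auto
qed

text \<open>
  Moving mass within networks takes equal amounts from \<open>\<mu>\<close> and \<open>\<nu>\<close> on each invariant event, and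
  initially these were equal.
\<close>

lemma balance:
  assumes C: "C \<in> invariant_events"
  shows "(\<integral>\<^sup>+ x. indicator C x * unsent x \<partial>\<mu>) = (\<integral>\<^sup>+ y. indicator C y * unmet y \<partial>\<nu>)"
proof -
  have [measurable]: "C \<in> sets borel" using C by (simp add: invariant_events_iff)
  have inv: "root2 z \<in> C \<longleftrightarrow> root1 z \<in> C" for z
  proof -
    have "\<And>z. root1 z \<in> C \<Longrightarrow> root2 z \<in> C" using C by (simp add: invariant_events_iff)
    from this[of z] this[of "flip z"] show ?thesis by auto
  qed
  have "(\<integral>\<^sup>+ y. indicator C y * met y \<partial>\<nu>) =
      (\<integral>\<^sup>+ x. root_sum (\<lambda>z. kernel z * indicator C (root2 z)) x \<partial>\<mu>)"
    by (rule nn_integral_kernel[symmetric]) measurable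
  also have "\<dots> = (\<integral>\<^sup>+ x. root_sum (\<lambda>z. indicator C (root1 z) * kernel z) x \<partial>\<mu>)"
    by (simp add: mult.commute inv indicator_def)
  also have "\<dots> = (\<integral>\<^sup>+ x. indicator C x * root_sum kernel x \<partial>\<mu>)"
    by (simp only: root_sum_mult_root1[of "indicator C"])
  finally have moved: "(\<integral>\<^sup>+ y. indicator C y * met y \<partial>\<nu>) = (\<integral>\<^sup>+ x. indicator C x * root_sum kernel x \<partial>\<mu>)" .
  have "(\<integral>\<^sup>+ x. indicator C x * root_sum kernel x \<partial>\<mu>) + (\<integral>\<^sup>+ x. indicator C x * unsent x \<partial>\<mu>) =
      (\<integral>\<^sup>+ x. indicator C x * root_sum kernel x + indicator C x * unsent x \<partial>\<mu>)"
    by (rule nn_integral_add[symmetric]) measurable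
  also have "\<dots> = emeasure \<mu> C"
    by (simp add: distrib_left[symmetric] kernel_add_unsent)
  also have "\<dots> = emeasure \<nu> C" using agree C unfolding agree_on_invariant_events_def by blast
  also have "\<dots> = (\<integral>\<^sup>+ y. indicator C y * met y + indicator C y * unmet y \<partial>\<nu>)"
    by (simp add: distrib_left[symmetric] met_add_unmet)
  also have "\<dots> = (\<integral>\<^sup>+ y. indicator C y * met y \<partial>\<nu>) + (\<integral>\<^sup>+ y. indicator C y * unmet y \<partial>\<nu>)"
    by (rule nn_integral_add) measurable
  finally have eq: "(\<integral>\<^sup>+ y. indicator C y * met y \<partial>\<nu>) + (\<integral>\<^sup>+ x. indicator C x * unsent x \<partial>\<mu>) =
      (\<integral>\<^sup>+ y. indicator C y * met y \<partial>\<nu>) + (\<integral>\<^sup>+ y. indicator C y * unmet y \<partial>\<nu>)"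
    unfolding moved .
  \<comment> \<open>Cancellation needs a finite summand.\<close>
  have "(\<integral>\<^sup>+ y. indicator C y * met y \<partial>\<nu>) \<le> (\<integral>\<^sup>+ y. 1 \<partial>\<nu>)"
  proof (rule nn_integral_mono)
    fix y
    have "met y \<le> 1" by (metis met_add_unmet le_iff_add)
    then show "indicator C y * met y \<le> 1" by (auto simp: indicator_def)
  qed
  also have "\<dots> = 1" using prob_space.emeasure_space_1[OF prob(2)] by simp
  finally have "(\<integral>\<^sup>+ y. indicator C y * met y \<partial>\<nu>) \<noteq> \<infinity>" by (auto simp: top_unique)
  with eq show ?thesis by (simp add: ennreal_add_left_cancel)
qed

text \<open>
  As \<open>joint_limit_null\<close> leaves no pair with both unsent mass and unmet demand, the set \<open>B\<close> of pairs with
  unsent mass separates the two. All pairs that start at a vertex with unsent mass lie in \<open>B\<close>, and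
  no pair that ends at a vertex with unmet demand does, because the weight is positive. Such vertices never
  share a network, so the networks that carry unsent mass form an invariant event without unmet demand,
  and \<open>balance\<close> applies.
\<close>

lemma unsent_null: "AE x in \<mu>. unsent x = 0" and unmet_null: "AE y in \<nu>. unmet y = 0"
proof -
  define B where "B = {z. unsent (root1 z) * p z \<noteq> 0}"
  have [measurable]: "B \<in> sets borel" unfolding B_def by measurable
  have "(\<integral>\<^sup>+ x. root_sum (\<lambda>z. k z * (indicator (- B) z * unsent (root1 z))) x \<partial>\<mu>) =
      (\<integral>\<^sup>+ z. p z * (indicator (- B) z * unsent (root1 z)) \<partial>M)"
    by (rule nn_integral_p) measurable
  also have "\<dots> = (\<integral>\<^sup>+ z. 0 \<partial>M)"
    by (intro nn_integral_cong) (auto simp: B_def indicator_def)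
  also have "\<dots> = 0" by simp
  finally have "AE x in \<mu>. root_sum (\<lambda>z. k z * (indicator (- B) z * unsent (root1 z))) x = 0"
    by (subst (asm) nn_integral_0_iff_AE) auto
  then have 1: "AE x in \<mu>. unsent x = 0 \<or> (\<forall>z. root1 z = x \<longrightarrow> z \<in> B)"
  proof eventually_elim
    case (elim x)
    then have "k z * (indicator (- B) z * unsent (root1 z)) = 0" if "root1 z = x" for z
      using that by (simp add: root_sum_eq_0_iff)
    then have "indicator (- B) z * unsent x = 0" if "root1 z = x" for z
      using that k_pos[of z] by fastforce
    then show ?case by (auto simp: indicator_def split: if_splits)
  qed
  have "(\<integral>\<^sup>+ y. root_sum (\<lambda>z. k z * (\<lambda>w. indicator B w * unmet (root2 w)) (flip z)) y \<partial>\<nu>) =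
      (\<integral>\<^sup>+ z. q z * (indicator B z * unmet (root2 z)) \<partial>M)"
    by (rule nn_integral_q) measurable
  also have "\<dots> = (\<integral>\<^sup>+ z. 0 \<partial>M)"
  proof (rule nn_integral_cong_AE)
    show "AE z in M. q z * (indicator B z * unmet (root2 z)) = 0"
      using joint_limit_null
      by eventually_elim (auto simp: B_def indicator_def joint_def min_def split: if_splits)
  qed
  also have "\<dots> = 0" by simp
  finally have "AE y in \<nu>. root_sum (\<lambda>z. k z * (indicator B (flip z) * unmet (root1 z))) y = 0"
    by (subst (asm) nn_integral_0_iff_AE) auto
  then have 2: "AE y in \<nu>. unmet y = 0 \<or> (\<forall>z. root2 z = y \<longrightarrow> z \<notin> B)"
  proof eventually_elim
    case (elim y)
    then have "k z * (indicator B (flip z) * unmet (root1 z)) = 0" if "root1 z = y" for z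
      using that by (simp add: root_sum_eq_0_iff)
    from this[of "flip z" for z] have "indicator B z * unmet y = 0" if "root2 z = y" for z
      using that k_pos[of "flip z"] by fastforce
    then show ?case by (auto simp: indicator_def split: if_splits)
  qed
  \<comment> \<open>\<open>C\<close> is the invariant hull of \<open>N\<close>; it is measurable because it is given by a sum over the vertices.\<close>
  define N where "N = {x. unsent x \<noteq> 0 \<and> root_sum (indicator (- B)) x = 0}"
  define C where "C = {x. root_sum (\<lambda>z. indicator N (root2 z)) x \<noteq> 0}"
  have [measurable]: "N \<in> sets borel" unfolding N_def by measurable
  have N: "x \<in> N \<longleftrightarrow> unsent x \<noteq> 0 \<and> (\<forall>z. root1 z = x \<longrightarrow> z \<in> B)" for x
    unfolding N_def by (auto simp: root_sum_eq_0_iff indicator_def)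
  have C: "x \<in> C \<longleftrightarrow> (\<exists>y\<in>N. unroot x = unroot y)" for x
    unfolding C_def unroot_eq_iff by (auto simp: root_sum_eq_0_iff indicator_def)
  have unroot: "unroot (root2 z) = unroot (root1 z)" for z using unroot_eq_iff by metis
  have "root2 z \<in> C" if "root1 z \<in> C" for z using that unfolding C unroot .
  moreover have "C \<in> sets borel" unfolding C_def by measurable
  ultimately have inv: "C \<in> invariant_events"
    unfolding invariant_events_iff by blast
  have "(\<integral>\<^sup>+ y. indicator C y * unmet y \<partial>\<nu>) = (\<integral>\<^sup>+ y. 0 \<partial>\<nu>)"
  proof (rule nn_integral_cong_AE)
    show "AE y in \<nu>. indicator C y * unmet y = 0"
      using 2
    proof eventually_elim
      case (elim y)
      have "unmet y = 0" if y: "y \<in> C"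
      proof -
        obtain x where x: "x \<in> N" "unroot x = unroot y" using y[unfolded C] by force
        obtain z where "root1 z = x" "root2 z = y" using x(2)[unfolded unroot_eq_iff] by blast
        with x(1) show ?thesis using elim N by blast
      qed
      then show ?case by (auto simp: indicator_def)
    qed
  qed
  then have "(\<integral>\<^sup>+ x. indicator C x * unsent x \<partial>\<mu>) = 0" using balance[OF inv] by simp
  then have "AE x in \<mu>. indicator C x * unsent x = 0"
    using inv by (subst (asm) nn_integral_0_iff_AE) (auto simp: invariant_events_iff)
  with 1 show *: "AE x in \<mu>. unsent x = 0"
  proof eventually_elim
    case (elim x)
    then have "unsent x \<noteq> 0 \<Longrightarrow> x \<in> C" using N C by blast
    then show ?case using elim by (auto simp: indicator_def)
  qed
  have "(\<integral>\<^sup>+ x. unsent x \<partial>\<mu>) = (\<integral>\<^sup>+ x. 0 \<partial>\<mu>)" using * by (intro nn_integral_cong_AE)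
  then have "(\<integral>\<^sup>+ y. unmet y \<partial>\<nu>) = 0"
    using balance[of UNIV] by (simp add: invariant_events_iff)
  then show "AE y in \<nu>. unmet y = 0" by (subst (asm) nn_integral_0_iff_AE) auto
qed

lemma root_change_by_kernel: "root_change \<mu> \<nu>"
  unfolding root_change_def
proof (intro conjI exI[of _ "\<lambda>z. enn2real (kernel z)"] ballI allI)
  \<comment> \<open>Being bounded by 1, the kernel can be taken real-valued.\<close>
  have "kernel z \<le> 1" for z
    using le_root_sum[of kernel z] kernel_add_unsent[of "root1 z"] by (metis le_iff_add order_trans)
  then have "kernel z < top" for z using ennreal_one_less_top by (metis order_le_less_trans)
  then have e: "ennreal (enn2real (kernel z)) = kernel z" for z by simp
  show "AE x in \<mu>. root_sum (\<lambda>z. ennreal (enn2real (kernel z))) x = 1"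
    unfolding e using unsent_null by eventually_elim (use kernel_add_unsent in \<open>metis add.right_neutral\<close>)
  fix A :: "'x rooted set" assume A [measurable]: "A \<in> sets borel"
  have "(\<integral>\<^sup>+ x. root_sum (\<lambda>z. kernel z * indicator A (root2 z)) x \<partial>\<mu>) = (\<integral>\<^sup>+ y. indicator A y * met y \<partial>\<nu>)"
    by (rule nn_integral_kernel) measurable
  also have "\<dots> = (\<integral>\<^sup>+ y. indicator A y \<partial>\<nu>)"
  proof (rule nn_integral_cong_AE)
    show "AE y in \<nu>. indicator A y * met y = indicator A y"
      using unmet_null by eventually_elim (metis add.right_neutral met_add_unmet mult.right_neutral)
  qed
  finally show "emeasure \<nu> A =
      (\<integral>\<^sup>+ x. root_sum (\<lambda>z. ennreal (enn2real (kernel z)) * indicator A (root2 z)) x \<partial>\<mu>)"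
    unfolding e using A by simp
qed auto

end

text \<open>
  Spread \<open>\<mu>\<close> around the sender and \<open>\<nu>\<close> around the receiver with the same weight. Both measures on the pairs
  are finite and so have densities relative to their sum.
\<close>

lemma agree_imp_root_change:
  fixes \<mu> \<nu> :: "'x::metric_space rooted measure"
  assumes prob: "prob_space \<mu>" "prob_space \<nu>"
    and sets [simp, measurable_cong]: "sets \<mu> = sets borel" "sets \<nu> = sets borel"
    and agree: "agree_on_invariant_events \<mu> \<nu>"
  shows "root_change \<mu> \<nu>"
proof -
  obtain k :: "'x birooted \<Rightarrow> ennreal" where k [measurable]: "k \<in> borel_measurable borel"
    and k_props: "\<And>z. 0 < k z" "\<And>x. root_sum k x \<le> 1"
    using spreading_weight by blast
  have fin: "finite_measure (density (vertex_measure \<rho>) k)"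
    if "prob_space \<rho>" and [simp]: "sets \<rho> = sets borel" for \<rho> :: "'x rooted measure"
  proof
    interpret prob_space \<rho> by fact
    have "emeasure (density (vertex_measure \<rho>) k) UNIV = (\<integral>\<^sup>+ x. root_sum k x \<partial>\<rho>)"
      by (simp add: emeasure_density nn_integral_vertex_measure)
    also have "\<dots> \<le> (\<integral>\<^sup>+ x. 1 \<partial>\<rho>)" by (intro nn_integral_mono k_props)
    also have "\<dots> = 1" by (simp add: emeasure_space_1)
    finally show "emeasure (density (vertex_measure \<rho>) k) (space (density (vertex_measure \<rho>) k)) \<noteq> \<infinity>"
      using ennreal_one_less_top by (auto simp: top_unique)
  qed
  define P where "P = density (vertex_measure \<mu>) k"
  define Q where "Q = distr (density (vertex_measure \<nu>) k) borel flip"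
  have P: "(\<integral>\<^sup>+ x. root_sum (\<lambda>z. k z * h z) x \<partial>\<mu>) = (\<integral>\<^sup>+ z. h z \<partial>P)"
    if [measurable]: "h \<in> borel_measurable borel" for h
    unfolding P_def by (simp add: nn_integral_density nn_integral_vertex_measure)
  have Q: "(\<integral>\<^sup>+ y. root_sum (\<lambda>z. k z * h (flip z)) y \<partial>\<nu>) = (\<integral>\<^sup>+ z. h z \<partial>Q)"
    if [measurable]: "h \<in> borel_measurable borel" for h
    unfolding Q_def by (simp add: nn_integral_distr nn_integral_density nn_integral_vertex_measure)
  have fP: "finite_measure P" unfolding P_def by (rule fin) (use prob in simp_all)
  have fQ: "finite_measure Q"
    unfolding Q_def by (rule finite_measure.finite_measure_distr[OF fin]) (use prob in simp_all)
  have sPQ: "sets P = sets borel" "sets Q = sets P" by (simp_all add: P_def Q_def)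
  obtain M p q where M: "sets M = sets P" and p: "p \<in> borel_measurable M" and q: "q \<in> borel_measurable M"
    and dens: "density M p = P" "density M q = Q"
    and fin': "AE z in M. p z \<noteq> \<infinity>" "AE z in M. q z \<noteq> \<infinity>"
    by (rule finite_measures_common_density[OF fP fQ sPQ(2)])
  have M' [simp, measurable_cong]: "sets M = sets borel" using M sPQ by simp
  have pq [measurable]: "p \<in> borel_measurable borel" "q \<in> borel_measurable borel"
    using p q by (simp_all cong: measurable_cong_sets)
  have "transport \<mu> \<nu> k p q M"
  proof (rule transport.intro)
    fix h :: "'x birooted \<Rightarrow> ennreal" assume h [measurable]: "h \<in> borel_measurable borel"
    show "(\<integral>\<^sup>+ x. root_sum (\<lambda>z. k z * h z) x \<partial>\<mu>) = (\<integral>\<^sup>+ z. p z * h z \<partial>M)"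
      unfolding P[OF h] dens(1)[symmetric] by (rule nn_integral_density) measurable
    show "(\<integral>\<^sup>+ y. root_sum (\<lambda>z. k z * h (flip z)) y \<partial>\<nu>) = (\<integral>\<^sup>+ z. q z * h z \<partial>M)"
      unfolding Q[OF h] dens(2)[symmetric] by (rule nn_integral_density) measurable
  qed (fact prob sets k k_props pq fin' agree M')+
  then show ?thesis by (rule transport.root_change_by_kernel)
qed

section \<open>Equivalence of the conditions\<close>

theorem theorem2:
  fixes M1 :: "'a measure" and M2 :: "'b measure"
    and X1 :: "'a \<Rightarrow> 'x::polish_space rooted" and X2 :: "'b \<Rightarrow> 'x rooted"
    and \<mu>1 \<mu>2 :: "'x rooted measure"
  assumes "prob_space M1" and "X1 \<in> borel_measurable M1"
    and "prob_space M2" and "X2 \<in> borel_measurable M2"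
    and "\<mu>1 = distr M1 borel X1" and "\<mu>2 = distr M2 borel X2"
  shows "(same_nonrooted_law \<mu>1 \<mu>2 \<longleftrightarrow> agree_on_invariant_events \<mu>1 \<mu>2) \<and>
    (root_change \<mu>1 \<mu>2 \<longleftrightarrow> same_network_coupling \<mu>1 \<mu>2) \<and>
    (root_change \<mu>1 \<mu>2 \<longleftrightarrow> doubly_rooted_coupling \<mu>1 \<mu>2) \<and>
    (root_change \<mu>1 \<mu>2 \<longleftrightarrow> same_nonrooted_law \<mu>1 \<mu>2) \<and>
    (root_change \<mu>1 \<mu>2 \<longrightarrow> biasing_root_change \<mu>1 \<mu>2 \<and> biasing_root_change \<mu>2 \<mu>1)"
proof -
  have prob: "prob_space \<mu>1" "prob_space \<mu>2"
    using assms by (auto intro: prob_space.prob_space_distr)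
  have sets: "sets \<mu>1 = sets borel" "sets \<mu>2 = sets borel" using assms by simp_all
  have law: "same_nonrooted_law \<mu>1 \<mu>2 \<longleftrightarrow> agree_on_invariant_events \<mu>1 \<mu>2"
    by (rule same_nonrooted_law_iff_agree[OF sets])
  have RD: "root_change \<mu>1 \<mu>2 \<Longrightarrow> doubly_rooted_coupling \<mu>1 \<mu>2"
    by (rule root_change_imp_doubly_rooted_coupling[OF sets(1) prob(1)])
  have DC: "doubly_rooted_coupling \<mu>1 \<mu>2 \<Longrightarrow> same_network_coupling \<mu>1 \<mu>2"
    by (rule doubly_rooted_imp_same_network_coupling)
  have CF: "same_network_coupling \<mu>1 \<mu>2 \<Longrightarrow> agree_on_invariant_events \<mu>1 \<mu>2"
    by (rule same_network_coupling_imp_agree)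
  have FR: "agree_on_invariant_events \<mu>1 \<mu>2 \<Longrightarrow> root_change \<mu>1 \<mu>2"
    by (rule agree_imp_root_change[OF prob sets])
  have "root_change \<mu>2 \<mu>1" if "root_change \<mu>1 \<mu>2"
  proof (rule agree_imp_root_change[OF prob(2,1) sets(2,1)])
    show "agree_on_invariant_events \<mu>2 \<mu>1"
      using CF[OF DC[OF RD[OF that]]] unfolding agree_on_invariant_events_def by simp
  qed
  then have "biasing_root_change \<mu>1 \<mu>2 \<and> biasing_root_change \<mu>2 \<mu>1" if "root_change \<mu>1 \<mu>2"
    using that root_change_imp_biasing_root_change prob by blast
  then show ?thesis using law RD DC CF FR by blast
qed

end
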